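(* Let $\Gamma$ be a finite nonempty simplicial graph and $\mathcal{G}_\Gamma$ a graph product with nontrivial vertex groups. Let $U\subseteq\mathcal{G}_\Gamma$ be any subset. Set $d=\dim(\Gamma)$, $k=\min\{|U|^2,|\Gamma^{(0)}|\}$ (where $|U|^2$ is interpreted as $\infty$ if $U$ is infinite), and $$N=\begin{cases}(6d+5)^k & \text{if no vertex group contains an element of order }2,\\ (2^{d+3}d)^k & \text{in general.}\end{cases}$$ Then: (1) If the subgroup $\langle U\rangle$ contains a regular element, then there exists an integer $1\le n\le N$ such that $U^n$ contains a regular element. (2) If $\langle U\rangle$ contains a strongly irreducible element, then there exists $1\le n\le N$ such that $U^n$ contains a strongly irreducible element. In particular $N$ can be bounded in terms of $|\Gamma^{(0)}|$ alone, or in terms of $\dim(\Gamma)$ and $|U|$ alone.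
   Context: Graph products: $\Gamma$ is a finite simplicial graph and for each vertex $v$ a nontrivial group $\mathcal{G}_v$ is given (no finite generation or countability is assumed). The graph product $\mathcal{G}_\Gamma$ is the quotient of the free product $\ast_{v\in\Gamma}\mathcal{G}_v$ by the normal subgroup generated by all commutators $[g,h]$ with $g\in\mathcal{G}_u$, $h\in\mathcal{G}_w$ and $u,w$ adjacent. Subsets $\Lambda\subseteq\Gamma^{(0)}$ are identified with the full subgraphs they span; $\mathcal{G}_\Lambda=\langle\mathcal{G}_v: v\in\Lambda\rangle$ is a standard parabolic subgroup (it is isomorphic to the graph product over $\Lambda$). $\dim(\Gamma)$ denotes the largest cardinality of a clique in $\Gamma$. Two disjoint nonempty vertex sets $\Lambda_1,\Lambda_2$ are said to be joined if every vertex of $\Lambda_1$ is adjacent to every vertex of $\Lambda_2$; then $\mathcal{G}_{\Lambda_1\cup\Lambda_2}\cong\mathcal{G}_{\Lambda_1}\times\mathcal{G}_{\Lambda_2}$. For a subset $U$ of a group and $n\ge1$, $U^n=\{u_1\cdots u_n: u_i\in U\}$. An element $g\in\mathcal{G}_\Gamma$ is strongly irreducible if $g$ is not conjugate into any vertex group $\mathcal{G}_v$, and not conjugate into any $\mathcal{G}_{\Lambda_1\cup\Lambda_2}$ with $\Lambda_1,\Lambda_2$ disjoint, nonempty and joined. An element $g$ is regular if for every $n\ge1$, $g^n$ is not conjugate into any vertex group, and not conjugate into any $\mathcal{G}_{\Lambda_1\cup\Lambda_2}$ with $\Lambda_1,\Lambda_2$ disjoint, nonempty, joined, and with both $\mathcal{G}_{\Lambda_1}$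 and $\mathcal{G}_{\Lambda_2}$ infinite. *)

theory Defs
  imports "HOL-Algebra.Algebra"
begin

definition gp_words :: "'v set \<Rightarrow> ('v \<Rightarrow> 'a monoid) \<Rightarrow> ('v \<times> 'a) list set" where
  "gp_words V G = {w. \<forall>p \<in> set w. fst p \<in> V \<and> snd p \<in> carrier (G (fst p))}"

inductive gp_step :: "'v set \<Rightarrow> ('v \<Rightarrow> 'v \<Rightarrow> bool) \<Rightarrow> ('v \<Rightarrow> 'a monoid)
    \<Rightarrow> ('v \<times> 'a) list \<Rightarrow> ('v \<times> 'a) list \<Rightarrow> bool"
  for V E G where
  drop: "\<lbrakk> xs @ (v, \<one>\<^bsub>G v\<^esub>) # ys \<in> gp_words V G \<rbrakk>
     \<Longrightarrow> gp_step V E G (xs @ (v, \<one>\<^bsub>G v\<^esub>) # ys) (xs @ ys)"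
| merge: "\<lbrakk> xs @ (v, g) # (v, h) # ys \<in> gp_words V G \<rbrakk>
     \<Longrightarrow> gp_step V E G (xs @ (v, g) # (v, h) # ys) (xs @ (v, g \<otimes>\<^bsub>G v\<^esub> h) # ys)"
| swap: "\<lbrakk> E u w; xs @ (u, g) # (w, h) # ys \<in> gp_words V G \<rbrakk>
     \<Longrightarrow> gp_step V E G (xs @ (u, g) # (w, h) # ys) (xs @ (w, h) # (u, g) # ys)"

definition gp_rel :: "'v set \<Rightarrow> ('v \<Rightarrow> 'v \<Rightarrow> bool) \<Rightarrow> ('v \<Rightarrow> 'a monoid)
    \<Rightarrow> (('v \<times> 'a) list \<times> ('v \<times> 'a) list) set" where
  "gp_rel V E G = {(a, b). a \<in> gp_words V G \<and> (symclp (gp_step V E G))\<^sup>*\<^sup>* a b}"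

definition graph_product :: "'v set \<Rightarrow> ('v \<Rightarrow> 'v \<Rightarrow> bool) \<Rightarrow> ('v \<Rightarrow> 'a monoid)
    \<Rightarrow> ('v \<times> 'a) list set monoid" where
  "graph_product V E G =
     \<lparr> carrier = gp_words V G // gp_rel V E G,
       monoid.mult = (\<lambda>A B. gp_rel V E G `` {a @ b | a b. a \<in> A \<and> b \<in> B}),
       monoid.one = gp_rel V E G `` {[]} \<rparr>"

definition parabolic :: "'v set \<Rightarrow> ('v \<Rightarrow> 'v \<Rightarrow> bool) \<Rightarrow> ('v \<Rightarrow> 'a monoid)
    \<Rightarrow> 'v set \<Rightarrow> ('v \<times> 'a) list set set" where
  "parabolic V E G L =
     {gp_rel V E G `` {w} | w. w \<in> gp_words V G \<and> (\<forall>p \<in> set w. fst p \<in> L)}"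

definition conj_into :: "('g, 'b) monoid_scheme \<Rightarrow> 'g \<Rightarrow> 'g set \<Rightarrow> bool" where
  "conj_into P x S \<longleftrightarrow> (\<exists>h \<in> carrier P. h \<otimes>\<^bsub>P\<^esub> x \<otimes>\<^bsub>P\<^esub> inv\<^bsub>P\<^esub> h \<in> S)"

definition joined :: "'v set \<Rightarrow> ('v \<Rightarrow> 'v \<Rightarrow> bool) \<Rightarrow> 'v set \<Rightarrow> 'v set \<Rightarrow> bool" where
  "joined V E L1 L2 \<longleftrightarrow> L1 \<subseteq> V \<and> L2 \<subseteq> V \<and> L1 \<noteq> {} \<and> L2 \<noteq> {} \<and> L1 \<inter> L2 = {}
     \<and> (\<forall>u \<in> L1. \<forall>w \<in> L2. E u w)"

definition strongly_irreducible :: "'v set \<Rightarrow> ('v \<Rightarrow> 'v \<Rightarrow> bool) \<Rightarrow> ('v \<Rightarrow> 'a monoid)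
    \<Rightarrow> ('v \<times> 'a) list set \<Rightarrow> bool" where
  "strongly_irreducible V E G x \<longleftrightarrow>
     x \<in> carrier (graph_product V E G)
     \<and> (\<forall>v \<in> V. \<not> conj_into (graph_product V E G) x (parabolic V E G {v}))
     \<and> (\<forall>L1 L2. joined V E L1 L2 \<longrightarrow>
          \<not> conj_into (graph_product V E G) x (parabolic V E G (L1 \<union> L2)))"

definition regular :: "'v set \<Rightarrow> ('v \<Rightarrow> 'v \<Rightarrow> bool) \<Rightarrow> ('v \<Rightarrow> 'a monoid)
    \<Rightarrow> ('v \<times> 'a) list set \<Rightarrow> bool" where
  "regular V E G x \<longleftrightarrow>
     x \<in> carrier (graph_product V E G)
     \<and> (\<forall>n::nat. n \<ge> 1 \<longrightarrow>
          (\<forall>v \<in> V. \<not> conj_into (graph_product V E G) (x [^]\<^bsub>graph_product V E G\<^esub> n)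
                      (parabolic V E G {v}))
          \<and> (\<forall>L1 L2. joined V E L1 L2 \<and> infinite (parabolic V E G L1)
                       \<and> infinite (parabolic V E G L2) \<longrightarrow>
               \<not> conj_into (graph_product V E G) (x [^]\<^bsub>graph_product V E G\<^esub> n)
                   (parabolic V E G (L1 \<union> L2))))"

definition set_power :: "('g, 'b) monoid_scheme \<Rightarrow> 'g set \<Rightarrow> nat \<Rightarrow> 'g set" where
  "set_power P U n = {foldr (\<lambda>x y. x \<otimes>\<^bsub>P\<^esub> y) xs \<one>\<^bsub>P\<^esub> | xs. length xs = n \<and> set xs \<subseteq> U}"

definition is_clique :: "('v \<Rightarrow> 'v \<Rightarrow> bool) \<Rightarrow> 'v set \<Rightarrow> bool" where
  "is_clique E C \<longleftrightarrow> (\<forall>u \<in> C. \<forall>w \<in> C. u \<noteq> w \<longrightarrow> E u w)"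

definition graph_dim :: "'v set \<Rightarrow> ('v \<Rightarrow> 'v \<Rightarrow> bool) \<Rightarrow> nat" where
  "graph_dim V E = Max {card C | C. C \<subseteq> V \<and> is_clique E C}"

end

theory Submission imports Defs Complex_Main
begin

text \<open>For every vertex \<open>v\<close>, the graph product acts on the Bass--Serre tree of its splitting as the
  amalgam of the parabolic subgroups of \<open>V - {v}\<close> and of the star of \<open>v\<close> over that of the link of
  \<open>v\<close>. An element that fixes an edge of this tree is conjugate into the link, hence elliptic in the
  tree of every vertex that is not adjacent to \<open>v\<close>. If \<open>x\<close> is strongly irreducible or regular,
  then a conjugate of \<open>x\<close> of minimal word length exhibits a set \<open>L\<close> of vertices in whose trees
  \<open>x\<close> is loxodromic, and every element that is loxodromic in the trees of \<open>L\<close> has the same property.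

  By Serre's lemma, for each \<open>v\<close> in \<open>L\<close> some product of two elements of \<open>U\<close> is loxodromic at \<open>v\<close>.
  It remains to combine two elements \<open>f\<close>, \<open>g\<close> into some \<open>f\<^sup>b g\<^sup>a\<close> that is loxodromic wherever \<open>f\<close>
  or \<open>g\<close> is. If \<open>f\<^sup>b g\<^sup>a\<close> is elliptic at \<open>v\<close>, then the axes of \<open>f\<close> and \<open>g\<close> have a long overlap,
  unless a power of \<open>f\<close> times \<open>g\<^sup>a\<close> acts like a reflection of the axis of \<open>f\<close>. Long overlaps make
  commutators of \<open>f\<close> and \<open>g\<close> fix edges, so that one fixed \<open>a\<close> and \<open>D + 1\<close> well separated exponents
  \<open>b\<close> that all fail would yield a clique of \<open>D + 1\<close> vertices, where \<open>D\<close> is the dimension.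
  Reflections do not occur without elements of order two, because then parabolic subgroups are
  closed under square roots. In general the exponents \<open>a\<close> that give reflections lie in \<open>D\<close>
  arithmetic progressions avoiding \<open>0\<close>, and such progressions miss one of any \<open>2\<^sup>D\<close> consecutive
  integers.\<close>

section \<open>Trees as integral metric spaces\<close>

text \<open>A tree is kept as an integral metric space with the four-point condition, without any
  graph structure. Most geometric claims then become linear arithmetic between a few distances.
  Parity excludes inversions and makes the midpoint of a point and its image a vertex. The exponents
  must not blow up word length. The long word built so far gets the smaller exponent
  \<open>a\<close>, which is the factor of growth; the new product of length two gets the larger
  exponent \<open>b\<close>, which only adds. If every block of \<open>K\<close> consecutive
  integers has an exponent without reflections (\<open>K = 1\<close> or \<open>K = 2 ^ D\<close>),
  then \<open>a \<le> 6 * D + 4 + K\<close> suffices: this is \<open>6 * D + 5\<close> without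
  elements of order two, and at most \<open>2 ^ (D + 3) * D\<close> in general. The exponent of
  \<open>N\<close> bounds how many products of two elements have to be combined. No normal form of
  words in the graph product is used. Deleting letters gives retractions, which control parabolic
  subgroups, and the trees consist of explicit lists on which letters act.\<close>

locale tree =
  fixes T :: "'p set" and d :: "'p \<Rightarrow> 'p \<Rightarrow> int" and col :: "'p \<Rightarrow> bool"
  assumes d_zero: "\<lbrakk>x \<in> T; y \<in> T\<rbrakk> \<Longrightarrow> d x y = 0 \<longleftrightarrow> x = y"
    and d_sym: "\<lbrakk>x \<in> T; y \<in> T\<rbrakk> \<Longrightarrow> d x y = d y x"
    and fourpt: "\<lbrakk>x \<in> T; y \<in> T; z \<in> T; w \<in> T\<rbrakk> \<Longrightarrow>
      d x y + d z w \<le> max (d x z + d y w) (d x w + d y z)"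
    and geodesic: "\<lbrakk>x \<in> T; y \<in> T; 0 \<le> k; k \<le> d x y\<rbrakk> \<Longrightarrow>
      \<exists>z\<in>T. d x z = k \<and> d z y = d x y - k"
    and parity: "\<lbrakk>x \<in> T; y \<in> T\<rbrakk> \<Longrightarrow> even (d x y) \<longleftrightarrow> col x = col y"
    and nonempty: "T \<noteq> {}"
begin

lemma d_refl [simp]: "x \<in> T \<Longrightarrow> d x x = 0"
  by (simp add: d_zero)

lemma d_nonneg: "\<lbrakk>x \<in> T; y \<in> T\<rbrakk> \<Longrightarrow> 0 \<le> d x y"
  using fourpt[of x x y y] by simp

lemma d_triangle: "\<lbrakk>x \<in> T; y \<in> T; z \<in> T\<rbrakk> \<Longrightarrow> d x y \<le> d x z + d z y"
  using fourpt[of x y z z] d_sym[of y z] by simp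

lemma d_pos: "\<lbrakk>x \<in> T; y \<in> T; x \<noteq> y\<rbrakk> \<Longrightarrow> 0 < d x y"
  using d_zero[of x y] d_nonneg[of x y] by linarith

text \<open>Two geodesics from \<open>y\<close> whose endpoints are not too far apart share their first halves.\<close>

lemma fellow:
  assumes "y \<in> T" "Z \<in> T" "Z' \<in> T" "A \<in> T" "B \<in> T"
    and "d y Z = c" "d y Z' = c" "d Z Z' \<le> c"
    and "d y A = s" "d A Z = c - s" "d y B = s" "d B Z' = c - s" "2 * s \<le> c"
  shows "A = B"
proof -
  have 1: "d A Z' + d y Z \<le> max (d A y + d Z' Z) (d A Z + d Z' y)"
    using assms by (intro fourpt) auto
  have 2: "d A B + d y Z' \<le> max (d A y + d B Z') (d A Z' + d B y)"
    using assms by (intro fourpt) auto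
  have "d A B \<le> 0"
    using 1 2 assms d_sym[of A y] d_sym[of Z' Z] d_sym[of Z' y] d_sym[of B y] by linarith
  then show ?thesis
    using assms d_pos by fastforce
qed

text \<open>The four-point condition gives \<open>d A B \<le> 0\<close>. This is how geodesics are
  seen to be unique without mentioning paths.\<close>

lemma between_unique:
  assumes "x \<in> T" "y \<in> T" "A \<in> T" "B \<in> T"
    and "d x A + d A y = d x y" "d x B = d x A" "d B y = d A y"
  shows "A = B"
proof -
  have "d A B + d x y \<le> max (d A x + d B y) (d A y + d B x)"
    using assms by (intro fourpt) auto
  then have "d A B \<le> 0"
    using assms d_sym[of A x] d_sym[of B x] by linarith
  then show ?thesis
    using assms d_pos by fastforce
qed

text \<open>Preserving the colour rules out inversions of edges, so displacements are even.\<close>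

definition aut :: "('p \<Rightarrow> 'p) \<Rightarrow> bool" where
  "aut f \<longleftrightarrow> bij_betw f T T \<and> (\<forall>x\<in>T. \<forall>y\<in>T. d (f x) (f y) = d x y) \<and> (\<forall>x\<in>T. col (f x) = col x)"

definition ell :: "('p \<Rightarrow> 'p) \<Rightarrow> bool" where
  "ell f \<longleftrightarrow> (\<exists>x\<in>T. f x = x)"

definition fixes_edge :: "('p \<Rightarrow> 'p) \<Rightarrow> bool" where
  "fixes_edge f \<longleftrightarrow> (\<exists>x\<in>T. \<exists>y\<in>T. d x y = 1 \<and> f x = x \<and> f y = y)"

lemma fixes_edge_ell: "fixes_edge f \<Longrightarrow> ell f"
  by (auto simp: fixes_edge_def ell_def)

lemma aut_mem [simp]: "\<lbrakk>aut f; x \<in> T\<rbrakk> \<Longrightarrow> f x \<in> T"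
  unfolding aut_def using bij_betwE by blast

lemma aut_d [simp]: "\<lbrakk>aut f; x \<in> T; y \<in> T\<rbrakk> \<Longrightarrow> d (f x) (f y) = d x y"
  by (simp add: aut_def)

lemma aut_inj: "\<lbrakk>aut f; x \<in> T; y \<in> T; f x = f y\<rbrakk> \<Longrightarrow> x = y"
  by (meson aut_def bij_betw_imp_inj_on inj_onD)

lemma aut_comp [simp]:
  assumes "aut f" "aut g" shows "aut (f \<circ> g)"
proof -
  have "bij_betw (f \<circ> g) T T"
    using assms bij_betw_trans by (auto simp: aut_def)
  moreover have "\<forall>x\<in>T. col ((f \<circ> g) x) = col x"
    using assms aut_mem[OF assms(2)] by (simp add: aut_def)
  ultimately show ?thesis
    using assms unfolding aut_def[of "f \<circ> g"] by simp
qed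

lemma aut_id [simp]: "aut id"
  by (auto simp: aut_def)

lemma aut_funpow [simp]: "aut f \<Longrightarrow> aut (f ^^ n)"
  by (induction n) auto

lemma aut_even: "\<lbrakk>aut f; x \<in> T\<rbrakk> \<Longrightarrow> even (d x (f x))"
  using parity[of x "f x"] aut_mem[of f x] by (simp add: aut_def)

lemma aut_inv_into:
  assumes "aut f" shows "aut (inv_into T f)"
proof -
  have b: "bij_betw (inv_into T f) T T"
    using assms bij_betw_inv_into by (auto simp: aut_def)
  have 1: "inv_into T f x \<in> T" if "x \<in> T" for x
    using b that bij_betwE by blast
  have 2: "f (inv_into T f x) = x" if "x \<in> T" for x
    using assms that by (auto simp: aut_def bij_betw_def f_inv_into_f)
  show ?thesis
    unfolding aut_def
  proof (intro conjI ballI b)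
    show "d (inv_into T f x) (inv_into T f y) = d x y" if "x \<in> T" "y \<in> T" for x y
      using aut_d[OF assms 1 1] 2 that by simp
    show "col (inv_into T f x) = col x" if "x \<in> T" for x
      using assms 1[OF that] 2[OF that] unfolding aut_def by metis
  qed
qed

text \<open>In the four-point inequality for \<open>x\<close>, \<open>w (w x)\<close>, the fixed
  point \<open>q\<close> and \<open>w x\<close>, both alternatives equal
  \<open>d x q + d x (w x)\<close>. Together with \<open>midpoint_fixed\<close> this turns
  ellipticity into an inequality at an arbitrary base point.\<close>

lemma ell_d_le:
  assumes "aut w" "ell w" "x \<in> T"
  shows "d x (w (w x)) \<le> d x (w x)"
proof -
  obtain q where q: "q \<in> T" "w q = q"
    using assms by (auto simp: ell_def)
  have e: "d (w x) q = d x q" "d (w (w x)) q = d x q" "d (w x) (w (w x)) = d x (w x)"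
    using assms q by (metis aut_d aut_mem)+
  have "d x (w (w x)) + d q (w x) \<le> max (d x q + d (w (w x)) (w x)) (d x (w x) + d (w (w x)) q)"
    using assms q by (intro fourpt) auto
  then show ?thesis
    using e assms q d_sym[of q "w x"] d_sym[of "w (w x)" "w x"] by auto
qed

text \<open>The geodesics from \<open>w x\<close> to \<open>x\<close> and to \<open>w (w x)\<close>
  have equal length, and their ends are no farther apart than that, so \<open>fellow\<close>
  identifies their midpoints \<open>m\<close> and \<open>w m\<close>.\<close>

lemma midpoint_fixed:
  assumes "aut w" "x \<in> T" "d x (w (w x)) \<le> d x (w x)"
    and "m \<in> T" "2 * d x m = d x (w x)" "2 * d m (w x) = d x (w x)"
  shows "w m = m"
proof -
  have e: "d (w x) (w m) = d x m" "d (w m) (w (w x)) = d m (w x)" "d (w x) (w (w x)) = d x (w x)"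
    using assms by simp_all
  have "m = w m"
    by (rule fellow[of "w x" x "w (w x)" m "w m" "d x (w x)" "d x m"])
       (use assms e d_sym[of m "w x"] d_sym[of "w x" x] d_sym[of m x] in auto)
  then show ?thesis by simp
qed

lemma midpoint_ex:
  assumes "aut w" "x \<in> T"
  obtains m where "m \<in> T" "2 * d x m = d x (w x)" "2 * d m (w x) = d x (w x)"
proof -
  obtain k where k: "d x (w x) = 2 * k"
    using aut_even[OF assms] by auto
  have "0 \<le> k"
    using k d_nonneg[of x "w x"] assms by auto
  with k geodesic[of x "w x" k] assms that show ?thesis
    by fastforce
qed

text \<open>Serre's lemma: the fixed point is the projection of the base point to the farthest fixed subtree.\<close>

lemma serre_pair:
  assumes u: "aut u" "ell u" and u': "aut u'" "ell u'" and uu': "ell (u' \<circ> u)"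
    and q0: "q0 \<in> T" and le: "d q0 (u' q0) \<le> d q0 (u q0)"
    and p: "p \<in> T" "2 * d q0 p = d q0 (u q0)" "2 * d p (u q0) = d q0 (u q0)"
  shows "u' p = p"
proof (rule ccontr)
  assume ne: "u' p \<noteq> p"
  let ?w = "u' \<circ> u"
  have up: "u p = p"
    using midpoint_fixed[OF u(1) q0 _ p] ell_d_le[OF u q0] by blast
  \<comment> \<open>\<open>z\<close> is the projection of \<open>p\<close> to the fixed tree of
    \<open>u'\<close>. Ellipticity of the product will make \<open>u\<close> fix \<open>z\<close>
    too.\<close>
  obtain z where z: "z \<in> T" "2 * d p z = d p (u' p)" "2 * d z (u' p) = d p (u' p)"
    using midpoint_ex[OF u'(1) p(1)] by blast
  have u'z: "u' z = z"
    using midpoint_fixed[OF u'(1) p(1) ell_d_le[OF u' p(1)]] z by blast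
  have wp: "?w p = u' p" using up by simp
  have le2: "d p (?w (?w p)) \<le> d p (?w p)"
    using ell_d_le[of ?w p] u u' uu' p by simp
  have 1: "d (u' p) (?w (?w p)) = d p (u' p)"
    using u u' p wp by (metis aut_d aut_mem up comp_apply)
  have 2: "d (u' p) (u' (u z)) = d p z"
    using u u' p z up by (metis aut_d aut_mem)
  have 3: "d (u' (u z)) (?w (?w p)) = d z (u' p)"
    using u u' p z wp by (metis aut_d aut_mem comp_apply)
  have "z = u' (u z)"
    by (rule fellow[of "u' p" p "?w (?w p)" z "u' (u z)" "d p (u' p)" "d p z"])
     (use u u' p z wp le2 1 2 3 d_sym[of "u' p" p] d_sym[of "u' p" z] d_sym[of z p] in auto)
  then have uz: "u z = z"
    using u'z u u' z aut_inj[of u' "u z" z] by auto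
  \<comment> \<open>\<open>p\<close> is the midpoint of \<open>q0\<close> and \<open>u q0\<close>,
    and \<open>u\<close> fixes \<open>z\<close>, so \<open>p\<close> lies between \<open>q0\<close>
    and \<open>z\<close>. As \<open>z\<close> lies beyond \<open>p\<close> by \<open>t > 0\<close>,
    \<open>u'\<close> moves \<open>q0\<close> by at least \<open>2 * r + 2 * t\<close>, more than
    \<open>u\<close> does.\<close>
  define r where "r = d q0 p"
  define t where "t = d p z"
  have tpos: "t > 0"
    using d_pos[of p "u' p"] ne z u' p by (auto simp: t_def)
  have a1: "d z p + d q0 (u q0) \<le> max (d z q0 + d p (u q0)) (d z (u q0) + d p q0)"
    using z p q0 u by (intro fourpt) auto
  have a2: "d z (u q0) = d z q0"
    using uz aut_d[OF u(1) z(1) q0] by simp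
  have oz: "d q0 z \<ge> r + t"
    using a1 a2 p z q0 u d_sym[of q0 z] d_sym[of p q0] d_sym[of z p] by (auto simp: r_def t_def)
  have oz': "d q0 z \<le> r + t"
    using d_triangle[of q0 z p] q0 z p by (auto simp: r_def t_def)
  have a3: "d q0 z + d p (u' p) \<le> max (d q0 p + d z (u' p)) (d q0 (u' p) + d z p)"
    using z p q0 u' by (intro fourpt) auto
  have b3: "d q0 (u' p) \<ge> r + 2 * t"
    using a3 oz z tpos d_sym[of z p] p by (auto simp: r_def t_def)
  have a4: "d q0 (u' p) + d z (u' q0) \<le> max (d q0 z + d (u' p) (u' q0)) (d q0 (u' q0) + d (u' p) z)"
    using z p q0 u' by (intro fourpt) auto
  have a5: "d z (u' q0) = d z q0" "d (u' p) (u' q0) = d p q0"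
    using u'z aut_d[OF u'(1) z(1) q0] aut_d[OF u'(1) p(1) q0] by simp_all
  have "d q0 (u' q0) \<ge> 2 * r + 2 * t"
    using a4 a5 b3 oz oz' z tpos d_sym[of z p] d_sym[of p q0] d_sym[of z q0] d_sym[of "u' p" z] p q0 u'
    by (auto simp: r_def t_def)
  then show False
    using le p tpos by (auto simp: r_def t_def)
qed

end

section \<open>Lines, projections to a line, and axes of automorphisms without fixed points\<close>

context tree begin

definition line :: "(int \<Rightarrow> 'p) \<Rightarrow> bool" where
  "line \<alpha> \<longleftrightarrow> (\<forall>i. \<alpha> i \<in> T) \<and> (\<forall>i j. d (\<alpha> i) (\<alpha> j) = \<bar>i - j\<bar>)"

definition axis :: "('p \<Rightarrow> 'p) \<Rightarrow> (int \<Rightarrow> 'p) \<Rightarrow> int \<Rightarrow> bool" where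
  "axis f \<alpha> l \<longleftrightarrow> line \<alpha> \<and> 0 < l \<and> (\<forall>i. f (\<alpha> i) = \<alpha> (i + l))"

text \<open>\<open>p\<close> is the projection of \<open>y\<close> to the line, and \<open>D\<close> its distance from the line.\<close>

definition near :: "'p \<Rightarrow> (int \<Rightarrow> 'p) \<Rightarrow> int \<Rightarrow> int \<Rightarrow> bool" where
  "near y \<alpha> p D \<longleftrightarrow> y \<in> T \<and> 0 \<le> D \<and> (\<forall>i. d y (\<alpha> i) = D + \<bar>i - p\<bar>)"

lemma line_mem [simp]: "line \<alpha> \<Longrightarrow> \<alpha> i \<in> T"
  by (simp add: line_def)

lemma line_d: "line \<alpha> \<Longrightarrow> d (\<alpha> i) (\<alpha> j) = \<bar>i - j\<bar>"
  by (simp add: line_def)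

lemma line_inj: "line \<alpha> \<Longrightarrow> \<alpha> i = \<alpha> j \<Longrightarrow> i = j"
  using line_d[of \<alpha> i j] line_mem[of \<alpha> j] by simp

lemma near_mem: "near y \<alpha> p D \<Longrightarrow> y \<in> T"
  by (simp add: near_def)

lemma near_d: "near y \<alpha> p D \<Longrightarrow> d y (\<alpha> i) = D + \<bar>i - p\<bar>"
  by (simp add: near_def)

text \<open>By parity the distance from \<open>y\<close> cannot stay constant along an edge, so it
  leaves its minimum with slope one. The four-point condition at three consecutive points of the
  line then forbids any later turn.\<close>

lemma near_aux:
  assumes l: "line \<alpha>" and y: "y \<in> T" and min: "\<And>i. d y (\<alpha> p) \<le> d y (\<alpha> i)"
  shows "d y (\<alpha> (p + int n)) = d y (\<alpha> p) + int n"
proof (induction n rule: less_induct)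
  case (less n)
  consider "n = 0" | "n = 1" | m where "n = Suc (Suc m)"
    by (metis One_nat_def nat.exhaust)
  then show ?case
  proof cases
    case 1
    then show ?thesis by simp
  next
    case 2
    have "d y (\<alpha> (p + 1)) \<le> d y (\<alpha> p) + 1"
      using d_triangle[of y "\<alpha> (p + 1)" "\<alpha> p"] l y by (simp add: line_d)
    moreover have "even (d y (\<alpha> (p + 1))) \<noteq> even (d y (\<alpha> p))"
      using parity[of "\<alpha> p" "\<alpha> (p + 1)"] parity[of y "\<alpha> p"] parity[of y "\<alpha> (p + 1)"] l y
      by (simp add: line_d)
    ultimately show ?thesis
      using min[of "p + 1"] 2 by (metis add_left_cancel dual_order.antisym int_one_le_iff_zero_less
          linorder_not_le of_nat_1 zless_imp_add1_zle)
  next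
    case 3
    let ?i = "p + int (Suc m)"
    have 1: "d y (\<alpha> ?i) = d y (\<alpha> p) + int (Suc m)" "d y (\<alpha> (?i - 1)) = d y (\<alpha> p) + int m"
      using less.IH[of "Suc m"] less.IH[of m] 3 by simp_all
    have 2: "d y (\<alpha> ?i) + d (\<alpha> (?i - 1)) (\<alpha> (?i + 1)) \<le>
        max (d y (\<alpha> (?i - 1)) + d (\<alpha> ?i) (\<alpha> (?i + 1))) (d y (\<alpha> (?i + 1)) + d (\<alpha> ?i) (\<alpha> (?i - 1)))"
      using l y by (intro fourpt) auto
    have t3: "d y (\<alpha> (?i + 1)) \<le> d y (\<alpha> ?i) + 1"
      using d_triangle[of y "\<alpha> (?i + 1)" "\<alpha> ?i"] l y by (simp add: line_d)
    have e: "d (\<alpha> (?i - 1)) (\<alpha> (?i + 1)) = 2" "d (\<alpha> ?i) (\<alpha> (?i + 1)) = 1" "d (\<alpha> ?i) (\<alpha> (?i - 1)) = 1"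
      using l by (simp_all add: line_d)
    have "d y (\<alpha> (?i + 1)) = d y (\<alpha> p) + int n"
      using 1 2 3 t3 unfolding e by linarith
    then show ?thesis using 3 by (simp add: add.commute add.left_commute)
  qed
qed

lemma line_uminus: "line \<alpha> \<Longrightarrow> line (\<lambda>i. \<alpha> (- i))"
  by (simp add: line_def abs_minus_commute)

lemma near_ex:
  assumes l: "line \<alpha>" and y: "y \<in> T"
  obtains p D where "near y \<alpha> p D"
proof -
  obtain p where p: "\<And>i. nat (d y (\<alpha> p)) \<le> nat (d y (\<alpha> i))"
    using ex_has_least_nat[of "\<lambda>_. True" undefined "\<lambda>i. nat (d y (\<alpha> i))"] by auto
  have m: "d y (\<alpha> p) \<le> d y (\<alpha> i)" for i
    using p[of i] d_nonneg[of y "\<alpha> i"] l y by simp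
  have "d y (\<alpha> i) = d y (\<alpha> p) + \<bar>i - p\<bar>" for i
  proof (cases "p \<le> i")
    case True
    then show ?thesis using near_aux[OF l y m, of "nat (i - p)"] by simp
  next
    case False
    then show ?thesis
      using near_aux[OF line_uminus[OF l] y, of "-p" "nat (p - i)"] m by simp
  qed
  then have "near y \<alpha> p (d y (\<alpha> p))"
    unfolding near_def using y d_nonneg[OF y line_mem[OF l]] by blast
  then show ?thesis by (rule that)
qed

lemma near_unique:
  assumes "near y \<alpha> p D" "near y \<alpha> p' D'" shows "p = p' \<and> D = D'"
proof -
  have "D = D' + \<bar>p - p'\<bar>" "D + \<bar>p' - p\<bar> = D'"
    using near_d[OF assms(1), of p] near_d[OF assms(2), of p]
      near_d[OF assms(1), of p'] near_d[OF assms(2), of p'] by simp_all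
  then show ?thesis by (auto simp: abs_if split: if_splits)
qed

lemma near_zero: "near y \<alpha> p 0 \<Longrightarrow> line \<alpha> \<Longrightarrow> y = \<alpha> p"
  using near_d[of y \<alpha> p 0 p] d_zero[OF near_mem line_mem] by simp

text \<open>Distinct feet force the geodesic from \<open>y\<close> to \<open>y'\<close> to run along
  the line between them; with equal feet the two bridges could share a piece.\<close>

lemma near_dist:
  assumes "line \<alpha>" "near y \<alpha> p D" "near y' \<alpha> p' D'" "p \<noteq> p'"
  shows "d y y' = D + D' + \<bar>p - p'\<bar>"
proof -
  have m: "y \<in> T" "y' \<in> T" using assms near_mem by auto
  have 1: "d y (\<alpha> p') + d (\<alpha> p) y' \<le> max (d y (\<alpha> p) + d (\<alpha> p') y') (d y y' + d (\<alpha> p') (\<alpha> p))"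
    using assms m by (intro fourpt) auto
  have 2: "d y y' \<le> d y (\<alpha> p) + d (\<alpha> p) y'"
    using assms m by (intro d_triangle) auto
  have e: "d y (\<alpha> p') = D + \<bar>p' - p\<bar>" "d (\<alpha> p) y' = D' + \<bar>p - p'\<bar>" "d y (\<alpha> p) = D"
    "d (\<alpha> p') y' = D'" "d (\<alpha> p') (\<alpha> p) = \<bar>p' - p\<bar>"
    using near_d[OF assms(2), of p] near_d[OF assms(2), of p'] near_d[OF assms(3), of p]
      near_d[OF assms(3), of p'] d_sym[OF m(2) line_mem[OF assms(1)], of p]
      d_sym[OF m(2) line_mem[OF assms(1)], of p'] line_d[OF assms(1), of p' p] by simp_all
  show ?thesis
    using 1 2 assms(4) unfolding e by (auto simp: max_def split: if_splits)
qed

lemma axis_line: "axis f \<alpha> l \<Longrightarrow> line \<alpha>"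
  by (simp add: axis_def)

lemma axis_pow: "axis f \<alpha> l \<Longrightarrow> (f ^^ n) (\<alpha> i) = \<alpha> (i + int n * l)"
proof (induction n)
  case (Suc n)
  then have "(f ^^ Suc n) (\<alpha> i) = \<alpha> (i + int n * l + l)" by (simp add: axis_def)
  then show ?case by (simp add: algebra_simps)
qed simp

lemma axis_funpow: "axis f \<alpha> l \<Longrightarrow> 0 < n \<Longrightarrow> axis (f ^^ n) \<alpha> (int n * l)"
  using axis_pow[of f \<alpha> l n] unfolding axis_def by simp

lemma near_aut:
  assumes "aut f" "axis f \<alpha> l" "near y \<alpha> p D"
  shows "near (f y) \<alpha> (p + l) D"
proof -
  have "d (f y) (\<alpha> i) = D + \<bar>i - (p + l)\<bar>" for i
  proof -
    have "\<alpha> i = f (\<alpha> (i - l))" using assms by (simp add: axis_def)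
    then have "d (f y) (\<alpha> i) = d y (\<alpha> (i - l))"
      using assms near_mem axis_line by (metis aut_d line_mem)
    then show ?thesis using near_d[OF assms(3)] by (simp add: algebra_simps)
  qed
  moreover have "f y \<in> T" "0 \<le> D" using assms by (auto simp: near_def)
  ultimately show ?thesis unfolding near_def by blast
qed

lemma near_funpow:
  assumes "aut f" "axis f \<alpha> l" "near y \<alpha> p D"
  shows "near ((f ^^ n) y) \<alpha> (p + int n * l) D"
proof (induction n)
  case (Suc n)
  show ?case using near_aut[OF assms(1,2) Suc] by (simp add: algebra_simps)
qed (use assms in simp)

lemma near_funpow_inv:
  assumes "aut f" "axis f \<alpha> l" "near ((f ^^ n) y) \<alpha> p D" "y \<in> T"
  shows "near y \<alpha> (p - int n * l) D"
proof -
  obtain p' D' where n: "near y \<alpha> p' D'"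
    using near_ex assms axis_line by metis
  then show ?thesis
    using near_unique[OF near_funpow[OF assms(1,2) n] assms(3)] by auto
qed

lemma axis_not_ell:
  assumes "aut f" "axis f \<alpha> l" shows "\<not> ell f"
proof
  assume "ell f"
  then obtain q where q: "q \<in> T" "f q = q" by (auto simp: ell_def)
  obtain p D where n: "near q \<alpha> p D" using near_ex axis_line assms q by metis
  show False
    using near_unique[OF n near_aut[OF assms n, unfolded q]] assms by (simp add: axis_def)
qed

text \<open>Negative powers are needed because an axis extends to both ends.\<close>

definition zpow :: "('p \<Rightarrow> 'p) \<Rightarrow> int \<Rightarrow> 'p \<Rightarrow> 'p" where
  "zpow f i = (if 0 \<le> i then f ^^ nat i else inv_into T f ^^ nat (- i))"

lemma zpow_mem: "aut f \<Longrightarrow> x \<in> T \<Longrightarrow> zpow f i x \<in> T"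
  by (simp add: zpow_def aut_inv_into)

lemma zpow_step:
  assumes "aut f" "x \<in> T" shows "f (zpow f i x) = zpow f (i + 1) x"
proof (cases "0 \<le> i")
  case True
  then show ?thesis by (simp add: zpow_def nat_add_distrib)
next
  case False
  then obtain n where i: "i = - int (Suc n)"
    by (metis int_cases neg_0_le_iff_le of_nat_0_le_iff)
  let ?y = "(inv_into T f ^^ n) x"
  have "?y \<in> T" using assms aut_mem[OF aut_funpow[OF aut_inv_into]] by blast
  then have "f (inv_into T f ?y) = ?y"
    using assms unfolding aut_def by (metis bij_betw_inv_into_right)
  then show ?thesis
    using i by (cases n) (auto simp: zpow_def nat_add_distrib)
qed

text \<open>At a point \<open>x\<close> of least displacement the path through \<open>x\<close>,
  \<open>f x\<close>, \<open>f (f x)\<close> cannot turn back at \<open>f x\<close>, because then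
  the midpoint \<open>m\<close> of \<open>x\<close> and \<open>f x\<close> would be moved less than
  \<open>x\<close>.\<close>

lemma min_displacement:
  assumes f: "aut f" "\<not> ell f"
  obtains x where "x \<in> T" "0 < d x (f x)" "d x (f (f x)) = 2 * d x (f x)"
proof -
  obtain x0 where "x0 \<in> T" using nonempty by auto
  then obtain x where x: "x \<in> T" "\<And>y. y \<in> T \<Longrightarrow> nat (d x (f x)) \<le> nat (d y (f y))"
    using ex_has_least_nat[of "\<lambda>x. x \<in> T" x0 "\<lambda>x. nat (d x (f x))"] by auto
  obtain m where m: "m \<in> T" "2 * d x m = d x (f x)" "2 * d m (f x) = d x (f x)"
    using midpoint_ex[OF f(1) x(1)] .
  define k where "k = d x m"
  have pos: "0 < d x (f x)"
    using d_pos[of x "f x"] f x unfolding ell_def by fastforce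
  have k: "0 < k" "d x (f x) = 2 * k" "d m (f x) = k"
    using m pos by (auto simp: k_def)
  have km: "d x m = k" by (simp add: k_def)
  have fm: "f x \<in> T" "f m \<in> T" "f (f x) \<in> T" using f x m by simp_all
  have e: "d (f x) (f m) = k" "d (f m) (f (f x)) = k" "d (f x) (f (f x)) = 2 * k"
    using aut_d[OF f(1) x(1) m(1)] aut_d[OF f(1) m(1) fm(1)] aut_d[OF f(1) x(1) fm(1)] km k
    by linarith+
  have mm: "2 * k \<le> d m (f m)"
    using x(2)[OF m(1)] k(2) d_nonneg[OF m(1) fm(2)] by linarith
  have 1: "d x (f x) + d m (f m) \<le> max (d x m + d (f x) (f m)) (d x (f m) + d (f x) m)"
    by (intro fourpt x m fm)
  have 2: "d x (f m) + d (f x) (f (f x)) \<le> max (d x (f x) + d (f m) (f (f x))) (d x (f (f x)) + d (f m) (f x))"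
    by (intro fourpt x m fm)
  have 3: "d x (f (f x)) \<le> d x (f x) + d (f x) (f (f x))"
    by (intro d_triangle x fm)
  have "d x (f (f x)) = 4 * k"
    using 1 2 3 mm k e km d_sym[OF fm(1) m(1)] d_sym[OF fm(2) fm(1)] by linarith
  then have "d x (f (f x)) = 2 * d x (f x)" using k(2) by linarith
  then show ?thesis using that x(1) pos by blast
qed

text \<open>The absence of backtracking propagates along the orbit: the four-point condition on
  \<open>x\<close>, \<open>f x\<close> and two consecutive later points makes each step add the full
  displacement.\<close>

lemma displacement_pow:
  assumes f: "aut f" and x: "x \<in> T" "0 < d x (f x)" "d x (f (f x)) = 2 * d x (f x)"
  shows "d x ((f ^^ n) x) = int n * d x (f x)"
proof (induction n rule: less_induct)
  case (less n)
  consider "n = 0" | "n = 1" | "n = 2" | m where "n = Suc (Suc (Suc m))"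
    by (metis One_nat_def Suc_1 nat.exhaust)
  then show ?case
  proof cases
    case 1
    then show ?thesis using x by simp
  next
    case 2
    then show ?thesis by simp
  next
    case 3
    then show ?thesis using x by (simp add: numeral_2_eq_2)
  next
    case 4
    let ?p = "\<lambda>n. (f ^^ n) x"
    have mem: "?p n \<in> T" for n using f x by simp
    have s: "d (f x) (?p (Suc n)) = d x (?p n)" for n using f x mem by simp
    have t: "d (?p (Suc (Suc m))) (?p (Suc (Suc (Suc m)))) = d x (f x)"
      using f x aut_d[OF aut_funpow[OF f], of x "f x" "Suc (Suc m)"]
      by (metis aut_mem comp_apply funpow.simps(2) funpow_swap1)
    have "d x (?p (Suc (Suc m))) + d (f x) (?p (Suc (Suc (Suc m)))) \<le>
      max (d x (f x) + d (?p (Suc (Suc m))) (?p (Suc (Suc (Suc m)))))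
          (d x (?p (Suc (Suc (Suc m)))) + d (?p (Suc (Suc m))) (f x))"
      using x(1) f mem by (intro fourpt) auto
    moreover have "d (?p (Suc (Suc m))) (f x) = d x (?p (Suc m))"
      using s[of "Suc m"] d_sym mem x f by simp
    moreover define P where "P = d x (f x)"
    moreover define M where "M = int m * P"
    have "d x (?p (Suc (Suc m))) = M + 2 * P" "d x (?p (Suc m)) = M + P"
      using less.IH[of "Suc (Suc m)"] less.IH[of "Suc m"] 4
      unfolding M_def P_def by (simp_all add: distrib_right)
    moreover have "d x (?p (Suc (Suc (Suc m)))) \<le> d x (?p (Suc (Suc m))) + d x (f x)"
      using d_triangle[OF x(1) mem[of "Suc (Suc (Suc m))"] mem[of "Suc (Suc m)"]] unfolding t .
    moreover have "0 \<le> M" using x by (simp add: M_def P_def)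
    moreover have "int n * P = M + 3 * P"
      by (simp add: 4 M_def distrib_right)
    ultimately have "d x (?p (Suc (Suc (Suc m)))) = int n * P"
      unfolding s t using x(2) by linarith
    then show ?thesis using 4 P_def by simp
  qed
qed

lemma geodesic_path:
  assumes "x \<in> T" "y \<in> T"
  obtains \<sigma> :: "int \<Rightarrow> 'p" where "\<sigma> 0 = x" "\<sigma> (d x y) = y" "\<And>i. \<lbrakk>0 \<le> i; i \<le> d x y\<rbrakk> \<Longrightarrow> \<sigma> i \<in> T"
    "\<And>i j. \<lbrakk>0 \<le> i; i \<le> j; j \<le> d x y\<rbrakk> \<Longrightarrow> d (\<sigma> i) (\<sigma> j) = j - i"
proof -
  obtain \<sigma> where s: "\<And>k. \<lbrakk>0 \<le> k; k \<le> d x y\<rbrakk> \<Longrightarrow> \<sigma> k \<in> T \<and> d x (\<sigma> k) = k \<and> d (\<sigma> k) y = d x y - k"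
    using geodesic[OF assms] by metis
  have 0: "\<sigma> 0 = x" "\<sigma> (d x y) = y"
    using s[of 0] s[of "d x y"] assms d_nonneg d_zero by fastforce+
  have "d (\<sigma> i) (\<sigma> j) = j - i" if ij: "0 \<le> i" "i \<le> j" "j \<le> d x y" for i j
  proof -
    have si: "\<sigma> i \<in> T" "d x (\<sigma> i) = i" "d (\<sigma> i) y = d x y - i"
      and sj: "\<sigma> j \<in> T" "d x (\<sigma> j) = j" "d (\<sigma> j) y = d x y - j"
      using s ij by auto
    obtain z where z: "z \<in> T" "d x z = i" "d z (\<sigma> j) = j - i"
      using geodesic[of x "\<sigma> j" i] sj assms ij by auto
    have "d z y \<le> d x y - i" "d x y \<le> i + d z y"
      using d_triangle[of z y "\<sigma> j"] d_triangle[of x y z] z sj assms by auto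
    then have "z = \<sigma> i"
      using between_unique[of x y z "\<sigma> i"] z si assms by auto
    then show ?thesis using z by simp
  qed
  then show ?thesis using that[of \<sigma>] 0 s by blast
qed

lemma not_ell_axis:
  assumes f: "aut f" "\<not> ell f"
  obtains \<alpha> l where "axis f \<alpha> l"
proof -
  obtain x where x: "x \<in> T" "0 < d x (f x)" "d x (f (f x)) = 2 * d x (f x)"
    using min_displacement[OF f] .
  define l where "l = d x (f x)"
  have l: "0 < l" using x by (simp add: l_def)
  obtain \<sigma> where s: "\<sigma> 0 = x" "\<sigma> l = f x" "\<And>i. \<lbrakk>0 \<le> i; i \<le> l\<rbrakk> \<Longrightarrow> \<sigma> i \<in> T"
    "\<And>i j. \<lbrakk>0 \<le> i; i \<le> j; j \<le> l\<rbrakk> \<Longrightarrow> d (\<sigma> i) (\<sigma> j) = j - i"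
    using geodesic_path[of x "f x"] x f unfolding l_def by (metis aut_mem)
  \<comment> \<open>The axis is the concatenation of the translates of the segment from
    \<open>x\<close> to \<open>f x\<close>: \<open>i div l\<close> selects the translate and
    \<open>i mod l\<close> the position in it.\<close>
  define \<alpha> where "\<alpha> i = zpow f (i div l) (\<sigma> (i mod l))" for i
  have sm: "\<sigma> (i mod l) \<in> T" for i using s(3)[of "i mod l"] l by (simp add: order.strict_implies_order)
  have mem: "\<alpha> i \<in> T" for i unfolding \<alpha>_def by (rule zpow_mem[OF f(1) sm])
  have step: "f (\<alpha> i) = \<alpha> (i + l)" for i
    unfolding \<alpha>_def using zpow_step[OF f(1) sm, of "i div l" i] l by simp
  have shift: "d (\<alpha> (i + int n * l)) (\<alpha> (j + int n * l)) = d (\<alpha> i) (\<alpha> j)" for i j n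
  proof (induction n)
    case (Suc n)
    have "d (\<alpha> (i + int (Suc n) * l)) (\<alpha> (j + int (Suc n) * l)) = d (f (\<alpha> (i + int n * l))) (f (\<alpha> (j + int n * l)))"
      by (simp add: step algebra_simps)
    then show ?case using Suc f mem by simp
  qed simp
  have base: "\<alpha> i = \<sigma> i" if "0 \<le> i" "i \<le> l" for i
  proof (cases "i = l")
    case True
    then show ?thesis using l s zpow_step[OF f(1) x(1), of 0] by (simp add: \<alpha>_def zpow_def)
  next
    case False
    then show ?thesis using that by (simp add: \<alpha>_def zpow_def)
  qed
  have unit: "d (\<alpha> i) (\<alpha> (i + 1)) = 1" for i
  proof -
    let ?r = "i mod l"
    have "d (\<alpha> ?r) (\<alpha> (?r + 1)) = 1"
      using base[of ?r] base[of "?r + 1"] s(4)[of ?r "?r + 1"] l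
      by (simp add: order.strict_implies_order zless_imp_add1_zle)
    moreover have "i = ?r + (i div l) * l" by simp
    then have "\<exists>n. i = ?r + int n * l \<or> ?r = i + int n * l"
      by (cases "0 \<le> i div l")
        (metis int_nat_eq, metis (no_types, opaque_lifting) add_diff_cancel_right' diff_conv_add_uminus
          int_nat_eq linorder_not_le minus_mult_left neg_0_le_iff_le order.strict_implies_order)
    then obtain n where "i = ?r + int n * l \<or> ?r = i + int n * l" ..
    then have "i = ?r + int n * l \<and> i + 1 = ?r + 1 + int n * l \<or>
        ?r = i + int n * l \<and> ?r + 1 = i + 1 + int n * l"
      by linarith
    ultimately show ?thesis
      using shift[of ?r n "?r + 1"] shift[of i n "i + 1"] by metis
  qed
  have upper: "d (\<alpha> i) (\<alpha> (i + int n)) \<le> int n" for i n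
  proof (induction n)
    case (Suc n)
    then show ?case
      using d_triangle[of "\<alpha> i" "\<alpha> (i + int (Suc n))" "\<alpha> (i + int n)"] unit[of "i + int n"] mem
      by (simp add: algebra_simps)
  qed (simp add: mem)
  have pow: "\<alpha> (int n * l) = (f ^^ n) x" for n
  proof (induction n)
    case 0 then show ?case using base[of 0] l s by simp
  next
    case (Suc n)
    then show ?case using step[of "int n * l"] by (simp add: algebra_simps)
  qed
  \<comment> \<open>Unit steps give only upper bounds. By \<open>displacement_pow\<close> they are
    sharp between two far points of the orbit of \<open>x\<close>, hence between all points on the
    way.\<close>
  have "d (\<alpha> i) (\<alpha> j) = j - i" if "i \<le> j" for i j
  proof -
    define n where "n = nat (\<bar>i\<bar> + \<bar>j\<bar>)"
    have n: "- (int n * l) \<le> i" "j \<le> int n * l"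
      using l mult_left_mono[of 1 l "int n"] by (auto simp: n_def)
    have "d (\<alpha> (- (int n * l))) (\<alpha> (int n * l)) = d (\<alpha> 0) (\<alpha> (int (2 * n) * l))"
      using shift[of "- (int n * l)" n "int n * l"] by (simp add: algebra_simps)
    also have "\<dots> = 2 * (int n * l)"
      using displacement_pow[OF f(1) x, of "2 * n"] pow[of "2 * n"] pow[of 0] by (simp add: l_def)
    finally have "2 * (int n * l) = d (\<alpha> (- (int n * l))) (\<alpha> (int n * l))" by simp
    moreover have "d (\<alpha> (- (int n * l))) (\<alpha> i) \<le> i + int n * l"
      using upper[of "- (int n * l)" "nat (i + int n * l)"] n by simp
    moreover have "d (\<alpha> j) (\<alpha> (int n * l)) \<le> int n * l - j"
      using upper[of j "nat (int n * l - j)"] n by simp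
    moreover have "d (\<alpha> i) (\<alpha> j) \<le> j - i"
      using upper[of i "nat (j - i)"] that by simp
    moreover have "d (\<alpha> (- (int n * l))) (\<alpha> (int n * l)) \<le>
        d (\<alpha> (- (int n * l))) (\<alpha> i) + d (\<alpha> i) (\<alpha> (int n * l))"
      "d (\<alpha> i) (\<alpha> (int n * l)) \<le> d (\<alpha> i) (\<alpha> j) + d (\<alpha> j) (\<alpha> (int n * l))"
      using d_triangle mem by auto
    ultimately show ?thesis by linarith
  qed
  then have "d (\<alpha> i) (\<alpha> j) = \<bar>i - j\<bar>" for i j
    using d_sym[OF mem[of i] mem[of j]] by (cases "i \<le> j") auto
  then have "axis f \<alpha> l"
    using mem step l by (simp add: axis_def line_def)
  then show ?thesis using that by blast
qed

lemma ell_funpow: "ell f \<Longrightarrow> ell (f ^^ n)"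
proof -
  assume "ell f"
  then obtain x where x: "x \<in> T" "f x = x" unfolding ell_def by blast
  then have "(f ^^ n) x = x" by (induction n) auto
  then show "ell (f ^^ n)" using x(1) unfolding ell_def by blast
qed

lemma funpow_ell:
  assumes "aut f" "0 < n" "ell (f ^^ n)" shows "ell f"
proof (rule ccontr)
  assume "\<not> ell f"
  then obtain \<alpha> l where "axis f \<alpha> l" using not_ell_axis assms(1) by blast
  then show False
    using axis_not_ell[OF aut_funpow[OF assms(1)] axis_funpow[OF _ assms(2)]] assms(3) by blast
qed

end

section \<open>Products of two axial automorphisms\<close>

context tree begin

lemma axis_len_even:
  assumes "aut f" "axis f \<alpha> l" shows "even l"
proof -
  have a: "\<alpha> 0 \<in> T" "d (\<alpha> 0) (f (\<alpha> 0)) = l"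
    using assms(2) line_d[of \<alpha> 0 l] by (auto simp: axis_def)
  show ?thesis using aut_even[OF assms(1) a(1)] a(2) by simp
qed

lemma axis_pos: "axis f \<alpha> l \<Longrightarrow> 0 < l"
  by (simp add: axis_def)

lemma ell_swap:
  assumes "aut f" "aut g" "ell (g \<circ> f)" shows "ell (f \<circ> g)"
proof -
  obtain x where x: "x \<in> T" "g (f x) = x" using assms(3) by (auto simp: ell_def)
  then have "f x \<in> T" "(f \<circ> g) (f x) = f x" using assms(1) by simp_all
  then show ?thesis unfolding ell_def by blast
qed

text \<open>If \<open>E\<close> and \<open>f\<^sup>m E\<close> are elliptic, then \<open>E\<close> reverses a long piece of the axis of \<open>f\<close>
  starting at the projection of its fixed point.\<close>

lemma flip:
  assumes f: "aut f" "axis f \<alpha> l" and E: "aut E" "E y = y" and n: "near y \<alpha> p D"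
    and m: "0 < m" "ell (f ^^ m \<circ> E)" and k: "0 \<le> k" "2 * k \<le> int m * l"
  shows "E (\<alpha> (p + k)) = \<alpha> (p - k)"
proof -
  define w where "w = f ^^ m \<circ> E"
  define M where "M = int m * l"
  have M: "0 < M" using m(1) axis_pos[OF f(2)] by (simp add: M_def)
  have l: "line \<alpha>" using f(2) axis_line by blast
  have w: "aut w" unfolding w_def using f(1) E(1) by simp
  have yT: "y \<in> T" using n near_mem by blast
  have wy: "w y = (f ^^ m) y" by (simp add: w_def E(2))
  have n2: "near (w y) \<alpha> (p + M) D"
    unfolding wy M_def by (rule near_funpow[OF f n])
  have wT: "w y \<in> T" "w (w y) \<in> T" using w yT by simp_all
  have c: "d y (w y) = 2 * D + M"
    using near_dist[OF l n n2] M by simp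
  \<comment> \<open>As \<open>w\<close> is elliptic, the geodesics from \<open>w y\<close> to
    \<open>y\<close> and to \<open>w (w y)\<close> share their first halves. The two points lie on
    these geodesics, both at distance \<open>D + k\<close> from \<open>w y\<close>.\<close>
  have "\<alpha> (p + M - k) = w (\<alpha> (p + k))"
  proof (rule fellow[of "w y" y "w (w y)" _ _ "2 * D + M" "D + k"])
    show "d (w y) y = 2 * D + M" using c d_sym[OF wT(1) yT] by simp
    show "d (w y) (w (w y)) = 2 * D + M" using aut_d[OF w yT wT(1)] c by simp
    show "d y (w (w y)) \<le> 2 * D + M"
      using ell_d_le[OF w _ yT] m(2) c by (simp add: w_def)
    show "d (w y) (\<alpha> (p + M - k)) = D + k" using near_d[OF n2, of "p + M - k"] k by simp
    show "d (\<alpha> (p + M - k)) y = 2 * D + M - (D + k)"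
      using near_d[OF n, of "p + M - k"] k d_sym[OF yT line_mem[OF l]] by (simp add: M_def)
    show "d (w y) (w (\<alpha> (p + k))) = D + k"
      using aut_d[OF w yT line_mem[OF l]] near_d[OF n, of "p + k"] k by simp
    show "d (w (\<alpha> (p + k))) (w (w y)) = 2 * D + M - (D + k)"
      using aut_d[OF w line_mem[OF l] wT(1)] near_d[OF n2, of "p + k"] k
        d_sym[OF wT(1) line_mem[OF l]] by (simp add: M_def)
    show "2 * (D + k) \<le> 2 * D + M" using k by (simp add: M_def)
  qed (use wT yT w l in auto)
  then have "(f ^^ m) (E (\<alpha> (p + k))) = (f ^^ m) (\<alpha> (p - k))"
    using axis_pow[OF f(2), of m "p - k"] by (simp add: w_def M_def algebra_simps)
  then show ?thesis
    using aut_inj[OF aut_funpow[OF f(1)]] aut_mem[OF E(1)] line_mem[OF l] by blast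
qed

lemma flip_pow:
  assumes f: "aut f" "axis f \<alpha> l" and E: "aut E" "E y = y" and n: "near y \<alpha> p D"
    and m: "0 < m" "ell (f ^^ m \<circ> E)" and k: "0 \<le> k" "2 * k \<le> int m * l"
  shows "(f ^^ i \<circ> E) (\<alpha> (p + k)) = \<alpha> (p + (int i * l - k))"
  using flip[OF assms] axis_pow[OF f(2), of i "p - k"] by (simp add: algebra_simps)

text \<open>On a stretch of the axis the map \<open>f ^^ i \<circ> E\<close> sends the point with
  offset \<open>k\<close> from \<open>p\<close> to the one with offset \<open>int i * l - k\<close>,
  a reflection whose square is the identity there. Two exponents that differ by \<open>2\<close> are
  kept: carried to another tree they form a \<open>weak_flip\<close>.\<close>

lemma flip_fixes_edge:
  assumes f: "aut f" and nf: "\<not> ell f" and E: "aut E" "ell E"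
    and m: "4 \<le> m" "ell (f ^^ m \<circ> E)" and i: "i = 1 \<or> i = 3"
  shows "fixes_edge ((f ^^ i \<circ> E) \<circ> (f ^^ i \<circ> E))"
proof -
  obtain \<alpha> l where ax: "axis f \<alpha> l" using not_ell_axis[OF f nf] .
  have l: "line \<alpha>" "0 < l" using ax axis_line axis_pos by blast+
  obtain y where y: "y \<in> T" "E y = y" using E(2) by (auto simp: ell_def)
  obtain p D where n: "near y \<alpha> p D" using near_ex[OF l(1) y(1)] .
  let ?W = "f ^^ i \<circ> E"
  have 4: "4 * l \<le> int m * l" using m(1) l(2) by (intro mult_right_mono) auto
  have W: "?W (\<alpha> (p + k)) = \<alpha> (p + (int i * l - k))" if "0 \<le> k" "2 * k \<le> 4 * l" for k
    using flip_pow[OF f ax E(1) y(2) n _ m(2), of k i] m(1) that 4 by simp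
  \<comment> \<open>The offsets \<open>k\<close>, \<open>k + 1\<close> and their reflections must
    all lie between \<open>0\<close> and \<open>2 * l\<close>, where the reflection is
    known.\<close>
  define k where "k = (if i = 1 then 0 else l)"
  have W2: "?W (?W (\<alpha> (p + t))) = \<alpha> (p + t)" if "t = k \<or> t = k + 1" for t
  proof -
    have "0 \<le> t" "2 * t \<le> 4 * l" "0 \<le> int i * l - t" "2 * (int i * l - t) \<le> 4 * l"
      using that i l(2) by (auto simp: k_def)
    then show ?thesis using W[of t] W[of "int i * l - t"] by simp
  qed
  have "d (\<alpha> (p + k)) (\<alpha> (p + (k + 1))) = 1" using line_d[OF l(1)] by simp
  then show ?thesis
    unfolding fixes_edge_def using W2[of k] W2[of "k + 1"] line_mem[OF l(1)] by (metis comp_apply)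
qed

text \<open>With exponent \<open>2\<close> the centre of the reflection has offset \<open>l\<close>,
  and \<open>l \<ge> 2\<close> by evenness, so the points with offsets \<open>0\<close> and
  \<open>1\<close> are both moved. They have different colours, which lets the caller prescribe the
  colour \<open>c\<close>.\<close>

lemma flip_involution:
  assumes f: "aut f" and nf: "\<not> ell f" and E: "aut E" "ell E"
    and m: "4 \<le> m" "ell (f ^^ m \<circ> E)"
  obtains x where "x \<in> T" "col x = c" "(f ^^ 2 \<circ> E) ((f ^^ 2 \<circ> E) x) = x" "(f ^^ 2 \<circ> E) x \<noteq> x"
proof -
  obtain \<alpha> l where ax: "axis f \<alpha> l" using not_ell_axis[OF f nf] .
  have l: "line \<alpha>" "0 < l" using ax axis_line axis_pos by blast+
  obtain y where y: "y \<in> T" "E y = y" using E(2) by (auto simp: ell_def)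
  obtain p D where n: "near y \<alpha> p D" using near_ex[OF l(1) y(1)] .
  let ?W = "f ^^ 2 \<circ> E"
  have 4: "4 * l \<le> int m * l" using m(1) l(2) by (intro mult_right_mono) auto
  have W: "?W (\<alpha> (p + k)) = \<alpha> (p + (2 * l - k))" if "0 \<le> k" "2 * k \<le> 4 * l" for k
    using flip_pow[OF f ax E(1) y(2) n _ m(2), of k 2] m(1) that 4 by simp
  have l2: "2 \<le> l" using axis_len_even[OF f ax] l(2) by presburger
  have W2: "?W (?W (\<alpha> (p + t))) = \<alpha> (p + t) \<and> ?W (\<alpha> (p + t)) \<noteq> \<alpha> (p + t)" if "t = 0 \<or> t = 1" for t
  proof -
    have t: "0 \<le> t" "2 * t \<le> 4 * l" "0 \<le> 2 * l - t" "2 * (2 * l - t) \<le> 4 * l"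
      using that l2 by auto
    have "\<alpha> (p + (2 * l - t)) \<noteq> \<alpha> (p + t)"
      using line_inj[OF l(1), of "p + (2 * l - t)" "p + t"] that l2 by auto
    then show ?thesis using W[of t] W[of "2 * l - t"] t by simp
  qed
  have "d (\<alpha> (p + 0)) (\<alpha> (p + 1)) = 1" using line_d[OF l(1)] by simp
  then have "col (\<alpha> (p + 0)) \<noteq> col (\<alpha> (p + 1))"
    using parity[OF line_mem[OF l(1)] line_mem[OF l(1)], of "p + 0" "p + 1"] by simp
  then have "col (\<alpha> (p + 0)) = c \<or> col (\<alpha> (p + 1)) = c" by blast
  then show ?thesis using that W2 line_mem[OF l(1)] by blast
qed

text \<open>The pair \<open>x\<close>, \<open>y\<close> depends only on the axis of \<open>f\<close>
  and on one fixed point of \<open>g\<close>, not on the exponents. So all exponents of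
  \<open>g\<close> that give reflections carry the same point to the same other point.\<close>

lemma flip_target:
  assumes f: "aut f" "\<not> ell f" and g: "aut g" "ell g"
  obtains x y where "x \<in> T" "y \<in> T" "x \<noteq> y"
    "\<And>m n. 2 \<le> m \<Longrightarrow> ell (f ^^ m \<circ> g ^^ n) \<Longrightarrow> (g ^^ n) x = y"
proof -
  obtain \<alpha> l where ax: "axis f \<alpha> l" using not_ell_axis[OF f] .
  have l: "line \<alpha>" "0 < l" using ax axis_line axis_pos by blast+
  obtain y where y: "y \<in> T" "g y = y" using g(2) by (auto simp: ell_def)
  obtain p D where n: "near y \<alpha> p D" using near_ex[OF l(1) y(1)] .
  have "(g ^^ n) (\<alpha> (p + 1)) = \<alpha> (p - 1)" if "2 \<le> m" "ell (f ^^ m \<circ> g ^^ n)" for m n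
  proof (rule flip[OF f(1) ax _ _ n _ that(2)])
    show "aut (g ^^ n)" using g(1) by simp
    show "(g ^^ n) y = y" using y(2) by (induction n) auto
    show "2 * 1 \<le> int m * l" using that(1) l(2) mult_mono[of 2 "int m" 1 l] by simp
  qed (use that(1) in auto)
  moreover have "\<alpha> (p + 1) \<noteq> \<alpha> (p - 1)" using line_inj[OF l(1), of "p + 1" "p - 1"] by auto
  ultimately show ?thesis using that[of "\<alpha> (p + 1)" "\<alpha> (p - 1)"] line_mem[OF l(1)] by blast
qed

text \<open>A common segment of length \<open>m\<close> that the two lines traverse in opposite
  directions: by \<open>par\<close> this is forced on the axes of \<open>f\<close> and
  \<open>g\<close> when a product of positive powers is elliptic.\<close>

definition opposite :: "(int \<Rightarrow> 'p) \<Rightarrow> (int \<Rightarrow> 'p) \<Rightarrow> int \<Rightarrow> bool" where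
  "opposite \<alpha> \<beta> m \<longleftrightarrow> (\<exists>c c'. \<forall>k. 0 \<le> k \<and> k \<le> m \<longrightarrow> \<alpha> (c + k) = \<beta> (c' - k))"

definition overlap_le :: "(int \<Rightarrow> 'p) \<Rightarrow> (int \<Rightarrow> 'p) \<Rightarrow> int \<Rightarrow> bool" where
  "overlap_le \<alpha> \<beta> m \<longleftrightarrow> (\<forall>i j. \<alpha> i \<in> range \<beta> \<longrightarrow> \<alpha> j \<in> range \<beta> \<longrightarrow> \<bar>i - j\<bar> \<le> m)"

lemma opposite_sym:
  assumes "opposite \<alpha> \<beta> m" shows "opposite \<beta> \<alpha> m"
proof -
  obtain c c' where c: "\<And>k. 0 \<le> k \<Longrightarrow> k \<le> m \<Longrightarrow> \<alpha> (c + k) = \<beta> (c' - k)"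
    using assms unfolding opposite_def by blast
  have "\<beta> (c' - m + k) = \<alpha> (c + m - k)" if "0 \<le> k" "k \<le> m" for k
  proof -
    have e: "c + (m - k) = c + m - k" "c' - (m - k) = c' - m + k" by simp_all
    show ?thesis using c[of "m - k"] that unfolding e by simp
  qed
  then show ?thesis unfolding opposite_def by blast
qed

lemma overlap_le_sym:
  assumes "overlap_le \<alpha> \<beta> m" "line \<alpha>" "line \<beta>" shows "overlap_le \<beta> \<alpha> m"
proof -
  have "\<bar>i - j\<bar> \<le> m" if ij: "\<beta> i = \<alpha> x" "\<beta> j = \<alpha> y" for i j x y
  proof -
    have "\<bar>x - y\<bar> \<le> m" using assms(1) ij unfolding overlap_le_def by (metis rangeI)
    moreover have "\<bar>i - j\<bar> = \<bar>x - y\<bar>" using line_d[OF assms(2)] line_d[OF assms(3)] ij by metis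
    ultimately show ?thesis by simp
  qed
  then show ?thesis unfolding overlap_le_def by blast
qed

lemma opposite_le:
  assumes "opposite \<alpha> \<beta> m" "overlap_le \<alpha> \<beta> m'" "0 \<le> m" shows "m \<le> m'"
proof -
  obtain c c' where c: "\<And>k. 0 \<le> k \<Longrightarrow> k \<le> m \<Longrightarrow> \<alpha> (c + k) = \<beta> (c' - k)"
    using assms(1) unfolding opposite_def by blast
  have "\<alpha> (c + 0) \<in> range \<beta>" "\<alpha> (c + m) \<in> range \<beta>"
    using c[of 0] c[of m] assms(3) by auto
  then have "\<bar>(c + 0) - (c + m)\<bar> \<le> m'" using assms(2) unfolding overlap_le_def by blast
  then show ?thesis by simp
qed

lemma lines_agree:
  assumes l: "line \<alpha>" "line \<beta>" and e: "\<alpha> i = \<beta> x" "\<alpha> j = \<beta> y"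
    and s: "\<bar>i - s\<bar> + \<bar>s - j\<bar> = \<bar>i - j\<bar>" "\<bar>x - t\<bar> = \<bar>i - s\<bar>" "\<bar>t - y\<bar> = \<bar>s - j\<bar>"
  shows "\<alpha> s = \<beta> t"
proof (rule between_unique[of "\<alpha> i" "\<alpha> j"])
  show "d (\<alpha> i) (\<alpha> s) + d (\<alpha> s) (\<alpha> j) = d (\<alpha> i) (\<alpha> j)"
    using s(1) by (simp add: line_d[OF l(1)])
  show "d (\<alpha> i) (\<beta> t) = d (\<alpha> i) (\<alpha> s)"
    using s(2) line_d[OF l(2), of x t] line_d[OF l(1), of i s] unfolding e by simp
  show "d (\<beta> t) (\<alpha> j) = d (\<alpha> s) (\<alpha> j)"
    using s(3) line_d[OF l(2), of t y] line_d[OF l(1), of s j] unfolding e by simp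
qed (use l in simp_all)

text \<open>The intersection of two lines is connected, so a common point outside the known segment
  forces agreement at the very next point. Hence it suffices to test the two neighbours of a
  segment. A segment of length at least one fixes the relative direction.\<close>

lemma opposite_extend:
  assumes l: "line \<alpha>" "line \<beta>" and c: "\<And>k. 0 \<le> k \<Longrightarrow> k \<le> m \<Longrightarrow> \<alpha> (c + k) = \<beta> (c' - k)"
    and m: "1 \<le> m" and i: "\<alpha> i = \<beta> x"
  shows "c + m < i \<Longrightarrow> \<alpha> (c + m + 1) = \<beta> (c' - m - 1)"
    and "i < c \<Longrightarrow> \<alpha> (c - 1) = \<beta> (c' + 1)"
proof -
  have 0: "\<alpha> c = \<beta> c'" "\<alpha> (c + m) = \<beta> (c' - m)" using c[of 0] c[of m] m by simp_all
  have d0: "\<bar>i - c\<bar> = \<bar>x - c'\<bar>" "\<bar>i - (c + m)\<bar> = \<bar>x - (c' - m)\<bar>"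
    using line_d[OF l(1), of i c] line_d[OF l(1), of i "c + m"] line_d[OF l(2), of x c']
      line_d[OF l(2), of x "c' - m"] unfolding 0 i by simp_all
  show "\<alpha> (c + m + 1) = \<beta> (c' - m - 1)" if a: "c + m < i"
  proof -
    have "x = c' - (i - c)" using d0 a m by linarith
    then show ?thesis using lines_agree[OF l 0(1) i, of "c + m + 1" "c' - m - 1"] a m by simp
  qed
  show "\<alpha> (c - 1) = \<beta> (c' + 1)" if a: "i < c"
  proof -
    have "x = c' + (c - i)" using d0 a m by linarith
    then show ?thesis using lines_agree[OF l 0(2) i, of "c - 1" "c' + 1"] a m by simp
  qed
qed

text \<open>If the product fixes \<open>q\<close>, the geodesic from \<open>q\<close> to
  \<open>(g ^^ a) q\<close> runs along \<open>\<beta>\<close> for the length translated by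
  \<open>g ^^ a\<close>, and backwards along \<open>\<alpha>\<close> for that of
  \<open>f ^^ b\<close>. Both stretches are centred on it, so the shorter lies inside the longer,
  with excess \<open>\<epsilon>\<close> at each end. There \<open>f ^^ b\<close> folds one end of
  the stretch of \<open>\<beta>\<close> onto the other.\<close>

lemma par_le:
  assumes f: "aut f" "axis f \<alpha> lf" and g: "aut g" "axis g \<beta> lg" and ab: "0 < a" "0 < b"
    and e: "ell (f ^^ b \<circ> g ^^ a)" and le: "int b * lf \<le> int a * lg"
  obtains c c' \<epsilon> where "0 \<le> \<epsilon>" "2 * \<epsilon> = int a * lg - int b * lf"
    "\<And>k. 0 \<le> k \<Longrightarrow> k \<le> int b * lf \<Longrightarrow> \<alpha> (c + k) = \<beta> (c' - k)"
    "\<And>j. 0 \<le> j \<Longrightarrow> j \<le> \<epsilon> \<Longrightarrow> (f ^^ b) (\<beta> (c' + j)) = \<beta> (c' - int b * lf - j)"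
proof -
  define A where "A = int a * lg"
  define B where "B = int b * lf"
  have pos: "0 < A" "0 < B" "B \<le> A"
    using ab axis_pos[OF f(2)] axis_pos[OF g(2)] le by (simp_all add: A_def B_def)
  have l: "line \<alpha>" "line \<beta>" using f(2) g(2) axis_line by blast+
  obtain q where q: "q \<in> T" "(f ^^ b) ((g ^^ a) q) = q" using e by (auto simp: ell_def)
  define q1 where "q1 = (g ^^ a) q"
  have q1: "q1 \<in> T" "(f ^^ b) q1 = q" using q g(1) by (simp_all add: q1_def)
  obtain pf Df where nf: "near q \<alpha> pf Df" using near_ex[OF l(1) q(1)] .
  obtain pg Dg where ng: "near q \<beta> pg Dg" using near_ex[OF l(2) q(1)] .
  have ng1: "near q1 \<beta> (pg + A) Dg"
    unfolding q1_def A_def by (rule near_funpow[OF g ng])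
  have nf1: "near q1 \<alpha> (pf - B) Df"
    unfolding B_def by (rule near_funpow_inv[OF f _ q1(1)]) (simp add: q1(2) nf)
  have d1: "d q q1 = 2 * Dg + A" using near_dist[OF l(2) ng ng1] pos by simp
  have d2: "d q q1 = 2 * Df + B" using near_dist[OF l(1) nf nf1] pos by simp
  define \<epsilon> where "\<epsilon> = Df - Dg"
  have eps: "2 * \<epsilon> = A - B" using d1 d2 by (simp add: \<epsilon>_def)
  have eps0: "0 \<le> \<epsilon>" using eps pos by simp
  have sy: "d z q1 = d q1 z" if "z \<in> T" for z using d_sym[OF that q1(1)] .
  have agree: "\<alpha> (pf - k) = \<beta> (pg + \<epsilon> + k)" if k: "0 \<le> k" "k \<le> B" for k
  proof (rule between_unique[OF q(1) q1(1) line_mem[OF l(1)] line_mem[OF l(2)]])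
    show "d q (\<alpha> (pf - k)) + d (\<alpha> (pf - k)) q1 = d q q1"
      using near_d[OF nf, of "pf - k"] near_d[OF nf1, of "pf - k"] k pos d2
      by (simp add: sy[OF line_mem[OF l(1)]])
    show "d q (\<beta> (pg + \<epsilon> + k)) = d q (\<alpha> (pf - k))"
      using near_d[OF nf, of "pf - k"] near_d[OF ng, of "pg + \<epsilon> + k"] k eps0 by (simp add: \<epsilon>_def)
    show "d (\<beta> (pg + \<epsilon> + k)) q1 = d (\<alpha> (pf - k)) q1"
      using near_d[OF nf1, of "pf - k"] near_d[OF ng1, of "pg + \<epsilon> + k"] k eps eps0
      unfolding sy[OF line_mem[OF l(1)]] sy[OF line_mem[OF l(2)]] by (simp add: \<epsilon>_def)
  qed
  have fl: "(f ^^ b) (\<beta> (pg + \<epsilon> + B + j)) = \<beta> (pg + \<epsilon> - j)" if j: "0 \<le> j" "j \<le> \<epsilon>" for j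
  proof (rule between_unique[OF q(1) line_mem[OF l(2), of "pg + \<epsilon>"] _ line_mem[OF l(2)]])
    have F: "aut (f ^^ b)" using f(1) by simp
    have Y: "\<beta> (pg + \<epsilon>) = (f ^^ b) (\<beta> (pg + \<epsilon> + B))"
      using agree[of 0] agree[of B] pos axis_pow[OF f(2), of b "pf - B"] by (simp add: B_def)
    have dY: "d q (\<beta> (pg + \<epsilon>)) = Df"
      using near_d[OF ng, of "pg + \<epsilon>"] eps0 by (simp add: \<epsilon>_def)
    show "(f ^^ b) (\<beta> (pg + \<epsilon> + B + j)) \<in> T" using F l(2) by simp
    have 1: "d q ((f ^^ b) (\<beta> (pg + \<epsilon> + B + j))) = Df - j"
      using aut_d[OF F q1(1) line_mem[OF l(2)], of "pg + \<epsilon> + B + j"] q1(2)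
        near_d[OF ng1, of "pg + \<epsilon> + B + j"] j eps by (simp add: \<epsilon>_def)
    have 2: "d ((f ^^ b) (\<beta> (pg + \<epsilon> + B + j))) (\<beta> (pg + \<epsilon>)) = j"
      unfolding Y using aut_d[OF F line_mem[OF l(2)] line_mem[OF l(2)]] line_d[OF l(2)] j by simp
    show "d q ((f ^^ b) (\<beta> (pg + \<epsilon> + B + j))) + d ((f ^^ b) (\<beta> (pg + \<epsilon> + B + j))) (\<beta> (pg + \<epsilon>)) = d q (\<beta> (pg + \<epsilon>))"
      unfolding 1 2 dY by simp
    show "d q (\<beta> (pg + \<epsilon> - j)) = d q ((f ^^ b) (\<beta> (pg + \<epsilon> + B + j)))"
      unfolding 1 using near_d[OF ng, of "pg + \<epsilon> - j"] j by (simp add: \<epsilon>_def)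
    show "d (\<beta> (pg + \<epsilon> - j)) (\<beta> (pg + \<epsilon>)) = d ((f ^^ b) (\<beta> (pg + \<epsilon> + B + j))) (\<beta> (pg + \<epsilon>))"
      unfolding 2 using line_d[OF l(2)] j by simp
  qed
  show ?thesis
  proof (rule that[of \<epsilon> "pf - B" "pg + \<epsilon> + B"])
    show "\<alpha> (pf - B + k) = \<beta> (pg + \<epsilon> + B - k)" if "0 \<le> k" "k \<le> int b * lf" for k
      using agree[of "B - k"] that by (simp add: B_def algebra_simps)
    show "(f ^^ b) (\<beta> (pg + \<epsilon> + B + j)) = \<beta> (pg + \<epsilon> + B - int b * lf - j)"
      if "0 \<le> j" "j \<le> \<epsilon>" for j
      using fl[OF that] by (simp add: B_def)
  qed (use eps eps0 in \<open>simp_all add: A_def B_def\<close>)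
qed

text \<open>If the translation lengths differ, \<open>f ^^ b\<close> folds the two ends of
  \<open>\<beta>\<close> outside the overlap onto each other, so the axes cannot agree any further.
  If they are equal, agreement at one more point gives an adjacent second fixed point. Folding also
  explains why the longer translation may shrink to the length of the other without losing
  ellipticity.\<close>

lemma par_le_props:
  assumes f: "aut f" "axis f \<alpha> lf" and g: "aut g" "axis g \<beta> lg" and ab: "0 < a" "0 < b"
    and e: "ell (f ^^ b \<circ> g ^^ a)" and le: "int b * lf \<le> int a * lg"
  shows "opposite \<alpha> \<beta> (int b * lf)"
    and "int a * lg = int b * lf \<and> fixes_edge (f ^^ b \<circ> g ^^ a) \<or> overlap_le \<alpha> \<beta> (int b * lf)"
    and "\<lbrakk>n \<le> a; int b * lf \<le> int (a - n) * lg\<rbrakk> \<Longrightarrow> ell (f ^^ b \<circ> g ^^ (a - n))"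
proof -
  have l: "line \<alpha>" "line \<beta>" using f(2) g(2) axis_line by blast+
  define B where "B = int b * lf"
  have B: "1 \<le> B" using ab axis_pos[OF f(2)] by (simp add: B_def int_one_le_iff_zero_less)
  obtain c c' \<epsilon> where eps: "0 \<le> \<epsilon>" "2 * \<epsilon> = int a * lg - B"
    and c: "\<And>k. 0 \<le> k \<Longrightarrow> k \<le> B \<Longrightarrow> \<alpha> (c + k) = \<beta> (c' - k)"
    and fl: "\<And>j. 0 \<le> j \<Longrightarrow> j \<le> \<epsilon> \<Longrightarrow> (f ^^ b) (\<beta> (c' + j)) = \<beta> (c' - B - j)"
    using par_le[OF assms] unfolding B_def by metis
  have F: "aut (f ^^ b)" using f(1) by simp
  have fp: "(f ^^ b) (\<alpha> i) = \<alpha> (i + B)" for i using axis_pow[OF f(2)] by (simp add: B_def)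
  have gp: "(g ^^ a) (\<beta> i) = \<beta> (i + int a * lg)" for i using axis_pow[OF g(2)] .
  show "opposite \<alpha> \<beta> (int b * lf)"
    using c unfolding opposite_def B_def by blast
  show "ell (f ^^ b \<circ> g ^^ (a - n))" if n: "n \<le> a" "int b * lf \<le> int (a - n) * lg"
  proof -
    have ev: "even (int n * lg)" using axis_len_even[OF g] by simp
    \<comment> \<open>\<open>\<beta> (c' + j)\<close> will be fixed by
      \<open>g ^^ (a - n) \<circ> f ^^ b\<close>: \<open>j\<close> is half of the remaining excess,
      an integer because \<open>lg\<close> is even.\<close>
    obtain j where j: "2 * j = int (a - n) * lg - B"
    proof -
      have "int (a - n) * lg - B = 2 * \<epsilon> - int n * lg"
        using n(1) eps(2) by (simp add: of_nat_diff left_diff_distrib)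
      then have "even (int (a - n) * lg - B)" using ev by simp
      then show ?thesis using that by (metis evenE)
    qed
    have "int (a - n) * lg \<le> int a * lg"
      using n(1) axis_pos[OF g(2)] by (intro mult_right_mono) auto
    then have j2: "0 \<le> j" "j \<le> \<epsilon>" using j eps n(2) by (simp_all add: B_def)
    have "(g ^^ (a - n)) ((f ^^ b) (\<beta> (c' + j))) = \<beta> (c' + j)"
    proof -
      have "\<beta> (c' - B - j + int (a - n) * lg) = \<beta> (c' + j)"
        by (rule arg_cong[where f = \<beta>]) (use j in linarith)
      then show ?thesis using fl[OF j2] axis_pow[OF g(2), of "a - n" "c' - B - j"] by simp
    qed
    then have "ell (g ^^ (a - n) \<circ> f ^^ b)"
      unfolding ell_def using line_mem[OF l(2)] by (metis comp_apply)
    then show ?thesis using ell_swap[of "f ^^ b" "g ^^ (a - n)"] f(1) g(1) by simp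
  qed
  have ext: "overlap_le \<alpha> \<beta> B"
    if no: "\<alpha> (c + B + 1) \<noteq> \<beta> (c' - B - 1)" "\<alpha> (c - 1) \<noteq> \<beta> (c' + 1)"
  proof -
    have "c \<le> i \<and> i \<le> c + B" if "\<alpha> i \<in> range \<beta>" for i
    proof -
      obtain x where x: "\<alpha> i = \<beta> x" using \<open>\<alpha> i \<in> range \<beta>\<close> by blast
      show ?thesis using opposite_extend[OF l c B x] no by (meson not_le)
    qed
    then show ?thesis unfolding overlap_le_def by (meson abs_le_iff diff_le_eq order_trans
          add_mono_thms_linordered_semiring(1) abs_diff_le_iff)
  qed
  show "int a * lg = int b * lf \<and> fixes_edge (f ^^ b \<circ> g ^^ a) \<or> overlap_le \<alpha> \<beta> (int b * lf)"
  proof (cases "int a * lg = B")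
    case False
    then have e1: "1 \<le> \<epsilon>" using eps by linarith
    have fe: "(f ^^ b) (\<beta> (c' + 1)) = \<beta> (c' - B - 1)" using fl[of 1] e1 by simp
    have "\<alpha> (c + B + 1) \<noteq> \<beta> (c' - B - 1)"
    proof
      assume a: "\<alpha> (c + B + 1) = \<beta> (c' - B - 1)"
      have "(f ^^ b) (\<alpha> (c + 1)) = (f ^^ b) (\<beta> (c' + 1))"
        using a fe fp[of "c + 1"] by (simp add: algebra_simps)
      then have "\<alpha> (c + 1) = \<beta> (c' + 1)"
        using aut_inj[OF F line_mem[OF l(1)] line_mem[OF l(2)]] by blast
      then show False using c[of 1] B line_inj[OF l(2), of "c' + 1" "c' - 1"] by simp
    qed
    moreover have "\<alpha> (c - 1) \<noteq> \<beta> (c' + 1)"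
    proof
      assume a: "\<alpha> (c - 1) = \<beta> (c' + 1)"
      have e: "c - 1 + B = c + (B - 1)" by simp
      have "\<alpha> (c - 1 + B) = \<beta> (c' - B - 1)" using fp[of "c - 1"] fe a by simp
      moreover have "\<alpha> (c - 1 + B) = \<beta> (c' - (B - 1))" unfolding e using c[of "B - 1"] B by simp
      ultimately show False using line_inj[OF l(2), of "c' - B - 1" "c' - (B - 1)"] by simp
    qed
    ultimately show ?thesis using ext by (simp add: B_def)
  next
    case True
    have w: "(f ^^ b \<circ> g ^^ a) (\<beta> (c' - k)) = \<alpha> (c - (B - k) + B)"
      if "\<beta> (c' - k + B) = \<alpha> (c - (B - k))" for k
      using that gp[of "c' - k"] fp[of "c - (B - k)"] True by simp
    have adj: "d (\<beta> i) (\<beta> (i + 1)) = 1" for i using line_d[OF l(2)] by simp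
    have base: "(f ^^ b \<circ> g ^^ a) (\<beta> (c' - B)) = \<beta> (c' - B)"
      using w[of B] c[of 0] c[of B] B by simp
    have "fixes_edge (f ^^ b \<circ> g ^^ a)" if x: "\<alpha> (c + B + 1) = \<beta> (c' - B - 1)"
    proof -
      have "(f ^^ b \<circ> g ^^ a) (\<beta> (c' - (B + 1))) = \<beta> (c' - (B + 1))"
        using w[of "B + 1"] c[of 1] x B by (simp add: algebra_simps)
      then show ?thesis
        using base adj[of "c' - (B + 1)"] line_mem[OF l(2)] unfolding fixes_edge_def
        by (metis add_diff_cancel_right' diff_add_eq diff_diff_add)
    qed
    moreover have "fixes_edge (f ^^ b \<circ> g ^^ a)" if x: "\<alpha> (c - 1) = \<beta> (c' + 1)"
    proof -
      have e: "c - 1 + B = c + (B - 1)" by simp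
      have "(f ^^ b \<circ> g ^^ a) (\<beta> (c' - (B - 1))) = \<alpha> (c - 1 + B)"
        using w[of "B - 1"] x by (simp add: algebra_simps)
      also have "\<dots> = \<beta> (c' - (B - 1))" unfolding e using c[of "B - 1"] B by simp
      finally show ?thesis
        using base adj[of "c' - B"] line_mem[OF l(2)] unfolding fixes_edge_def
        by (metis add.commute diff_add_eq diff_diff_eq2)
    qed
    ultimately show ?thesis using ext True by (auto simp: B_def)
  qed
qed

lemma par:
  assumes f: "aut f" "axis f \<alpha> lf" and g: "aut g" "axis g \<beta> lg" and ab: "0 < a" "0 < b"
    and e: "ell (f ^^ b \<circ> g ^^ a)" and m: "m = min (int a * lg) (int b * lf)"
  shows "opposite \<alpha> \<beta> m"
    and "int a * lg = int b * lf \<and> fixes_edge (f ^^ b \<circ> g ^^ a) \<or> overlap_le \<alpha> \<beta> m"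
    and "\<lbrakk>n \<le> a; int b * lf \<le> int (a - n) * lg\<rbrakk> \<Longrightarrow> ell (f ^^ b \<circ> g ^^ (a - n))"
    and "\<lbrakk>n \<le> b; int a * lg \<le> int (b - n) * lf\<rbrakk> \<Longrightarrow> ell (f ^^ (b - n) \<circ> g ^^ a)"
proof -
  have l: "line \<alpha>" "line \<beta>" using f(2) g(2) axis_line by blast+
  have e': "ell (g ^^ a \<circ> f ^^ b)" using ell_swap[of "g ^^ a" "f ^^ b"] e f(1) g(1) by simp
  have mono: "int (a - n) * lg \<le> int a * lg" "int (b - n) * lf \<le> int b * lf"
    using axis_pos[OF g(2)] axis_pos[OF f(2)] by (auto intro!: mult_right_mono)
  have eq0: "n = 0" if "n \<le> b" "int (b - n) * lf = int b * lf"
    using that axis_pos[OF f(2)] by simp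
  have eq0': "n = 0" if "n \<le> a" "int (a - n) * lg = int a * lg"
    using that axis_pos[OF g(2)] by simp
  note swap = ell_swap[of "f ^^ (b - n)" "g ^^ a"] f(1) g(1)
  show "opposite \<alpha> \<beta> m"
    using par_le_props(1)[OF f g ab e] opposite_sym[OF par_le_props(1)[OF g f ab(2,1) e']] m
    by (cases "int b * lf \<le> int a * lg") (simp_all add: min_def)
  show "int a * lg = int b * lf \<and> fixes_edge (f ^^ b \<circ> g ^^ a) \<or> overlap_le \<alpha> \<beta> m"
    using par_le_props(2)[OF f g ab e] par_le_props(2)[OF g f ab(2,1) e'] m
      overlap_le_sym[OF _ l(2,1), of m]
    by (cases "int b * lf \<le> int a * lg") (auto simp: min_def)
  show "ell (f ^^ b \<circ> g ^^ (a - n))" if "n \<le> a" "int b * lf \<le> int (a - n) * lg"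
    using par_le_props(3)[OF f g ab e _ that] that mono(1) by linarith
  show "ell (f ^^ (b - n) \<circ> g ^^ a)" if "n \<le> b" "int a * lg \<le> int (b - n) * lf"
    using swap par_le_props(3)[OF g f ab(2,1) e' _ that] that mono(2) by simp
qed

text \<open>Inside the common segment \<open>f\<close> and \<open>g\<close> are translations in
  opposite directions and commute. The required length leaves room for both of them, and for the two
  ends of an edge, hence the \<open>+ 1\<close>.\<close>

lemma commutator_fixes:
  assumes f: "axis f \<alpha> lf" and g: "axis g \<beta> lg"
    and op: "opposite \<alpha> \<beta> m" and m: "lg + int j * lf + 1 \<le> m"
  obtains x y where "x \<in> T" "y \<in> T" "d x y = 1"
    "(f ^^ j) (g x) = g ((f ^^ j) x)" "(f ^^ j) (g y) = g ((f ^^ j) y)"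
proof -
  have l: "line \<alpha>" using f axis_line by blast
  obtain c c' where c: "\<And>k. 0 \<le> k \<Longrightarrow> k \<le> m \<Longrightarrow> \<alpha> (c + k) = \<beta> (c' - k)"
    using op unfolding opposite_def by blast
  have jf: "0 \<le> int j * lf" using axis_pos[OF f] by simp
  have ga: "g (\<alpha> (c + k)) = \<alpha> (c + (k - lg))" if "lg \<le> k" "k \<le> m" for k
  proof -
    have "\<beta> (c' - (k - lg)) = \<beta> (c' - k + lg)" by (rule arg_cong[where f = \<beta>]) simp
    moreover have "g (\<beta> (c' - k)) = \<beta> (c' - k + lg)" using g by (simp add: axis_def)
    ultimately show ?thesis using c[of k] c[of "k - lg"] that axis_pos[OF g] by simp
  qed
  have fj: "(f ^^ j) (\<alpha> i) = \<alpha> (i + int j * lf)" for i using axis_pow[OF f] .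
  have fixk: "(f ^^ j) (g (\<alpha> (c + k))) = g ((f ^^ j) (\<alpha> (c + k)))"
    if "lg \<le> k" "k + int j * lf \<le> m" for k
    using ga[of k] ga[of "k + int j * lf"] fj[of "c + (k - lg)"] fj[of "c + k"] that jf
    by (simp add: algebra_simps)
  have "d (\<alpha> (c + lg)) (\<alpha> (c + (lg + 1))) = 1" using line_d[OF l] by simp
  then show ?thesis
    using that[of "\<alpha> (c + lg)" "\<alpha> (c + (lg + 1))"] fixk[of lg] fixk[of "lg + 1"] m line_mem[OF l]
    by (simp add: algebra_simps)
qed

text \<open>The geodesic from \<open>\<alpha> s\<close> to its image is a part of
  \<open>\<alpha>\<close>, and it starts by descending to the axis of \<open>g\<close>. So one step
  along \<open>\<alpha>\<close> towards \<open>t\<close> comes closer to that axis.\<close>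

lemma translate_step:
  assumes g: "aut g" "axis g \<beta> lg" and l: "line \<alpha>" and e: "g (\<alpha> s) = \<alpha> t"
    and near: "near (\<alpha> s) \<beta> p D" "0 < D" and s': "s' = s + sgn (t - s)"
  shows "d (\<alpha> s') (\<beta> p) = D - 1" "\<bar>t - s\<bar> = 2 * D + lg"
proof -
  have lb: "line \<beta>" using g(2) axis_line by blast
  have nt: "near (\<alpha> t) \<beta> (p + lg) D" using near_aut[OF g near(1)] e by simp
  have lg: "0 < lg" using axis_pos[OF g(2)] .
  have D: "d (\<alpha> s) (\<alpha> t) = 2 * D + lg" using near_dist[OF lb near(1) nt] lg by simp
  then show S: "\<bar>t - s\<bar> = 2 * D + lg" using line_d[OF l, of s t] by (simp add: abs_minus_commute)
  have dp: "d (\<alpha> s) (\<beta> p) = D" using near_d[OF near(1), of p] by simp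
  obtain z where z: "z \<in> T" "d (\<alpha> s) z = 1" "d z (\<beta> p) = D - 1"
    using geodesic[of "\<alpha> s" "\<beta> p" 1] near(2) l lb dp by auto
  have "d z (\<alpha> t) \<le> d z (\<beta> p) + d (\<beta> p) (\<alpha> t)" using z l lb by (intro d_triangle) auto
  moreover have "d (\<beta> p) (\<alpha> t) = D + lg"
    using near_d[OF nt, of p] lg d_sym[OF line_mem[OF lb] line_mem[OF l]] by simp
  moreover have "d (\<alpha> s) (\<alpha> t) \<le> d (\<alpha> s) z + d z (\<alpha> t)" using z l by (intro d_triangle) auto
  ultimately have zt: "d z (\<alpha> t) = 2 * D + lg - 1" using z D by linarith
  have ne: "s \<noteq> t" using S lg near(2) by auto
  have "\<bar>s - s'\<bar> = 1" "\<bar>s' - t\<bar> = 2 * D + lg - 1"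
    using S ne by (cases "s < t"; auto simp: s')+
  then have "z = \<alpha> s'"
    using between_unique[of "\<alpha> s" "\<alpha> t" z "\<alpha> s'"] z zt D l by (simp add: line_d)
  then show "d (\<alpha> s') (\<beta> p) = D - 1" using z by simp
qed

text \<open>All points of the segment are moved by \<open>\<bar>t - s\<bar>\<close>, so all have the
  same distance from the axis of \<open>g\<close>. If that distance were positive,
  \<open>translate_step\<close> would make it drop at one step towards the image.\<close>

lemma translated_subset_axis:
  assumes g: "aut g" "axis g \<beta> lg" and l: "line \<alpha>" and m: "1 \<le> m"
    and e: "\<And>k. 0 \<le> k \<Longrightarrow> k \<le> m \<Longrightarrow> g (\<alpha> (s + k)) = \<alpha> (t + k)" and k: "0 \<le> k" "k \<le> m"
  shows "\<alpha> (s + k) \<in> range \<beta>"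
proof -
  have lb: "line \<beta>" using g(2) axis_line by blast
  have lg: "0 < lg" using axis_pos[OF g(2)] .
  have D: "\<bar>t - s\<bar> = 2 * D + lg" if "0 \<le> k" "k \<le> m" "near (\<alpha> (s + k)) \<beta> p D" for k p D
  proof -
    have "near (\<alpha> (t + k)) \<beta> (p + lg) D" using near_aut[OF g that(3)] e[OF that(1,2)] by simp
    then show ?thesis
      using near_dist[OF lb that(3)] lg line_d[OF l, of "s + k" "t + k"] by simp
  qed
  obtain p D0 where n: "near (\<alpha> (s + k)) \<beta> p D0" using near_ex[OF lb line_mem[OF l]] .
  have "D0 = 0"
  proof (rule ccontr)
    assume "D0 \<noteq> 0"
    then have pos: "0 < D0" using n by (simp add: near_def)
    \<comment> \<open>The starting end is chosen so that one step towards \<open>t\<close> stays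
      within the segment.\<close>
    define i where "i = (if s < t then 0 else 1::int)"
    have i: "0 \<le> i" "i \<le> m" "0 \<le> i + sgn (t - s)" "i + sgn (t - s) \<le> m"
      using m by (auto simp: i_def sgn_if)
    obtain q D1 where n1: "near (\<alpha> (s + i)) \<beta> q D1" using near_ex[OF lb line_mem[OF l]] .
    have D1: "D1 = D0" using D[OF k n] D[OF i(1,2) n1] by simp
    obtain r D2 where n2: "near (\<alpha> (s + (i + sgn (t - s)))) \<beta> r D2" using near_ex[OF lb line_mem[OF l]] .
    have D2: "D2 = D0" using D[OF k n] D[OF i(3,4) n2] by simp
    have "d (\<alpha> (s + (i + sgn (t - s)))) (\<beta> q) = D0 - 1"
      by (rule translate_step(1)[OF g l e[OF i(1,2)] n1[unfolded D1] pos]) (simp add: add.assoc)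
    then show False using near_d[OF n2, of q] D2 by simp
  qed
  then show ?thesis using near_zero[of "\<alpha> (s + k)" \<beta> p] n lb by simp
qed

text \<open>If \<open>f ^^ (k + 2)\<close> were the shorter translation, the overlap would have at
  least its length, against the upper bound coming from \<open>k\<close>. So the overlap has length
  exactly \<open>int n * lg\<close>, and the two axes determine \<open>n\<close>.\<close>

lemma flip_exponent_unique:
  assumes f: "aut f" "axis f \<alpha> lf" and g: "aut g" "axis g \<beta> lg" and n: "0 < n" and k: "0 < k"
    and e: "ell (f ^^ k \<circ> g ^^ n)" "ell (f ^^ (k + 2) \<circ> g ^^ n)"
  shows "opposite \<alpha> \<beta> (int n * lg)" "overlap_le \<alpha> \<beta> (int n * lg)"
proof -
  note p1 = par(1,2)[OF f g n k e(1) refl]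
  have k2: "0 < k + 2" by simp
  note p2 = par(1,2)[OF f g n k2 e(2) refl]
  have lf: "0 < lf" using axis_pos[OF f(2)] .
  have lt: "int n * lg < int (k + 2) * lf"
  proof (rule ccontr)
    assume "\<not> ?thesis"
    then have ge: "int (k + 2) * lf \<le> int n * lg" by simp
    have lk: "int k * lf < int (k + 2) * lf" using lf by simp
    have "opposite \<alpha> \<beta> (int (k + 2) * lf)" using p2(1) unfolding min_absorb2[OF ge] .
    moreover have "overlap_le \<alpha> \<beta> (int k * lf)"
      using p1(2) ge lk by (auto simp: min_def)
    ultimately have "int (k + 2) * lf \<le> int k * lf"
      using opposite_le lf by simp
    then show False using lk by simp
  qed
  show "opposite \<alpha> \<beta> (int n * lg)" using p2(1) lt by (simp add: min_def)
  show "overlap_le \<alpha> \<beta> (int n * lg)" using p2(2) lt by (auto simp: min_def)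
qed

end

section \<open>Avoiding arithmetic progressions\<close>

definition exp_sum :: "nat \<Rightarrow> (nat \<Rightarrow> complex) \<Rightarrow> bool" where
  "exp_sum m h \<longleftrightarrow> (\<exists>c \<theta>. (\<forall>s<m. \<theta> s \<noteq> 0) \<and> (\<forall>n. h n = (\<Sum>s<m. c s * \<theta> s ^ n)))"

text \<open>The shift operator minus \<open>\<theta> m\<close> removes one exponential and uses up
  one of the known zeros. In the end \<open>\<theta> m * h 0 = 0\<close>.\<close>

lemma exp_sum_vanish:
  "\<lbrakk>exp_sum m h; \<And>i. \<lbrakk>1 \<le> i; i \<le> m\<rbrakk> \<Longrightarrow> h i = 0\<rbrakk> \<Longrightarrow> h 0 = 0"
proof (induction m arbitrary: h)
  case 0
  then show ?case by (auto simp: exp_sum_def)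
next
  case (Suc m)
  obtain c \<theta> where \<theta>: "\<And>s. s < Suc m \<Longrightarrow> \<theta> s \<noteq> 0" and h: "\<And>n. h n = (\<Sum>s<Suc m. c s * \<theta> s ^ n)"
    using Suc.prems(1) unfolding exp_sum_def by blast
  define h' where "h' n = h (Suc n) - \<theta> m * h n" for n
  have "h' n = (\<Sum>s<m. (c s * (\<theta> s - \<theta> m)) * \<theta> s ^ n)" for n
    by (simp add: h'_def h algebra_simps sum_distrib_left sum_subtractf)
  then have "exp_sum m h'" using \<theta> unfolding exp_sum_def by (metis less_Suc_eq)
  moreover have "h' i = 0" if "1 \<le> i" "i \<le> m" for i
    using Suc.prems(2)[of i] Suc.prems(2)[of "Suc i"] that by (simp add: h'_def)
  ultimately have "h' 0 = 0" using Suc.IH by blast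
  then show ?case using Suc.prems(2)[of 1] \<theta>[of m] by (simp add: h'_def)
qed

lemma exp_sum_shift:
  assumes "exp_sum m h" shows "exp_sum m (\<lambda>n. h (x + n))"
proof -
  obtain c \<theta> where "\<And>s. s < m \<Longrightarrow> \<theta> s \<noteq> 0" and "\<And>n. h n = (\<Sum>s<m. c s * \<theta> s ^ n)"
    using assms unfolding exp_sum_def by blast
  then show ?thesis
    unfolding exp_sum_def
    by (intro exI[of _ "\<lambda>s. c s * \<theta> s ^ x"] exI[of _ \<theta>]) (simp add: power_add mult.assoc)
qed

text \<open>A block of \<open>m\<close> consecutive zeros can be shifted down one by one until it
  reaches \<open>0\<close>.\<close>

lemma exp_sum_vanish_block:
  assumes "exp_sum m h" "\<And>i. \<lbrakk>x < i; i \<le> x + m\<rbrakk> \<Longrightarrow> h i = 0" shows "h 0 = 0"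
  using assms(2)
proof (induction x)
  case 0
  then show ?case using exp_sum_vanish[OF assms(1)] by simp
next
  case (Suc x)
  have "h (Suc x + i) = 0" if "1 \<le> i" "i \<le> m" for i using Suc.prems[of "Suc x + i"] that by simp
  then have "h (Suc x + 0) = 0" by (rule exp_sum_vanish[OF exp_sum_shift[OF assms(1), of "Suc x"]])
  then have "h i = 0" if "x < i" "i \<le> x + m" for i
    using Suc.prems[of i] that by (cases "i = Suc x") auto
  then show ?case by (rule Suc.IH)
qed

lemma exp_sum_mult:
  assumes "exp_sum m h" "\<theta>' \<noteq> 0" shows "exp_sum (2 * m) (\<lambda>n. h n * (1 - c' * \<theta>' ^ n))"
proof -
  obtain c \<theta> where t: "\<And>s. s < m \<Longrightarrow> \<theta> s \<noteq> 0" and h: "\<And>n. h n = (\<Sum>s<m. c s * \<theta> s ^ n)"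
    using assms unfolding exp_sum_def by blast
  define C where "C s = (if s < m then c s else - c' * c (s - m))" for s
  define H where "H s = (if s < m then \<theta> s else \<theta>' * \<theta> (s - m))" for s
  have "h n * (1 - c' * \<theta>' ^ n) = (\<Sum>s<2*m. C s * H s ^ n)" for n
  proof -
    have "(\<Sum>s<2*m. C s * H s ^ n) = (\<Sum>s<m. C s * H s ^ n) + (\<Sum>s=m..<m+m. C s * H s ^ n)"
      by (simp add: mult_2 lessThan_atLeast0 sum.atLeastLessThan_concat)
    also have "(\<Sum>s=m..<m+m. C s * H s ^ n) = (\<Sum>s<m. C (s + m) * H (s + m) ^ n)"
      using sum.shift_bounds_nat_ivl[of "\<lambda>s. C s * H s ^ n" 0 m m] by (simp add: lessThan_atLeast0)
    also have "(\<Sum>s<m. C s * H s ^ n) = h n" by (simp add: C_def H_def h)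
    also have "(\<Sum>s<m. C (s + m) * H (s + m) ^ n) = - (c' * \<theta>' ^ n) * h n"
      by (simp add: C_def H_def h sum_distrib_left power_mult_distrib sum_negf mult_ac)
    finally show ?thesis by (simp add: algebra_simps)
  qed
  moreover have "H s \<noteq> 0" if "s < 2 * m" for s using t assms(2) that by (simp add: H_def)
  ultimately show ?thesis unfolding exp_sum_def by blast
qed

text \<open>Progressions that avoid \<open>0\<close> are zero sets of functions \<open>1 - c \<theta>\<^sup>n\<close> that do not vanish at \<open>0\<close>.
  A product of \<open>q\<close> of these is a sum of \<open>2\<^sup>q\<close> exponentials, which is determined by its values on
  any \<open>2\<^sup>q\<close> consecutive integers (Crittenden and Vanden Eynden).\<close>

definition avoidable :: "nat set \<Rightarrow> bool" where
  "avoidable N \<longleftrightarrow> (\<exists>c \<theta>::complex. \<theta> \<noteq> 0 \<and> c \<noteq> 1 \<and> (\<forall>n\<in>N. c * \<theta> ^ n = 1))"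

lemma avoid_block:
  assumes "finite Q" "\<And>u. u \<in> Q \<Longrightarrow> avoidable (N u)"
  shows "\<exists>n. x < n \<and> n \<le> x + 2 ^ card Q \<and> (\<forall>u\<in>Q. n \<notin> N u)"
proof -
  have "\<exists>h. exp_sum (2 ^ card Q) h \<and> h 0 \<noteq> 0 \<and> (\<forall>u\<in>Q. \<forall>n\<in>N u. h n = 0)"
    using assms
  proof (induction Q rule: finite_induct)
    case empty
    have "exp_sum 1 (\<lambda>n. 1)"
      unfolding exp_sum_def by (intro exI[of _ "\<lambda>s. 1"]) simp
    then show ?case by (intro exI[of _ "\<lambda>n. 1"]) simp
  next
    case (insert u Q)
    obtain h where h: "exp_sum (2 ^ card Q) h" "h 0 \<noteq> 0" "\<forall>u\<in>Q. \<forall>n\<in>N u. h n = 0"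
      using insert by auto
    obtain c \<theta> :: complex where c: "\<theta> \<noteq> 0" "c \<noteq> 1" "\<forall>n\<in>N u. c * \<theta> ^ n = 1"
      using insert.prems[OF insertI1] unfolding avoidable_def by blast
    have "exp_sum (2 ^ card (insert u Q)) (\<lambda>n. h n * (1 - c * \<theta> ^ n))"
      using exp_sum_mult[OF h(1) c(1)] insert.hyps by simp
    then show ?case
      using h c by (intro exI[of _ "\<lambda>n. h n * (1 - c * \<theta> ^ n)"]) auto
  qed
  then obtain h where h: "exp_sum (2 ^ card Q) h" "h 0 \<noteq> 0" "\<forall>u\<in>Q. \<forall>n\<in>N u. h n = 0" by blast
  then show ?thesis using exp_sum_vanish_block[OF h(1), of x] by blast
qed

text \<open>A single positive integer is handled like a progression, with
  \<open>\<theta> = 2\<close> in place of a root of unity: \<open>(1/2) ^ n0 * 2 ^ n\<close> is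
  \<open>1\<close> at \<open>n0\<close> and not at \<open>0\<close>.\<close>

lemma avoidable_singleton:
  assumes "\<And>n. n \<in> N \<Longrightarrow> n = n0" "0 < n0" shows "avoidable N"
  unfolding avoidable_def
proof (intro exI conjI ballI)
  show "(2::complex) \<noteq> 0" by simp
  show "(1/2)^n0 \<noteq> (1::complex)"
  proof
    assume "(1/2)^n0 = (1::complex)"
    then have "norm ((1/2::complex)^n0) = 1" by simp
    then have "(1/2::real)^n0 = 1" by (simp add: norm_power norm_divide)
    moreover have "(1/2::real)^n0 < 1" using assms(2) by (simp add: power_less_one_iff)
    ultimately show False by simp
  qed
  show "(1/2)^n0 * (2::complex)^n = 1" if "n \<in> N" for n
    using assms(1)[OF that] by (simp flip: power_mult_distrib)
qed

text \<open>Take a primitive root of unity of order \<open>q\<close> and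
  \<open>c = inverse (\<theta> ^ n0)\<close>; then \<open>c \<noteq> 1\<close> because
  \<open>q\<close> does not divide \<open>n0\<close>.\<close>

lemma avoidable_progression:
  assumes "\<And>n. n \<in> N \<Longrightarrow> n mod q = n0 mod q" "0 < q" "\<not> q dvd n0" shows "avoidable N"
proof -
  define \<theta> where "\<theta> = cis (2 * pi / real q)"
  have pow: "\<theta> ^ n = cis (2 * pi * real n / real q)" for n
    by (simp add: \<theta>_def DeMoivre mult_ac)
  have q1: "\<theta> ^ q = 1" using assms(2) by (simp add: pow)
  have md: "\<theta> ^ n = \<theta> ^ (n mod q)" for n
    by (metis q1 mult_1 power_add power_mult power_one div_mult_mod_eq mult.commute)
  have "\<theta> ^ n0 \<noteq> 1"
  proof
    assume "\<theta> ^ n0 = 1"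
    then have "cis (2 * pi * real (n0 mod q) / real q) = cis (2 * pi * real 0 / real q)"
      using md[of n0] by (simp add: pow)
    moreover have "inj_on (\<lambda>k. cis (2 * pi * real k / real q)) {..<q}"
      using bij_betw_roots_unity[OF assms(2)] by (simp add: bij_betw_def)
    ultimately have "n0 mod q = 0" using assms(2) unfolding inj_on_def
      by (metis lessThan_iff mod_less_divisor)
    then show False using assms(3) by auto
  qed
  moreover have "\<theta> ^ n = \<theta> ^ n0" if "n \<in> N" for n
    using assms(1)[OF that] md by metis
  moreover have "\<theta> \<noteq> 0" by (simp add: \<theta>_def)
  ultimately show ?thesis
    unfolding avoidable_def by (intro exI[of _ "inverse (\<theta> ^ n0)"] exI[of _ \<theta>]) (auto simp: inverse_eq_1_iff)
qed

text \<open>Two times at which \<open>x\<close> is sent to \<open>y\<close> differ by a period of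
  \<open>x\<close>. So they form part of a progression if \<open>x\<close> is periodic and at most
  one number otherwise; \<open>0\<close> is excluded by \<open>x \<noteq> y\<close>.\<close>

lemma avoidable_orbit:
  assumes inj: "inj_on g T" and clo: "\<And>z. z \<in> T \<Longrightarrow> g z \<in> T" and x: "x \<in> T" and ne: "x \<noteq> y"
    and N: "\<And>n. n \<in> N \<Longrightarrow> (g ^^ n) x = y"
  shows "avoidable N"
proof (cases "N = {}")
  case True
  then show ?thesis using avoidable_singleton[of N 1] by simp
next
  case False
  then obtain n0 where n0: "n0 \<in> N" by blast
  have pc: "(g ^^ n) z \<in> T" if "z \<in> T" for z n using that clo by (induction n) auto
  have pinj: "z = z'" if "(g ^^ n) z = (g ^^ n) z'" "z \<in> T" "z' \<in> T" for n z z'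
    using that(1)
  proof (induction n)
    case (Suc n)
    then have "(g ^^ n) z = (g ^^ n) z'"
      using inj_onD[OF inj] pc that by (metis comp_apply funpow.simps(2))
    then show ?case by (rule Suc.IH)
  qed simp
  have diff: "(g ^^ (b - a)) x = x" if "a \<in> N" "b \<in> N" "a \<le> b" for a b
  proof -
    have "(g ^^ a) ((g ^^ (b - a)) x) = (g ^^ b) x"
      using that(3) by (metis comp_apply funpow_add le_add_diff_inverse)
    then have "(g ^^ a) ((g ^^ (b - a)) x) = (g ^^ a) x" using N that by simp
    then show ?thesis using pinj pc x by blast
  qed
  show ?thesis
  proof (cases "\<exists>q>0. (g ^^ q) x = x")
    case True
    define q where "q = (LEAST q. 0 < q \<and> (g ^^ q) x = x)"
    have q: "0 < q" "(g ^^ q) x = x"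
      using LeastI_ex[of "\<lambda>q. 0 < q \<and> (g ^^ q) x = x"] True by (auto simp: q_def)
    have mult: "(g ^^ (q * k)) x = x" for k
      by (induction k) (auto simp: q(2) funpow_add)
    have "q dvd r" if "(g ^^ r) x = x" for r
    proof -
      have "(g ^^ (r mod q)) x = x"
        using that mult[of "r div q"] by (metis comp_apply funpow_add mod_mult_div_eq)
      moreover have "r mod q < q" using q(1) by simp
      ultimately have "r mod q = 0" using not_less_Least[of "r mod q" "\<lambda>q. 0 < q \<and> (g ^^ q) x = x"]
        unfolding q_def by auto
      then show ?thesis by auto
    qed
    note dv = this
    show ?thesis
    proof (rule avoidable_progression[OF _ q(1)])
      show "\<not> q dvd n0" using mult N[OF n0] ne by (metis dvdE)
      show "n mod q = n0 mod q" if "n \<in> N" for n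
        using dv[OF diff[OF n0 that]] dv[OF diff[OF that n0]]
        by (metis mod_eq_dvd_iff_nat nat_le_linear)
    qed
  next
    case False
    have "n = n0" if "n \<in> N" for n
      using diff[OF n0 that] diff[OF that n0] False by (metis nat_le_linear nat_less_le zero_less_diff)
    moreover have "0 < n0" using N[OF n0] ne by (cases n0) auto
    ultimately show ?thesis by (rule avoidable_singleton)
  qed
qed

section \<open>Words, retractions and parabolic subgroups\<close>

locale graph_group =
  fixes V :: "'v set" and E :: "'v \<Rightarrow> 'v \<Rightarrow> bool" and G :: "'v \<Rightarrow> 'a monoid"
  assumes symE: "\<And>u w. E u w \<Longrightarrow> E w u" and irrE: "\<And>v. \<not> E v v"
    and grp: "\<And>v. v \<in> V \<Longrightarrow> group (G v)"
begin

abbreviation "P \<equiv> graph_product V E G"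
abbreviation "W \<equiv> gp_words V G"
abbreviation "par \<equiv> parabolic V E G"

definition eqw :: "('v \<times> 'a) list \<Rightarrow> ('v \<times> 'a) list \<Rightarrow> bool" where
  "eqw = (symclp (gp_step V E G))\<^sup>*\<^sup>*"

definition cls :: "('v \<times> 'a) list \<Rightarrow> ('v \<times> 'a) list set" where
  "cls w = gp_rel V E G `` {w}"

lemma words_Nil [simp]: "[] \<in> W"
  by (simp add: gp_words_def)

lemma words_append [simp]: "a @ b \<in> W \<longleftrightarrow> a \<in> W \<and> b \<in> W"
  by (auto simp: gp_words_def)

lemma words_Cons [simp]: "p # b \<in> W \<longleftrightarrow> fst p \<in> V \<and> snd p \<in> carrier (G (fst p)) \<and> b \<in> W"
  by (auto simp: gp_words_def)

lemma group_closed [simp]: "\<lbrakk>v \<in> V; g \<in> carrier (G v); h \<in> carrier (G v)\<rbrakk> \<Longrightarrow> g \<otimes>\<^bsub>G v\<^esub> h \<in> carrier (G v)"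
  using grp[of v] by (simp add: group_def monoid.m_closed)

lemma group_one [simp]: "v \<in> V \<Longrightarrow> \<one>\<^bsub>G v\<^esub> \<in> carrier (G v)"
  using grp[of v] by (simp add: group_def monoid.one_closed)

lemma step_words: "gp_step V E G a b \<Longrightarrow> a \<in> W \<and> b \<in> W"
  by (induction rule: gp_step.induct) auto

lemma step_context:
  assumes "gp_step V E G a b" "x \<in> W" "y \<in> W"
  shows "gp_step V E G (x @ a @ y) (x @ b @ y)"
  using assms(1)
proof cases
  case (drop xs v ys)
  then show ?thesis using gp_step.drop[where xs = "x @ xs" and ys = "ys @ y" and v = v and V = V and G = G and E = E] assms by simp
next
  case (merge xs v g h ys)
  then show ?thesis using gp_step.merge[where xs = "x @ xs" and ys = "ys @ y" and v = v and g = g and h = h and V = V and G = G and E = E] assms by simp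
next
  case (swap u w xs g h ys)
  then show ?thesis using gp_step.swap[where xs = "x @ xs" and ys = "ys @ y" and u = u and w = w and g = g and h = h and V = V and G = G and E = E] assms by simp
qed

lemma eqw_refl [simp]: "eqw a a"
  by (simp add: eqw_def)

lemma eqw_trans: "\<lbrakk>eqw a b; eqw b c\<rbrakk> \<Longrightarrow> eqw a c"
  unfolding eqw_def by (rule rtranclp_trans)

lemma eqw_sym: "eqw a b \<Longrightarrow> eqw b a"
  unfolding eqw_def
proof (induction rule: rtranclp_induct)
  case (step b c)
  then have "symclp (gp_step V E G) c b" by (auto simp: symclp_def)
  then show ?case using step.IH by (rule converse_rtranclp_into_rtranclp)
qed simp

lemma step_eqw: "gp_step V E G a b \<Longrightarrow> eqw a b"
  unfolding eqw_def by (auto simp: symclp_def)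

lemma eqw_words: "\<lbrakk>eqw a b; a \<in> W\<rbrakk> \<Longrightarrow> b \<in> W"
  unfolding eqw_def
  by (induction rule: rtranclp_induct) (auto simp: symclp_def dest: step_words)

lemma eqw_invariant:
  assumes "eqw a b" "\<And>a b. gp_step V E G a b \<Longrightarrow> F a = F b" shows "F a = F b"
  using assms(1) unfolding eqw_def
proof (induction rule: rtranclp_induct)
  case (step b c)
  then have "F b = F c" using assms(2)[of b c] assms(2)[of c b] unfolding symclp_def by argo
  then show ?case using step.IH by simp
qed simp

lemma eqw_context:
  assumes "eqw a b" "x \<in> W" "y \<in> W" shows "eqw (x @ a @ y) (x @ b @ y)"
  using assms(1) unfolding eqw_def
proof (induction rule: rtranclp_induct)
  case (step b c)
  then have "symclp (gp_step V E G) (x @ b @ y) (x @ c @ y)"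
    using step_context assms by (auto simp: symclp_def)
  then show ?case using step.IH by (rule rtranclp.rtrancl_into_rtrancl[rotated])
qed simp

lemma eqw_append:
  assumes "eqw a a'" "eqw b b'" "a \<in> W" "b \<in> W" shows "eqw (a @ b) (a' @ b')"
proof -
  have "eqw (a @ b) (a' @ b)" using eqw_context[OF assms(1), of "[]" b] assms by simp
  moreover have "eqw (a' @ b) (a' @ b')"
    using eqw_context[OF assms(2), of a' "[]"] eqw_words[OF assms(1,3)] by simp
  ultimately show ?thesis by (rule eqw_trans)
qed

lemma mem_cls: "b \<in> cls a \<longleftrightarrow> a \<in> W \<and> eqw a b"
  by (simp add: cls_def gp_rel_def eqw_def)

lemma cls_eq_iff:
  assumes "a \<in> W" "b \<in> W" shows "cls a = cls b \<longleftrightarrow> eqw a b"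
proof
  assume "cls a = cls b"
  then have "b \<in> cls a" using assms by (simp add: mem_cls)
  then show "eqw a b" by (simp add: mem_cls)
next
  assume ab: "eqw a b"
  have "z \<in> cls a \<longleftrightarrow> z \<in> cls b" for z
    unfolding mem_cls using assms ab eqw_sym[OF ab] eqw_trans by blast
  then show "cls a = cls b" by blast
qed

lemma carrier_P: "carrier P = cls ` W"
  by (auto simp: graph_product_def quotient_def cls_def)

lemma cls_carrier [simp]: "w \<in> W \<Longrightarrow> cls w \<in> carrier P"
  by (simp add: carrier_P)

lemma carrierE:
  assumes "x \<in> carrier P" obtains w where "w \<in> W" "x = cls w"
  using assms by (auto simp: carrier_P)

lemma one_P: "\<one>\<^bsub>P\<^esub> = cls []"
  by (simp add: graph_product_def cls_def)

lemma mult_cls: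
  assumes "a \<in> W" "b \<in> W" shows "cls a \<otimes>\<^bsub>P\<^esub> cls b = cls (a @ b)"
proof -
  have "cls a \<otimes>\<^bsub>P\<^esub> cls b = gp_rel V E G `` {x @ y | x y. x \<in> cls a \<and> y \<in> cls b}"
    by (simp add: graph_product_def)
  also have "\<dots> = cls (a @ b)"
  proof (intro equalityI subsetI)
    fix z assume "z \<in> gp_rel V E G `` {x @ y | x y. x \<in> cls a \<and> y \<in> cls b}"
    then obtain x y where xy: "x \<in> cls a" "y \<in> cls b" "z \<in> cls (x @ y)"
      by (auto simp: cls_def)
    then have "eqw (a @ b) (x @ y)" "eqw (x @ y) z" using assms eqw_append by (auto simp: mem_cls)
    then show "z \<in> cls (a @ b)" using assms eqw_trans by (auto simp: mem_cls)
  next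
    fix z assume "z \<in> cls (a @ b)"
    moreover have "a \<in> cls a" "b \<in> cls b" using assms by (auto simp: mem_cls)
    ultimately show "z \<in> gp_rel V E G `` {x @ y | x y. x \<in> cls a \<and> y \<in> cls b}"
      unfolding cls_def by blast
  qed
  finally show ?thesis .
qed

lemma cls_drop: "\<lbrakk>a \<in> W; b \<in> W; v \<in> V\<rbrakk> \<Longrightarrow> cls (a @ (v, \<one>\<^bsub>G v\<^esub>) # b) = cls (a @ b)"
  by (subst cls_eq_iff) (auto intro!: step_eqw gp_step.drop)

lemma cls_merge:
  "\<lbrakk>a \<in> W; b \<in> W; v \<in> V; g \<in> carrier (G v); h \<in> carrier (G v)\<rbrakk>
    \<Longrightarrow> cls (a @ (v, g) # (v, h) # b) = cls (a @ (v, g \<otimes>\<^bsub>G v\<^esub> h) # b)"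
  by (subst cls_eq_iff) (auto intro!: step_eqw gp_step.merge)

lemma cls_swap:
  "\<lbrakk>a \<in> W; b \<in> W; u \<in> V; w \<in> V; E u w; g \<in> carrier (G u); h \<in> carrier (G w)\<rbrakk>
    \<Longrightarrow> cls (a @ (u, g) # (w, h) # b) = cls (a @ (w, h) # (u, g) # b)"
  by (subst cls_eq_iff) (auto intro!: step_eqw gp_step.swap)

definition winv :: "('v \<times> 'a) list \<Rightarrow> ('v \<times> 'a) list" where
  "winv w = rev (map (\<lambda>(v, g). (v, inv\<^bsub>G v\<^esub> g)) w)"

lemma winv_words [simp]: "w \<in> W \<Longrightarrow> winv w \<in> W"
  using grp by (auto simp: winv_def gp_words_def group.inv_closed)

lemma winv_cancel: "w \<in> W \<Longrightarrow> cls (winv w @ w) = cls []"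
proof (induction w)
  case (Cons p w)
  obtain v g where p: "p = (v, g)" by force
  have v: "v \<in> V" "g \<in> carrier (G v)" "w \<in> W" using Cons p by auto
  interpret Gv: group "G v" using grp v by blast
  have "cls (winv (p # w) @ p # w) = cls (winv w @ (v, inv\<^bsub>G v\<^esub> g) # (v, g) # w)"
    by (simp add: winv_def p)
  also have "\<dots> = cls (winv w @ (v, \<one>\<^bsub>G v\<^esub>) # w)" using v cls_merge[of "winv w" w v] by simp
  also have "\<dots> = cls (winv w @ w)" using v cls_drop by simp
  finally show ?case using Cons v by simp
qed (simp add: winv_def)

lemma group_P: "group P"
proof (rule groupI)
  show "x \<otimes>\<^bsub>P\<^esub> y \<in> carrier P" if "x \<in> carrier P" "y \<in> carrier P" for x y
    using that by (auto simp: carrier_P mult_cls)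
  show "x \<otimes>\<^bsub>P\<^esub> y \<otimes>\<^bsub>P\<^esub> z = x \<otimes>\<^bsub>P\<^esub> (y \<otimes>\<^bsub>P\<^esub> z)"
    if "x \<in> carrier P" "y \<in> carrier P" "z \<in> carrier P" for x y z
    using that by (auto simp: carrier_P mult_cls)
  show "\<exists>y\<in>carrier P. y \<otimes>\<^bsub>P\<^esub> x = \<one>\<^bsub>P\<^esub>" if x: "x \<in> carrier P" for x
  proof -
    obtain w where "w \<in> W" "x = cls w" using carrierE[OF x] by blast
    then show ?thesis by (intro bexI[of _ "cls (winv w)"]) (simp_all add: one_P mult_cls winv_cancel)
  qed
qed (auto simp: one_P carrier_P mult_cls)

sublocale P: group P by (rule group_P)

definition ret :: "'v set \<Rightarrow> ('v \<times> 'a) list \<Rightarrow> ('v \<times> 'a) list" where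
  "ret L w = filter (\<lambda>p. fst p \<in> L) w"

lemma ret_words [simp]: "w \<in> W \<Longrightarrow> ret L w \<in> W"
  by (auto simp: ret_def gp_words_def)

lemma ret_append [simp]: "ret L (a @ b) = ret L a @ ret L b"
  by (simp add: ret_def)

lemma ret_Nil [simp]: "ret L [] = []"
  by (simp add: ret_def)

lemma ret_Cons: "ret L (p # w) = (if fst p \<in> L then p # ret L w else ret L w)"
  by (simp add: ret_def)

lemma ret_ret: "ret L (ret M w) = ret (L \<inter> M) w"
  unfolding ret_def filter_filter by (rule filter_cong) (rule refl, blast)

lemma ret_cong: "\<lbrakk>a \<in> W; b \<in> W; cls a = cls b\<rbrakk> \<Longrightarrow> cls (ret L a) = cls (ret L b)"
proof -
  assume ab: "a \<in> W" "b \<in> W" "cls a = cls b"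
  have "cls (ret L a) = cls (ret L b)" if "gp_step V E G a b" for a b
    using that
  proof cases
    case (drop xs v ys)
    then show ?thesis using cls_drop[of "ret L xs" "ret L ys" v] by (simp add: ret_Cons)
  next
    case (merge xs v g h ys)
    then show ?thesis using cls_merge[of "ret L xs" "ret L ys" v g h] by (simp add: ret_Cons)
  next
    case (swap u w xs g h ys)
    then show ?thesis using cls_swap[of "ret L xs" "ret L ys" u w g h] by (auto simp: ret_Cons)
  qed
  then show ?thesis using eqw_invariant[of a b "\<lambda>w. cls (ret L w)"] ab cls_eq_iff by blast
qed

text \<open>The retraction of the group onto \<open>par L\<close> induced by deleting letters. It is
  well defined because every rewriting step survives the deletion.\<close>

definition rho :: "'v set \<Rightarrow> ('v \<times> 'a) list set \<Rightarrow> ('v \<times> 'a) list set" where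
  "rho L x = cls (ret L (SOME w. w \<in> W \<and> cls w = x))"

lemma rho_cls [simp]:
  assumes "w \<in> W" shows "rho L (cls w) = cls (ret L w)"
proof -
  let ?w = "SOME w'. w' \<in> W \<and> cls w' = cls w"
  have "?w \<in> W \<and> cls ?w = cls w" by (rule someI[of _ w]) (simp add: assms)
  then show ?thesis unfolding rho_def using ret_cong assms by blast
qed

lemma rho_closed [simp]: "x \<in> carrier P \<Longrightarrow> rho L x \<in> carrier P"
proof -
  assume "x \<in> carrier P"
  then obtain w where "w \<in> W" "x = cls w" using carrierE by blast
  then show ?thesis by simp
qed

lemma rho_mult:
  assumes "x \<in> carrier P" "y \<in> carrier P" shows "rho L (x \<otimes>\<^bsub>P\<^esub> y) = rho L x \<otimes>\<^bsub>P\<^esub> rho L y"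
proof -
  obtain a b where "a \<in> W" "x = cls a" "b \<in> W" "y = cls b" using assms carrierE by metis
  then show ?thesis by (simp add: mult_cls)
qed

lemma rho_inv: "x \<in> carrier P \<Longrightarrow> rho L (inv\<^bsub>P\<^esub> x) = inv\<^bsub>P\<^esub> (rho L x)"
proof -
  assume x: "x \<in> carrier P"
  have "rho L (inv\<^bsub>P\<^esub> x) \<otimes>\<^bsub>P\<^esub> rho L x = rho L \<one>\<^bsub>P\<^esub>"
    using rho_mult[of "inv\<^bsub>P\<^esub> x" x L] x by simp
  also have "\<dots> = \<one>\<^bsub>P\<^esub>" by (simp add: one_P)
  finally show ?thesis using x by (simp add: P.inv_equality)
qed

lemma par_def: "par L = {cls w | w. w \<in> W \<and> (\<forall>p\<in>set w. fst p \<in> L)}"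
  by (simp add: parabolic_def cls_def)

lemma par_carrier: "x \<in> par L \<Longrightarrow> x \<in> carrier P"
  by (auto simp: par_def)

text \<open>Membership becomes a fixed-point equation for an endomorphism. Closure of
  \<open>par L\<close> under the operations, and the formula for intersections, are then
  formal.\<close>

lemma par_iff_rho: "x \<in> carrier P \<Longrightarrow> x \<in> par L \<longleftrightarrow> rho L x = x"
proof
  assume "x \<in> par L"
  then obtain w where "w \<in> W" "\<forall>p\<in>set w. fst p \<in> L" "x = cls w" by (auto simp: par_def)
  moreover from this have "ret L w = w" by (simp add: ret_def)
  ultimately show "rho L x = x" by simp
next
  assume x: "x \<in> carrier P" "rho L x = x"
  then obtain w where w: "w \<in> W" "x = cls w" by (auto elim: carrierE)
  then have "x = cls (ret L w)" using x by simp
  moreover have "ret L w \<in> W" using w by simp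
  moreover have "\<forall>p\<in>set (ret L w). fst p \<in> L" by (simp add: ret_def)
  ultimately show "x \<in> par L" unfolding par_def by blast
qed

lemma rho_par: "x \<in> carrier P \<Longrightarrow> rho L x \<in> par L"
proof -
  assume "x \<in> carrier P"
  then obtain w where "w \<in> W" "x = cls w" using carrierE by blast
  then show ?thesis using par_iff_rho[of "rho L x" L] by (simp add: ret_ret)
qed

lemma rho_par_inter: "x \<in> par M \<Longrightarrow> rho L x \<in> par (L \<inter> M)"
proof -
  assume x: "x \<in> par M"
  then obtain w where w: "w \<in> W" "\<forall>p\<in>set w. fst p \<in> M" "x = cls w" by (auto simp: par_def)
  then have "ret L w = ret (L \<inter> M) w" unfolding ret_def by (intro filter_cong) auto
  then show ?thesis using w rho_par[of x "L \<inter> M"] by simp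
qed

lemma par_inter:
  assumes "x \<in> par L" "x \<in> par M" shows "x \<in> par (L \<inter> M)"
proof -
  have "rho L x = x" using assms(1) par_iff_rho par_carrier by blast
  then show ?thesis using rho_par_inter[OF assms(2), of L] by simp
qed

lemma par_mono: "L \<subseteq> M \<Longrightarrow> par L \<subseteq> par M"
  by (auto simp: par_def)

lemma par_mult:
  assumes "x \<in> par L" "y \<in> par L" shows "x \<otimes>\<^bsub>P\<^esub> y \<in> par L"
proof -
  have c: "x \<in> carrier P" "y \<in> carrier P" using assms par_carrier by blast+
  then have "rho L x = x" "rho L y = y" using assms par_iff_rho by blast+
  then show ?thesis using par_iff_rho[of "x \<otimes>\<^bsub>P\<^esub> y" L] rho_mult[OF c] c by simp
qed

lemma par_inv:
  assumes "x \<in> par L" shows "inv\<^bsub>P\<^esub> x \<in> par L"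
proof -
  have c: "x \<in> carrier P" using assms par_carrier by blast
  then have "rho L x = x" using assms par_iff_rho by blast
  then show ?thesis using par_iff_rho[of "inv\<^bsub>P\<^esub> x" L] rho_inv[OF c] c by simp
qed

lemma par_one: "\<one>\<^bsub>P\<^esub> \<in> par L"
  by (auto simp: par_def one_P)

lemma par_pow: "x \<in> par L \<Longrightarrow> x [^]\<^bsub>P\<^esub> (n::nat) \<in> par L"
proof (induction n)
  case (Suc n)
  then show ?case using par_mult by simp
qed (simp add: par_one)

lemma cls_par: "\<lbrakk>w \<in> W; fst ` set w \<subseteq> L\<rbrakk> \<Longrightarrow> cls w \<in> par L"
  by (auto simp: par_def)

text \<open>Retracting the word to the letters in \<open>L\<close> does not change the element.\<close>

lemma shortest_word_par:
  assumes "w \<in> W" "cls w \<in> par L" "\<And>w'. \<lbrakk>w' \<in> W; cls w' = cls w\<rbrakk> \<Longrightarrow> length w \<le> length w'"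
  shows "fst ` set w \<subseteq> L"
proof -
  have "cls (ret L w) = cls w" using assms(1,2) par_iff_rho[of "cls w" L] by simp
  then have "length w \<le> length (ret L w)" using assms(3)[OF ret_words[OF assms(1)]] by blast
  then have "\<not> length (filter (\<lambda>p. fst p \<in> L) w) < length w" by (simp add: ret_def)
  then show ?thesis using length_filter_less[of _ w "\<lambda>p. fst p \<in> L"] by blast
qed

lemma letter_commute:
  assumes "v \<in> V" "a \<in> carrier (G v)" "w \<in> W" "\<And>p. p \<in> set w \<Longrightarrow> E v (fst p)"
  shows "cls ((v, a) # w) = cls (w @ [(v, a)])"
  using assms(3,4)
proof (induction w)
  case (Cons p w)
  obtain u b where p: "p = (u, b)" by force
  have u: "u \<in> V" "b \<in> carrier (G u)" "w \<in> W" "E v u"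
    using Cons.prems(1) Cons.prems(2)[of p] p by simp_all
  have "cls ((v, a) # p # w) = cls ([(u, b)] @ (v, a) # w)"
    using cls_swap[of "[]" w v u a b] u assms p by simp
  also have "\<dots> = cls [(u, b)] \<otimes>\<^bsub>P\<^esub> cls ((v, a) # w)" using u assms by (simp add: mult_cls)
  also have "\<dots> = cls [(u, b)] \<otimes>\<^bsub>P\<^esub> cls (w @ [(v, a)])" using Cons by simp
  finally show ?case using u assms by (simp add: mult_cls p)
qed simp

end

section \<open>Trees of lists\<close>

fun lcp :: "'b list \<Rightarrow> 'b list \<Rightarrow> nat" where
  "lcp (x # xs) (y # ys) = (if x = y then Suc (lcp xs ys) else 0)"
| "lcp _ _ = 0"

text \<open>Distance in the tree in which the parent of a nonempty list is the list without its last
  entry.\<close>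

definition ldist :: "'b list \<Rightarrow> 'b list \<Rightarrow> int" where
  "ldist x y = int (length x) + int (length y) - 2 * int (lcp x y)"

lemma lcp_sym: "lcp x y = lcp y x"
  by (induction x y rule: lcp.induct) auto

lemma lcp_le: "lcp x y \<le> length x" "lcp x y \<le> length y"
  by (induction x y rule: lcp.induct) auto

lemma lcp_take: "take (lcp x y) x = take (lcp x y) y"
  by (induction x y rule: lcp.induct) auto

lemma lcp_geI: "\<lbrakk>take n x = take n y; n \<le> length x; n \<le> length y\<rbrakk> \<Longrightarrow> n \<le> lcp x y"
proof (induction x y arbitrary: n rule: lcp.induct)
  case (1 x xs y ys)
  then show ?case by (cases n) auto
qed auto

lemma lcp_ultra: "min (lcp x y) (lcp y z) \<le> lcp x z"
proof (rule lcp_geI)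
  let ?m = "min (lcp x y) (lcp y z)"
  have "take ?m x = take ?m y" using lcp_take[of x y] by (metis min.cobounded1 min.absorb1 take_take)
  moreover have "take ?m y = take ?m z" using lcp_take[of y z] by (metis min.cobounded2 min.absorb1 take_take)
  ultimately show "take ?m x = take ?m z" by simp
qed (use lcp_le[of x y] lcp_le[of y z] in auto)

lemma lcp_self [simp]: "lcp x x = length x"
  by (induction x) auto

lemma lcp_takeL: "n \<le> length x \<Longrightarrow> lcp (take n x) x = n"
  using lcp_geI[of n "take n x" x] lcp_le[of "take n x" x] by simp

lemma lcp_append_self [simp]: "lcp x (x @ y) = length x"
  by (induction x) auto

lemma ldist_refl [simp]: "ldist x x = 0"
  by (simp add: ldist_def)

lemma ldist_sym: "ldist x y = ldist y x"
  by (simp add: ldist_def lcp_sym)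

lemma ldist_Cons [simp]: "ldist (a # x) (a # y) = ldist x y"
  by (simp add: ldist_def)

text \<open>Lengths of common prefixes satisfy an ultrametric inequality, which yields the
  four-point condition. A geodesic goes from \<open>x\<close> down to the common prefix and up to
  \<open>y\<close>, so it consists of prefixes and stays in \<open>T\<close>.\<close>

lemma tree_of_lists:
  assumes ne: "T \<noteq> {}" and pre: "\<And>x n. x \<in> T \<Longrightarrow> take n x \<in> T"
  shows "tree T ldist (\<lambda>x. even (length x))"
proof
  show "ldist x y = 0 \<longleftrightarrow> x = y" for x y :: "'a list"
  proof
    assume "ldist x y = 0"
    then have "lcp x y = length x" "lcp x y = length y"
      using lcp_le[of x y] by (auto simp: ldist_def)
    then show "x = y" using lcp_take[of x y] by simp
  qed simp
  show "ldist x y = ldist y x" for x y :: "'a list" by (rule ldist_sym)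
  show "ldist x y + ldist z w \<le> max (ldist x z + ldist y w) (ldist x w + ldist y z)"
    for x y z w :: "'a list"
  proof -
    have "min (lcp x z + lcp y w) (lcp x w + lcp y z) \<le> lcp x y + lcp z w"
      using lcp_ultra[of x z y] lcp_ultra[of x w y] lcp_ultra[of z x w] lcp_ultra[of z y w]
        lcp_sym[of z y] lcp_sym[of w y] lcp_sym[of z x]
by linarith
    then show ?thesis unfolding ldist_def by linarith
  qed
  show "\<exists>z\<in>T. ldist x z = k \<and> ldist z y = ldist x y - k"
    if "x \<in> T" "y \<in> T" "0 \<le> k" "k \<le> ldist x y" for x y k
  proof -
    define m where "m = lcp x y"
    have m: "m \<le> length x" "m \<le> length y" using lcp_le by (simp_all add: m_def)
    show ?thesis
    proof (cases "k \<le> int (length x) - int m")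
      case True
      define n where "n = nat (int (length x) - k)"
      have n: "m \<le> n" "n \<le> length x" "int n = int (length x) - k" using True that(3) by (auto simp: n_def)
      let ?z = "take n x"
      have zx: "lcp ?z x = n" using lcp_takeL n(2) .
      have "m \<le> lcp ?z y"
        by (rule lcp_geI) (use n m lcp_take[of x y] in \<open>simp_all add: m_def min_def\<close>)
      moreover have "min (lcp x ?z) (lcp ?z y) \<le> lcp x y" by (rule lcp_ultra)
      moreover have "lcp ?z y \<le> n" using lcp_le(1)[of ?z y] n by simp
      moreover have xz: "lcp x ?z = n" using zx lcp_sym[of x ?z] by simp
      ultimately have zy: "lcp ?z y = m" using n(1) unfolding m_def[symmetric] by linarith
      have "length ?z = n" using n(2) by simp
      then have "ldist x ?z = k" "ldist ?z y = ldist x y - k"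
        unfolding ldist_def xz zy m_def[symmetric] using n by linarith+
      then show ?thesis using pre[OF that(1)] by blast
    next
      case False
      define n where "n = nat (k - int (length x) + 2 * int m)"
      have n: "m \<le> n" "n \<le> length y" "int n = k - int (length x) + 2 * int m"
        using False that(4) m by (auto simp: n_def ldist_def m_def)
      let ?z = "take n y"
      have zy: "lcp ?z y = n" using lcp_takeL n(2) .
      have "m \<le> lcp ?z x"
        by (rule lcp_geI) (use n m lcp_take[of x y] in \<open>simp_all add: m_def min_def\<close>)
      moreover have "min (lcp x ?z) (lcp ?z y) \<le> lcp x y" by (rule lcp_ultra)
      moreover have "lcp ?z x \<le> n" using lcp_le(1)[of ?z x] n by simp
      moreover have "lcp x ?z = lcp ?z x" by (rule lcp_sym)
      ultimately have zx: "lcp x ?z = m"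
        using zy n(1) unfolding m_def[symmetric] by linarith
      have "length ?z = n" using n(2) by simp
      then have "ldist x ?z = k" "ldist ?z y = ldist x y - k"
        unfolding ldist_def zx zy m_def[symmetric] using n by linarith+
      then show ?thesis using pre[OF that(2)] by blast
    qed
  qed
  show "even (ldist x y) \<longleftrightarrow> even (length x) = even (length y)" for x y :: "'a list"
    by (simp add: ldist_def)
qed (rule ne)

lemma ldist_map:
  assumes "inj_on f (set x \<union> set y)" shows "ldist (map f x) (map f y) = ldist x y"
proof -
  have "lcp (map f x) (map f y) = lcp x y"
    using assms
  proof (induction x y rule: lcp.induct)
    case (1 x xs y ys)
    then have "f x = f y \<longleftrightarrow> x = y" by (auto simp: inj_on_def)
    moreover have "inj_on f (set xs \<union> set ys)" using 1(2) by (rule inj_on_subset) auto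
    ultimately show ?case using 1(1) by simp
  qed auto
  then show ?thesis by (simp add: ldist_def)
qed

lemma ldist_one:
  fixes x y :: "'b list"
  assumes "ldist x y = 1" shows "(\<exists>e. y = x @ [e]) \<or> (\<exists>e. x = y @ [e])"
proof -
  have le: "lcp x y \<le> length x" "lcp x y \<le> length y" by (rule lcp_le)+
  have t: "take (lcp x y) x = take (lcp x y) y" by (rule lcp_take)
  have "int (length x) + int (length y) = 1 + 2 * int (lcp x y)"
    using assms by (simp add: ldist_def)
  then have "length x = lcp x y \<and> length y = Suc (length x) \<or> length y = lcp x y \<and> length x = Suc (length y)"
  proof -
    have "int a + int b = 1 + 2 * int m \<Longrightarrow> m \<le> a \<Longrightarrow> m \<le> b \<Longrightarrow> a = m \<and> b = Suc a \<or> b = m \<and> a = Suc b"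
      for a b m by presburger
    then show ?thesis using \<open>int (length x) + _ = _\<close> le by blast
  qed
  then consider "length x = lcp x y" "length y = Suc (length x)" | "length y = lcp x y" "length x = Suc (length y)"
    by blast
  then show ?thesis
  proof cases
    case 1
    then have "x = take (length x) y" using t by simp
    then have "y = x @ drop (length x) y" by (metis append_take_drop_id)
    moreover have "length (drop (length x) y) = 1" using 1 by simp
    ultimately show ?thesis by (metis One_nat_def length_0_conv length_Suc_conv)
  next
    case 2
    then have "y = take (length y) x" using t by simp
    then have "x = y @ drop (length y) x" by (metis append_take_drop_id)
    moreover have "length (drop (length y) x) = 1" using 2 by simp
    ultimately show ?thesis by (metis One_nat_def length_0_conv length_Suc_conv)
  qed
qed

section \<open>The Bass--Serre tree of a vertex\<close>

locale graph_tree = graph_group V E G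
  for V :: "'v set" and E :: "'v \<Rightarrow> 'v \<Rightarrow> bool" and G :: "'v \<Rightarrow> 'a monoid" +
  fixes v :: 'v
  assumes vV: "v \<in> V"
begin

abbreviation "lk \<equiv> {u \<in> V. E v u}"
abbreviation "i0 \<equiv> par lk"

text \<open>Cosets of the link, which index the conjugates of \<open>G v\<close> that generate the
  kernel. The parameter \<open>L\<close> cuts out a subtree that \<open>par L\<close> preserves; the
  induction for square roots needs it.\<close>

definition idx :: "'v set \<Rightarrow> ('v \<times> 'a) list set set set" where
  "idx L = (\<lambda>x. x <#\<^bsub>P\<^esub> par lk) ` par (L - {v})"

sublocale Gv: group "G v" by (rule grp[OF vV])

text \<open>\<open>j\<close> is the index that precedes the list and must not be repeated at its
  start. A list may break off after an index, which is how the cosets of the star arise.\<close>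

fun red :: "('v \<times> 'a) list set set set \<Rightarrow> ('v \<times> 'a) list set set option
    \<Rightarrow> (('v \<times> 'a) list set set + 'a) list \<Rightarrow> bool" where
  "red S j [] \<longleftrightarrow> True"
| "red S j (Inr a # x) \<longleftrightarrow> False"
| "red S j [Inl i] \<longleftrightarrow> i \<in> S \<and> Some i \<noteq> j"
| "red S j (Inl i # Inl k # x) \<longleftrightarrow> False"
| "red S j (Inl i # Inr a # x) \<longleftrightarrow>
     i \<in> S \<and> Some i \<noteq> j \<and> a \<in> carrier (G v) \<and> a \<noteq> \<one>\<^bsub>G v\<^esub> \<and> red S (Some i) x"

text \<open>Vertices of the Bass--Serre tree for \<open>v\<close>. The kernel of the retraction that kills \<open>G v\<close> is
  the free product of the conjugates of \<open>G v\<close> indexed by the cosets of the link, and the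
  alternating lists are its normal forms; those ending with an index are the cosets of the star.\<close>

definition TT :: "'v set \<Rightarrow> (('v \<times> 'a) list set set + 'a) list set" where
  "TT L = {x. red (idx L) None x}"

text \<open>The normal form of a letter \<open>b\<close> of the factor with index \<open>i0\<close>
  followed by \<open>r\<close>, where a trivial letter disappears.\<close>

definition join where
  "join b r = (if b = \<one>\<^bsub>G v\<^esub> then r else Inl i0 # Inr b # r)"

text \<open>Left multiplication of normal forms by a letter of \<open>G v\<close>. The lone index
  \<open>[Inl i0]\<close> stands for the coset of the star, which contains \<open>G v\<close>, so it
  is fixed.\<close>

fun smul where
  "smul a (Inl i # Inr b # r) = (if i = i0 then join (a \<otimes>\<^bsub>G v\<^esub> b) r else join a (Inl i # Inr b # r))"
| "smul a x = (if x = [Inl i0] then x else join a x)"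

text \<open>Elements without \<open>v\<close> act on the kernel by conjugation, which permutes its
  factors as it permutes their indices.\<close>

definition imap where
  "imap h x = map (map_sum (\<lambda>i. h <#\<^bsub>P\<^esub> i) (\<lambda>a. a)) x"

definition la where
  "la p x = (if fst p = v then smul (snd p) x else imap (cls [p]) x)"

definition actw where "actw w x = foldr la w x"

lemma red_take: "red S j x \<Longrightarrow> red S j (take n x)"
proof (induction S j x arbitrary: n rule: red.induct)
  case (3 S j i)
  then show ?case by (cases n) auto
next
  case (5 S j i a x)
  then show ?case
    by (cases n; cases "n - 1") auto
qed auto

lemma red_None: "red S j x \<Longrightarrow> red S None x"
  by (induction S j x rule: red.induct) auto

lemma idx_carrier: "i \<in> idx L \<Longrightarrow> i \<subseteq> carrier P"
  by (auto simp: idx_def l_coset_def par_carrier)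

lemma i0_carrier: "i0 \<subseteq> carrier P"
  by (auto simp: par_carrier)

lemma coset_one: "i \<subseteq> carrier P \<Longrightarrow> \<one>\<^bsub>P\<^esub> <#\<^bsub>P\<^esub> i = i"
  by (rule P.lcos_mult_one)

lemma coset_mult: "\<lbrakk>h \<in> carrier P; k \<in> carrier P; i \<subseteq> carrier P\<rbrakk> \<Longrightarrow> h <#\<^bsub>P\<^esub> (k <#\<^bsub>P\<^esub> i) = (h \<otimes>\<^bsub>P\<^esub> k) <#\<^bsub>P\<^esub> i"
  by (simp add: P.lcos_m_assoc)

lemma i0_idx [simp]: "i0 \<in> idx L"
  unfolding idx_def
  by (rule image_eqI[where x = "\<one>\<^bsub>P\<^esub>"]) (simp_all only: coset_one[OF i0_carrier] par_one)

lemma coset_idx: "\<lbrakk>h \<in> par (L - {v}); i \<in> idx L\<rbrakk> \<Longrightarrow> h <#\<^bsub>P\<^esub> i \<in> idx L"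
proof -
  assume h: "h \<in> par (L - {v})" and "i \<in> idx L"
  then obtain x where x: "x \<in> par (L - {v})" "i = x <#\<^bsub>P\<^esub> par lk" by (auto simp: idx_def)
  then have "h <#\<^bsub>P\<^esub> i = (h \<otimes>\<^bsub>P\<^esub> x) <#\<^bsub>P\<^esub> par lk"
    using coset_mult[OF par_carrier[OF h] par_carrier[OF x(1)] i0_carrier] by simp
  then show ?thesis unfolding idx_def using par_mult[OF h x(1)] by blast
qed

lemma coset_inj:
  assumes "h \<in> carrier P" "i \<subseteq> carrier P" "k \<subseteq> carrier P" "h <#\<^bsub>P\<^esub> i = h <#\<^bsub>P\<^esub> k" shows "i = k"
proof -
  have "inv\<^bsub>P\<^esub> h <#\<^bsub>P\<^esub> (h <#\<^bsub>P\<^esub> i) = inv\<^bsub>P\<^esub> h <#\<^bsub>P\<^esub> (h <#\<^bsub>P\<^esub> k)" using assms(4) by simp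
  then show ?thesis using assms(1-3) coset_mult[of "inv\<^bsub>P\<^esub> h" h] coset_one by (metis P.inv_closed P.l_inv)
qed

lemma coset_i0_iff: "h \<in> carrier P \<Longrightarrow> h <#\<^bsub>P\<^esub> i0 = i0 \<longleftrightarrow> h \<in> par lk"
proof
  assume "h \<in> carrier P" "h <#\<^bsub>P\<^esub> i0 = i0"
  moreover have "h \<otimes>\<^bsub>P\<^esub> \<one>\<^bsub>P\<^esub> \<in> h <#\<^bsub>P\<^esub> i0" unfolding l_coset_def using par_one by blast
  ultimately show "h \<in> par lk" by simp
next
  assume h: "h \<in> carrier P" "h \<in> par lk"
  show "h <#\<^bsub>P\<^esub> i0 = i0"
  proof (intro equalityI subsetI)
    fix z assume "z \<in> h <#\<^bsub>P\<^esub> i0"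
    then show "z \<in> i0" using par_mult[OF h(2)] by (auto simp: l_coset_def)
  next
    fix z assume z: "z \<in> i0"
    then have "h \<otimes>\<^bsub>P\<^esub> (inv\<^bsub>P\<^esub> h \<otimes>\<^bsub>P\<^esub> z) = z"
      using h par_carrier[OF z] by (simp add: P.m_assoc[symmetric])
    moreover have "inv\<^bsub>P\<^esub> h \<otimes>\<^bsub>P\<^esub> z \<in> i0" using par_mult[OF par_inv[OF h(2)] z] .
    ultimately show "z \<in> h <#\<^bsub>P\<^esub> i0" unfolding l_coset_def by blast
  qed
qed

lemma red_join: "\<lbrakk>b \<in> carrier (G v); red S (Some i0) r; i0 \<in> S\<rbrakk> \<Longrightarrow> red S None (join b r)"
  using red_None by (auto simp: join_def)

text \<open>Writing every vertex other than \<open>[Inl i0]\<close> as \<open>join b r\<close>, with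
  \<open>b\<close> possibly trivial, reduces the action of \<open>G v\<close> to multiplication on
  \<open>b\<close>.\<close>

lemma T_cases:
  assumes "red S None x"
  obtains "x = [Inl i0]" | b r where "b \<in> carrier (G v)" "red S (Some i0) r" "x = join b r"
proof (cases "x = [Inl i0]")
  case False
  have "\<exists>b r. b \<in> carrier (G v) \<and> red S (Some i0) r \<and> x = join b r"
    using assms False
  proof (induction S "None :: ('v \<times> 'a) list set set option" x rule: red.induct)
    case (5 S i a x)
    show ?case
    proof (cases "i = i0")
      case True
      then show ?thesis using 5 by (intro exI[of _ a] exI[of _ x]) (auto simp: join_def)
    next
      case False
      then show ?thesis using 5 by (intro exI[of _ "\<one>\<^bsub>G v\<^esub>"] exI[of _ "Inl i # Inr a # x"]) (auto simp: join_def)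
    qed
  next
    case (1 S)
    show ?case by (intro exI[of _ "\<one>\<^bsub>G v\<^esub>"] exI[of _ "[]"]) (auto simp: join_def)
  next
    case (3 S i)
    then show ?case by (intro exI[of _ "\<one>\<^bsub>G v\<^esub>"] exI[of _ "[Inl i]"]) (auto simp: join_def)
  qed auto
  then show ?thesis using that by blast
qed (use that in blast)

lemma smul_join:
  "\<lbrakk>a \<in> carrier (G v); b \<in> carrier (G v); red S (Some i0) r\<rbrakk> \<Longrightarrow> smul a (join b r) = join (a \<otimes>\<^bsub>G v\<^esub> b) r"
proof (cases "b = \<one>\<^bsub>G v\<^esub>")
  case True
  assume a: "a \<in> carrier (G v)" "red S (Some i0) r"
  have "smul a r = join a r"
    using a(2) by (induction S "Some i0" r rule: red.induct) auto
  then show ?thesis using True a by (simp add: join_def)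
qed (simp add: join_def)

lemma smul_i0 [simp]: "smul a [Inl i0] = [Inl i0]"
  by simp

lemma smul_closed:
  assumes "a \<in> carrier (G v)" "x \<in> TT L" shows "smul a x \<in> TT L"
proof -
  have x: "red (idx L) None x" using assms(2) by (simp add: TT_def)
  show ?thesis
  proof (rule T_cases[OF x])
    assume "x = [Inl i0]"
    then show ?thesis using assms(2) by simp
  next
    fix b r assume "b \<in> carrier (G v)" "red (idx L) (Some i0) r" "x = join b r"
    then show ?thesis using assms(1) red_join smul_join by (simp add: TT_def)
  qed
qed

lemma smul_smul:
  assumes "a \<in> carrier (G v)" "c \<in> carrier (G v)" "x \<in> TT L"
  shows "smul a (smul c x) = smul (a \<otimes>\<^bsub>G v\<^esub> c) x"
proof -
  have x: "red (idx L) None x" using assms(3) by (simp add: TT_def)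
  show ?thesis
  proof (rule T_cases[OF x])
    fix b r assume "b \<in> carrier (G v)" "red (idx L) (Some i0) r" "x = join b r"
    then show ?thesis using assms(1,2) smul_join by (simp add: Gv.m_assoc)
  qed simp
qed

lemma smul_one:
  assumes "x \<in> TT L" shows "smul \<one>\<^bsub>G v\<^esub> x = x"
proof -
  have x: "red (idx L) None x" using assms by (simp add: TT_def)
  show ?thesis
  proof (rule T_cases[OF x])
    fix b r assume "b \<in> carrier (G v)" "red (idx L) (Some i0) r" "x = join b r"
    then show ?thesis using smul_join[of "\<one>\<^bsub>G v\<^esub>" b] by simp
  qed simp
qed

lemma red_lcp: "red S (Some i0) r \<Longrightarrow> lcp r (Inl i0 # y) = 0"
  by (induction S "Some i0" r rule: red.induct) auto

lemma ldist_join: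
  assumes "red S (Some i0) r" "red S (Some i0) r'"
  shows "ldist (join b r) (join b' r') = (if b = b' then ldist r r' else int (length r) + int (length r') + 2)"
    and "ldist [Inl i0] (join b r) = int (length r) + 1"
    and "ldist (join b r) [Inl i0] = int (length r) + 1"
proof -
  have h: "lcp r (Inl i0 # y) = 0" "lcp (Inl i0 # y) r = 0" "lcp r' (Inl i0 # y) = 0" "lcp (Inl i0 # y) r' = 0" for y
    using red_lcp[OF assms(1), of y] red_lcp[OF assms(2), of y]
      lcp_sym[of "Inl i0 # y" r] lcp_sym[of "Inl i0 # y" r'] by simp_all
  show "ldist (join b r) (join b' r') = (if b = b' then ldist r r' else int (length r) + int (length r') + 2)"
    using h by (auto simp: join_def ldist_def)
  show "ldist [Inl i0] (join b r) = int (length r) + 1" "ldist (join b r) [Inl i0] = int (length r) + 1"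
    using h by (auto simp: join_def ldist_def)
qed

lemma smul_isometry:
  assumes a: "a \<in> carrier (G v)" and xy: "x \<in> TT L" "y \<in> TT L"
  shows "ldist (smul a x) (smul a y) = ldist x y"
proof -
  have x: "red (idx L) None x" and y: "red (idx L) None y" using xy by (simp_all add: TT_def)
  show ?thesis
  proof (rule T_cases[OF x]; rule T_cases[OF y])
    fix b r b' r'
    assume *: "b \<in> carrier (G v)" "red (idx L) (Some i0) r" "x = join b r"
      "b' \<in> carrier (G v)" "red (idx L) (Some i0) r'" "y = join b' r'"
    have "a \<otimes>\<^bsub>G v\<^esub> b = a \<otimes>\<^bsub>G v\<^esub> b' \<longleftrightarrow> b = b'" using a * by simp
    then show ?thesis using * a smul_join[OF a _ *(2)] smul_join[OF a _ *(5)] ldist_join(1)[OF *(2,5)] by simp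
  next
    fix b r assume *: "b \<in> carrier (G v)" "red (idx L) (Some i0) r" "x = join b r" "y = [Inl i0]"
    then show ?thesis using smul_join[OF a _ *(2)] ldist_join(3)[OF *(2,2)] by simp
  next
    fix b r assume *: "x = [Inl i0]" "b \<in> carrier (G v)" "red (idx L) (Some i0) r" "y = join b r"
    then show ?thesis using smul_join[OF a _ *(3)] ldist_join(2)[OF *(3,3)] by simp
  qed simp
qed

lemma smul_parity:
  assumes a: "a \<in> carrier (G v)" and x: "x \<in> TT L"
  shows "even (length (smul a x)) \<longleftrightarrow> even (length x)"
proof -
  have x: "red (idx L) None x" using x by (simp add: TT_def)
  show ?thesis
  proof (rule T_cases[OF x])
    fix b r assume *: "b \<in> carrier (G v)" "red (idx L) (Some i0) r" "x = join b r"
    have "even (length (join c r)) \<longleftrightarrow> even (length r)" for c by (simp add: join_def)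
    then show ?thesis using * smul_join[OF a _ *(2)] by simp
  qed simp
qed

lemma imap_length [simp]: "length (imap h x) = length x"
  by (simp add: imap_def)

lemma imap_Nil [simp]: "imap h [] = []"
  by (simp add: imap_def)

lemma imap_Cons [simp]: "imap h (Inl i # x) = Inl (h <#\<^bsub>P\<^esub> i) # imap h x" "imap h (Inr a # x) = Inr a # imap h x"
  by (simp_all add: imap_def)

lemma coset_avoid:
  assumes h: "h \<in> carrier P" and i: "i \<subseteq> carrier P" "Some i \<noteq> j"
    and j: "\<And>k. j = Some k \<Longrightarrow> k \<subseteq> carrier P"
  shows "Some (h <#\<^bsub>P\<^esub> i) \<noteq> map_option (\<lambda>i. h <#\<^bsub>P\<^esub> i) j"
proof (cases j)
  case (Some k)
  then have "i \<noteq> k" using i(2) by blast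
  then have "h <#\<^bsub>P\<^esub> i \<noteq> h <#\<^bsub>P\<^esub> k" using coset_inj[OF h i(1) j[OF Some]] by blast
  then show ?thesis using Some by simp
qed simp

lemma red_imap:
  assumes h: "h \<in> par (L - {v})"
  shows "\<lbrakk>red (idx L) j x; \<And>i. j = Some i \<Longrightarrow> i \<subseteq> carrier P\<rbrakk>
    \<Longrightarrow> red (idx L) (map_option (\<lambda>i. h <#\<^bsub>P\<^esub> i) j) (imap h x)"
proof (induction "idx L" j x rule: red.induct)
  case (3 j i)
  have i: "i \<in> idx L" "Some i \<noteq> j" using 3(1) by auto
  show ?case
    using coset_idx[OF h i(1)] coset_avoid[OF par_carrier[OF h] idx_carrier[OF i(1)] i(2) 3(2)] by simp
next
  case (5 j i a x)
  have i: "i \<in> idx L" "Some i \<noteq> j" and r: "a \<in> carrier (G v)" "a \<noteq> \<one>\<^bsub>G v\<^esub>" "red (idx L) (Some i) x"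
    using 5(2) by auto
  have "red (idx L) (map_option (\<lambda>i. h <#\<^bsub>P\<^esub> i) (Some i)) (imap h x)"
    using 5(1)[OF r(3)] idx_carrier[OF i(1)] by blast
  then show ?case
    using coset_idx[OF h i(1)] coset_avoid[OF par_carrier[OF h] idx_carrier[OF i(1)] i(2) 5(3)] r by simp
qed auto

lemma imap_closed: "\<lbrakk>h \<in> par (L - {v}); x \<in> TT L\<rbrakk> \<Longrightarrow> imap h x \<in> TT L"
  using red_imap[of h L None x] by (simp add: TT_def)

lemma red_indices: "red S j x \<Longrightarrow> Inl i \<in> set x \<Longrightarrow> i \<in> S"
  by (induction S j x rule: red.induct) auto

lemma imap_imap:
  assumes "h \<in> carrier P" "k \<in> carrier P" "red (idx L) j x" shows "imap h (imap k x) = imap (h \<otimes>\<^bsub>P\<^esub> k) x"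
proof -
  have "map_sum (\<lambda>i. h <#\<^bsub>P\<^esub> i) (\<lambda>a. a) (map_sum (\<lambda>i. k <#\<^bsub>P\<^esub> i) (\<lambda>a. a) e) = map_sum (\<lambda>i. (h \<otimes>\<^bsub>P\<^esub> k) <#\<^bsub>P\<^esub> i) (\<lambda>a. a) e"
    if "e \<in> set x" for e
  proof (cases e)
    case (Inl i)
    then have "i \<subseteq> carrier P" using that red_indices[OF assms(3)] idx_carrier by blast
    then show ?thesis using coset_mult[OF assms(1,2)] Inl by simp
  qed simp
  then show ?thesis by (simp add: imap_def)
qed

lemma imap_one:
  assumes "red (idx L) j x" shows "imap \<one>\<^bsub>P\<^esub> x = x"
proof -
  have "map_sum (\<lambda>i. \<one>\<^bsub>P\<^esub> <#\<^bsub>P\<^esub> i) (\<lambda>a. a) e = e" if "e \<in> set x" for e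
  proof (cases e)
    case (Inl i)
    then have "i \<subseteq> carrier P" using that red_indices[OF assms] idx_carrier by blast
    then show ?thesis using coset_one Inl by simp
  qed simp
  then show ?thesis by (simp add: imap_def map_idI)
qed

lemma imap_isometry:
  assumes h: "h \<in> carrier P" and xy: "x \<in> TT L" "y \<in> TT L"
  shows "ldist (imap h x) (imap h y) = ldist x y"
  unfolding imap_def
proof (rule ldist_map, rule inj_onI)
  fix e e' assume e: "e \<in> set x \<union> set y" "e' \<in> set x \<union> set y"
    "map_sum (\<lambda>i. h <#\<^bsub>P\<^esub> i) (\<lambda>a. a) e = map_sum (\<lambda>i. h <#\<^bsub>P\<^esub> i) (\<lambda>a. a) e'"
  have "i \<subseteq> carrier P" if "Inl i \<in> set x \<union> set y" for i
  proof -
    have "i \<in> idx L" using that xy red_indices[of "idx L" None] unfolding TT_def by blast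
    then show ?thesis by (rule idx_carrier)
  qed
  note sub = this
  show "e = e'"
  proof (cases e)
    case (Inl i)
    then obtain k where k: "e' = Inl k" "h <#\<^bsub>P\<^esub> i = h <#\<^bsub>P\<^esub> k" using e(3) by (cases e') simp_all
    then have "i = k" using coset_inj[OF h sub sub k(2)] e(1,2) Inl by blast
    then show ?thesis using Inl k by simp
  next
    case (Inr a)
    then show ?thesis using e(3) by (cases e') simp_all
  qed
qed

text \<open>Elements of the link fix \<open>i0\<close>, the only index that a letter of
  \<open>G v\<close> inspects.\<close>

lemma imap_smul:
  assumes h: "h \<in> par lk" and a: "a \<in> carrier (G v)" and x: "x \<in> TT V"
  shows "smul a (imap h x) = imap h (smul a x)"
proof -
  have x: "red (idx V) None x" using x by (simp add: TT_def)
  have hi: "h <#\<^bsub>P\<^esub> i0 = i0" using coset_i0_iff h par_carrier by blast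
  have hV: "h \<in> par (V - {v})" using h par_mono[of lk "V - {v}"] irrE by blast
  have ij: "imap h (join b r) = join b (imap h r)" for b r by (simp add: join_def hi)
  show ?thesis
  proof (rule T_cases[OF x])
    fix b r assume *: "b \<in> carrier (G v)" "red (idx V) (Some i0) r" "x = join b r"
    have "red (idx V) (Some i0) (imap h r)"
      using red_imap[OF hV *(2)] i0_carrier hi by simp
    then show ?thesis using * ij smul_join[OF a *(1)] by simp
  qed (simp add: hi)
qed

end

section \<open>The action of the graph product, its stabilizers and its edge orbits\<close>

context graph_tree begin

lemma T_tree: "tree (TT L) ldist (\<lambda>x. even (length x))"
proof (rule tree_of_lists)
  show "TT L \<noteq> {}" unfolding TT_def using red.simps(1) by blast
  show "take n x \<in> TT L" if "x \<in> TT L" for x n using that red_take by (simp add: TT_def)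
qed

sublocale T: tree "TT V" ldist "\<lambda>x. even (length x)" by (rule T_tree)

lemma Nil_T [simp]: "[] \<in> TT L"
  by (simp add: TT_def)

lemma i0_T [simp]: "[Inl i0] \<in> TT L"
  by (simp add: TT_def)

lemma letter_par: "\<lbrakk>[p] \<in> W; fst p \<in> L; fst p \<noteq> v\<rbrakk> \<Longrightarrow> cls [p] \<in> par (L - {v})"
  by (rule cls_par) auto

lemma la_closed:
  assumes "[p] \<in> W" "fst p \<in> L" "x \<in> TT L" shows "la p x \<in> TT L"
proof (cases "fst p = v")
  case True
  then have "snd p \<in> carrier (G v)" using assms(1) by auto
  then show ?thesis using smul_closed assms(3) True by (simp add: la_def)
next
  case False
  then show ?thesis using imap_closed[OF letter_par[OF assms(1,2) False] assms(3)] by (simp add: la_def)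
qed

lemma actw_Cons: "actw (p # w) x = la p (actw w x)"
  by (simp add: actw_def)

lemma actw_Nil [simp]: "actw [] x = x"
  by (simp add: actw_def)

lemma actw_append: "actw (a @ b) x = actw a (actw b x)"
  by (simp add: actw_def)

lemma actw_closed: "\<lbrakk>w \<in> W; fst ` set w \<subseteq> L; x \<in> TT L\<rbrakk> \<Longrightarrow> actw w x \<in> TT L"
proof (induction w)
  case (Cons p w)
  then show ?case using la_closed[of p L "actw w x"] by (simp add: actw_Cons)
qed simp

lemma words_labels: "w \<in> W \<Longrightarrow> fst ` set w \<subseteq> V"
  by (auto simp: gp_words_def)

lemma actw_T: "\<lbrakk>w \<in> W; x \<in> TT V\<rbrakk> \<Longrightarrow> actw w x \<in> TT V"
  using actw_closed words_labels by blast

lemma la_isometry: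
  assumes "[p] \<in> W" "x \<in> TT V" "y \<in> TT V" shows "ldist (la p x) (la p y) = ldist x y"
proof (cases "fst p = v")
  case True
  then have "snd p \<in> carrier (G v)" using assms(1) by auto
  then show ?thesis using smul_isometry assms(2,3) True by (simp add: la_def)
next
  case False
  then show ?thesis using imap_isometry[OF cls_carrier[OF assms(1)] assms(2,3)] by (simp add: la_def)
qed

lemma la_parity:
  assumes "[p] \<in> W" "x \<in> TT V" shows "even (length (la p x)) \<longleftrightarrow> even (length x)"
proof (cases "fst p = v")
  case True
  then have "snd p \<in> carrier (G v)" using assms(1) by auto
  then show ?thesis using smul_parity assms(2) True by (simp add: la_def)
qed (simp add: la_def)

lemma TT_red: "x \<in> TT L \<Longrightarrow> red (idx L) None x"
  by (simp add: TT_def)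

lemma la_one: "\<lbrakk>u \<in> V; x \<in> TT V\<rbrakk> \<Longrightarrow> la (u, \<one>\<^bsub>G u\<^esub>) x = x"
proof (cases "u = v")
  case False
  assume u: "u \<in> V" "x \<in> TT V"
  have "cls [(u, \<one>\<^bsub>G u\<^esub>)] = \<one>\<^bsub>P\<^esub>" using cls_drop[of "[]" "[]" u] u by (simp add: one_P)
  then show ?thesis using imap_one[OF TT_red[OF u(2)]] False by (simp add: la_def)
qed (simp add: la_def smul_one)

lemma la_merge:
  assumes "u \<in> V" "g \<in> carrier (G u)" "h \<in> carrier (G u)" "x \<in> TT V"
  shows "la (u, g) (la (u, h) x) = la (u, g \<otimes>\<^bsub>G u\<^esub> h) x"
proof (cases "u = v")
  case True
  then show ?thesis using smul_smul[OF _ _ assms(4)] assms by (simp add: la_def)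
next
  case False
  have "cls [(u, g)] \<otimes>\<^bsub>P\<^esub> cls [(u, h)] = cls [(u, g \<otimes>\<^bsub>G u\<^esub> h)]"
    using cls_merge[of "[]" "[]" u g h] assms by (simp add: mult_cls)
  then show ?thesis
    using imap_imap[OF _ _ TT_red[OF assms(4)], of "cls [(u, g)]" "cls [(u, h)]"] False assms by (simp add: la_def)
qed

lemma la_swap:
  assumes "u \<in> V" "w \<in> V" "E u w" "g \<in> carrier (G u)" "h \<in> carrier (G w)" "x \<in> TT V"
  shows "la (u, g) (la (w, h) x) = la (w, h) (la (u, g) x)"
proof -
  have lkp: "cls [(z, k)] \<in> par lk" if "z \<in> V" "E v z" "k \<in> carrier (G z)" for z k
    by (rule cls_par) (use that in auto)
  consider "u = v" "w \<noteq> v" | "u \<noteq> v" "w = v" | "u \<noteq> v" "w \<noteq> v"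
    using assms(3) irrE by blast
  then show ?thesis
  proof cases
    case 1
    then have "E v w" using assms(3) by simp
    then show ?thesis using imap_smul[OF lkp[OF assms(2) _ assms(5)] _ assms(6), of g] 1 assms(4) by (simp add: la_def)
  next
    case 2
    then have "E v u" using assms(3) symE by simp
    then show ?thesis using imap_smul[OF lkp[OF assms(1) _ assms(4)] _ assms(6), of h] 2 assms(5) by (simp add: la_def)
  next
    case 3
    have "cls [(u, g)] \<otimes>\<^bsub>P\<^esub> cls [(w, h)] = cls [(w, h)] \<otimes>\<^bsub>P\<^esub> cls [(u, g)]"
      using cls_swap[of "[]" "[]" u w g h] assms by (simp add: mult_cls)
    then show ?thesis
      using imap_imap[OF _ _ TT_red[OF assms(6)], of "cls [(u, g)]" "cls [(w, h)]"]
        imap_imap[OF _ _ TT_red[OF assms(6)], of "cls [(w, h)]" "cls [(u, g)]"] 3 assms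
      by (simp add: la_def)
  qed
qed

lemma actw_step:
  assumes "gp_step V E G a b" "x \<in> TT V" shows "actw a x = actw b x"
  using assms(1)
proof cases
  case (drop xs u ys)
  then show ?thesis using la_one[of u] actw_T[of ys x] assms(2) by (simp add: actw_append actw_Cons)
next
  case (merge xs u g h ys)
  then show ?thesis using la_merge[of u g h] actw_T[of ys x] assms(2) by (simp add: actw_append actw_Cons)
next
  case (swap u w xs g h ys)
  then show ?thesis using la_swap[of u w g h] actw_T[of ys x] assms(2) by (simp add: actw_append actw_Cons)
qed

definition act where "act g x = actw (SOME w. w \<in> W \<and> cls w = g) x"

lemma act_cls:
  assumes "w \<in> W" "x \<in> TT V" shows "act (cls w) x = actw w x"
proof -
  let ?w = "SOME w'. w' \<in> W \<and> cls w' = cls w"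
  have "?w \<in> W \<and> cls ?w = cls w" by (rule someI[of _ w]) (simp add: assms)
  then have "eqw ?w w" using assms(1) cls_eq_iff by blast
  then have "actw ?w x = actw w x"
    by (rule eqw_invariant[of _ _ "\<lambda>w. actw w x"]) (rule actw_step[OF _ assms(2)])
  then show ?thesis by (simp add: act_def)
qed

lemma act_closed: "\<lbrakk>g \<in> carrier P; x \<in> TT V\<rbrakk> \<Longrightarrow> act g x \<in> TT V"
  using carrierE act_cls actw_T by metis

lemma act_mult:
  assumes "g \<in> carrier P" "h \<in> carrier P" "x \<in> TT V"
  shows "act (g \<otimes>\<^bsub>P\<^esub> h) x = act g (act h x)"
proof -
  obtain a b where ab: "a \<in> W" "g = cls a" "b \<in> W" "h = cls b" using assms carrierE by metis
  then show ?thesis using act_cls actw_T assms(3) by (simp add: mult_cls actw_append)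
qed

lemma act_one: "x \<in> TT V \<Longrightarrow> act \<one>\<^bsub>P\<^esub> x = x"
  using act_cls[of "[]" x] by (simp add: one_P)

lemma actw_isometry: "\<lbrakk>w \<in> W; x \<in> TT V; y \<in> TT V\<rbrakk> \<Longrightarrow> ldist (actw w x) (actw w y) = ldist x y"
proof (induction w)
  case (Cons p w)
  then show ?case using la_isometry[of p "actw w x" "actw w y"] actw_T[of w] by (simp add: actw_Cons)
qed simp

lemma actw_parity: "\<lbrakk>w \<in> W; x \<in> TT V\<rbrakk> \<Longrightarrow> even (length (actw w x)) \<longleftrightarrow> even (length x)"
proof (induction w)
  case (Cons p w)
  then show ?case using la_parity[of p "actw w x"] actw_T[of w] by (simp add: actw_Cons)
qed simp

lemma act_aut:
  assumes g: "g \<in> carrier P" shows "T.aut (act g)"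
  unfolding T.aut_def
proof (intro conjI ballI)
  obtain w where w: "w \<in> W" "g = cls w" using g carrierE by blast
  have a: "act g x = actw w x" if "x \<in> TT V" for x using act_cls[OF w(1) that] w(2) by simp
  show "ldist (act g x) (act g y) = ldist x y" if "x \<in> TT V" "y \<in> TT V" for x y
    using actw_isometry[OF w(1) that] a that by simp
  show "even (length (act g x)) = even (length x)" if "x \<in> TT V" for x
    using actw_parity[OF w(1) that] a that by simp
  show "bij_betw (act g) (TT V) (TT V)"
  proof (rule bij_betw_byWitness[of _ "act (inv\<^bsub>P\<^esub> g)"])
    show "\<forall>x\<in>TT V. act (inv\<^bsub>P\<^esub> g) (act g x) = x"
      using act_mult[of "inv\<^bsub>P\<^esub> g" g] act_one g by simp
    show "\<forall>x\<in>TT V. act g (act (inv\<^bsub>P\<^esub> g) x) = x"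
      using act_mult[of g "inv\<^bsub>P\<^esub> g"] act_one g by simp
  qed (use act_closed g in auto)
qed

lemma actw_imap:
  assumes x: "x \<in> TT V" shows "\<lbrakk>w \<in> W; v \<notin> fst ` set w\<rbrakk> \<Longrightarrow> actw w x = imap (cls w) x"
proof (induction w)
  case Nil
  show ?case using imap_one[OF TT_red[OF x]] by (simp add: one_P)
next
  case (Cons p w)
  have p: "fst p \<noteq> v" "[p] \<in> W" "w \<in> W" using Cons.prems by auto
  have "actw (p # w) x = imap (cls [p]) (imap (cls w) x)" using Cons p by (simp add: actw_Cons la_def)
  also have "\<dots> = imap (cls [p] \<otimes>\<^bsub>P\<^esub> cls w) x" using imap_imap[OF _ _ TT_red[OF x]] p(2,3) by simp
  finally show ?case using mult_cls[OF p(2,3)] by simp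
qed

lemma act_par:
  assumes "g \<in> par (V - {v})" "x \<in> TT V" shows "act g x = imap g x"
proof -
  obtain w where w: "w \<in> W" "\<forall>p\<in>set w. fst p \<in> V - {v}" "g = cls w" using assms(1) by (auto simp: par_def)
  then have "v \<notin> fst ` set w" by auto
  then show ?thesis using actw_imap[OF assms(2) w(1)] act_cls[OF w(1) assms(2)] w(3) by simp
qed

lemma letter_v: "a \<in> carrier (G v) \<Longrightarrow> [(v, a)] \<in> W"
  using vV by simp

lemma act_letter: "\<lbrakk>a \<in> carrier (G v); x \<in> TT V\<rbrakk> \<Longrightarrow> act (cls [(v, a)]) x = smul a x"
  using act_cls[OF letter_v] by (simp add: actw_Cons la_def)

text \<open>The letter \<open>a\<close> in the conjugate of \<open>G v\<close> with index
  \<open>i\<close>. The representative does not matter, because the link commutes with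
  \<open>G v\<close>.\<close>

definition bl where
  "bl i a = (SOME t. t \<in> i) \<otimes>\<^bsub>P\<^esub> cls [(v, a)] \<otimes>\<^bsub>P\<^esub> inv\<^bsub>P\<^esub> (SOME t. t \<in> i)"

text \<open>Evaluation of a normal form in the group; a final lone index counts as trivial.\<close>

fun val where
  "val (Inl i # Inr a # r) = bl i a \<otimes>\<^bsub>P\<^esub> val r"
| "val _ = \<one>\<^bsub>P\<^esub>"

lemma lk_commute:
  assumes "c \<in> par lk" "a \<in> carrier (G v)"
  shows "cls [(v, a)] \<otimes>\<^bsub>P\<^esub> c = c \<otimes>\<^bsub>P\<^esub> cls [(v, a)]"
proof -
  obtain w where w: "w \<in> W" "\<forall>p\<in>set w. fst p \<in> lk" "c = cls w" using assms(1) by (auto simp: par_def)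
  then show ?thesis
    using letter_commute[OF vV assms(2) w(1)] mult_cls[OF letter_v[OF assms(2)] w(1)]
      mult_cls[OF w(1) letter_v[OF assms(2)]] by simp
qed

lemma bl_coset:
  assumes x: "x \<in> carrier P" and a: "a \<in> carrier (G v)"
  shows "bl (x <#\<^bsub>P\<^esub> i0) a = x \<otimes>\<^bsub>P\<^esub> cls [(v, a)] \<otimes>\<^bsub>P\<^esub> inv\<^bsub>P\<^esub> x"
proof -
  let ?t = "SOME t. t \<in> x <#\<^bsub>P\<^esub> i0"
  have "x \<otimes>\<^bsub>P\<^esub> \<one>\<^bsub>P\<^esub> \<in> x <#\<^bsub>P\<^esub> i0" using par_one unfolding l_coset_def by blast
  then have "?t \<in> x <#\<^bsub>P\<^esub> i0" by (rule someI)
  then obtain c where c: "c \<in> par lk" "?t = x \<otimes>\<^bsub>P\<^esub> c" unfolding l_coset_def by blast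
  have cP: "c \<in> carrier P" using c(1) par_carrier by blast
  have aP: "cls [(v, a)] \<in> carrier P" using letter_v[OF a] by simp
  have "c \<otimes>\<^bsub>P\<^esub> cls [(v, a)] \<otimes>\<^bsub>P\<^esub> inv\<^bsub>P\<^esub> c = cls [(v, a)]"
    using lk_commute[OF c(1) a] aP cP by (metis P.inv_solve_right' P.m_closed)
  moreover have "x \<otimes>\<^bsub>P\<^esub> c \<otimes>\<^bsub>P\<^esub> cls [(v, a)] \<otimes>\<^bsub>P\<^esub> inv\<^bsub>P\<^esub> (x \<otimes>\<^bsub>P\<^esub> c)
      = x \<otimes>\<^bsub>P\<^esub> (c \<otimes>\<^bsub>P\<^esub> cls [(v, a)] \<otimes>\<^bsub>P\<^esub> inv\<^bsub>P\<^esub> c) \<otimes>\<^bsub>P\<^esub> inv\<^bsub>P\<^esub> x"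
    using x aP cP by (simp add: P.m_assoc P.inv_mult_group)
  ultimately show ?thesis unfolding bl_def c(2) by simp
qed

lemma idxE:
  assumes "i \<in> idx L" obtains x where "x \<in> par (L - {v})" "i = x <#\<^bsub>P\<^esub> i0"
  using assms by (auto simp: idx_def)

lemma bl_par:
  assumes "i \<in> idx L" "a \<in> carrier (G v)" "v \<in> L" shows "bl i a \<in> par L"
proof -
  obtain x where x: "x \<in> par (L - {v})" "i = x <#\<^bsub>P\<^esub> i0" using assms(1) by (rule idxE)
  have "x \<in> par L" using x(1) par_mono[of "L - {v}" L] by blast
  moreover have "cls [(v, a)] \<in> par L" by (rule cls_par) (use letter_v assms in auto)
  ultimately show ?thesis
    using bl_coset[OF par_carrier[OF x(1)] assms(2)] x(2) par_mult par_inv by simp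
qed

lemma val_par: "\<lbrakk>red (idx L) j x; v \<in> L\<rbrakk> \<Longrightarrow> val x \<in> par L"
proof (induction "idx L" j x rule: red.induct)
  case (5 j i a x)
  then have "i \<in> idx L" "a \<in> carrier (G v)" "val x \<in> par L" by auto
  then show ?case using par_mult[OF bl_par[OF _ _ 5(3)]] by simp
qed (auto simp: par_one)

lemma val_carrier: "red (idx V) j x \<Longrightarrow> val x \<in> carrier P"
  using val_par[of V j x] vV par_carrier by blast

lemma act_bl:
  assumes i: "i \<in> idx V" and a: "a \<in> carrier (G v)" "a \<noteq> \<one>\<^bsub>G v\<^esub>" and y: "red (idx V) (Some i) y"
  shows "act (bl i a) y = Inl i # Inr a # y"
proof -
  obtain x where x: "x \<in> par (V - {v})" "i = x <#\<^bsub>P\<^esub> i0" using i by (rule idxE)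
  have xP: "x \<in> carrier P" and ix: "inv\<^bsub>P\<^esub> x \<in> par (V - {v})" using x(1) par_carrier par_inv by blast+
  have yT: "y \<in> TT V" using red_None[OF y] by (simp add: TT_def)
  let ?y = "imap (inv\<^bsub>P\<^esub> x) y"
  have inv_i: "inv\<^bsub>P\<^esub> x <#\<^bsub>P\<^esub> i = i0"
    using x(2) coset_mult[OF P.inv_closed[OF xP] xP i0_carrier] coset_one[OF i0_carrier] xP by simp
  have ry: "red (idx V) (Some i0) ?y"
    using red_imap[OF ix y] idx_carrier[OF i] inv_i by simp
  have yy: "imap x ?y = y"
    using imap_imap[OF xP P.inv_closed[OF xP] y] imap_one[OF y] xP by simp
  have aP: "cls [(v, a)] \<in> carrier P" using letter_v[OF a(1)] by simp
  have yT2: "?y \<in> TT V" using red_None[OF ry] by (simp add: TT_def)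
  have "act (bl i a) y = act x (act (cls [(v, a)]) (act (inv\<^bsub>P\<^esub> x) y))"
    unfolding x(2) bl_coset[OF xP a(1)]
    using act_mult yT xP aP act_closed by simp
  also have "act (inv\<^bsub>P\<^esub> x) y = ?y" by (rule act_par[OF ix yT])
  also have "act (cls [(v, a)]) ?y = Inl i0 # Inr a # ?y"
    using act_letter[OF a(1) yT2] smul_join[OF a(1) Gv.one_closed ry] a by (simp add: join_def)
  also have "act x \<dots> = imap x (Inl i0 # Inr a # ?y)"
  proof (rule act_par[OF x(1)])
    show "Inl i0 # Inr a # ?y \<in> TT V" using ry a by (simp add: TT_def)
  qed
  finally show ?thesis using x(2) yy by simp
qed

lemma red_Inl_second [simp]: "\<not> red S j (e # Inl k # x)"
  by (cases e) auto

text \<open>For \<open>z = []\<close> this says that \<open>val x\<close> carries the base vertex to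
  \<open>x\<close>; other \<open>z\<close> give the neighbours of \<open>x\<close>.\<close>

lemma act_val: "\<lbrakk>red (idx V) j (x @ z); even (length x); z \<in> TT V\<rbrakk> \<Longrightarrow> act (val x) z = x @ z"
proof (induction x arbitrary: j rule: val.induct)
  case (1 i a r)
  have r: "i \<in> idx V" "a \<in> carrier (G v)" "a \<noteq> \<one>\<^bsub>G v\<^esub>" "red (idx V) (Some i) (r @ z)"
    using 1(2) by auto
  have IH: "act (val r) z = r @ z" using 1 r by simp
  have rr: "red (idx V) (Some i) r"
    using red_take[OF r(4), of "length r"] by simp
  have "act (val (Inl i # Inr a # r)) z = act (bl i a) (act (val r) z)"
    using act_mult[OF par_carrier[OF bl_par[OF r(1,2) vV]] val_carrier[OF rr] 1(4)] by simp
  then show ?case using IH act_bl[OF r] by simp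
qed (auto simp: act_one)

lemma val_imap:
  assumes h: "h \<in> par (V - {v})"
  shows "red (idx V) j x \<Longrightarrow> val (imap h x) = h \<otimes>\<^bsub>P\<^esub> val x \<otimes>\<^bsub>P\<^esub> inv\<^bsub>P\<^esub> h"
proof (induction "idx V" j x rule: red.induct)
  case (5 j i a r)
  have hP: "h \<in> carrier P" using h par_carrier by blast
  have r: "i \<in> idx V" "a \<in> carrier (G v)" "red (idx V) (Some i) r" using 5 by auto
  obtain x where x: "x \<in> par (V - {v})" "i = x <#\<^bsub>P\<^esub> i0" using r(1) by (rule idxE)
  have xP: "x \<in> carrier P" using x(1) par_carrier by blast
  have aP: "cls [(v, a)] \<in> carrier P" using letter_v[OF r(2)] by simp
  have vP: "val r \<in> carrier P" using val_carrier[OF r(3)] .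
  have "bl (h <#\<^bsub>P\<^esub> i) a = h \<otimes>\<^bsub>P\<^esub> bl i a \<otimes>\<^bsub>P\<^esub> inv\<^bsub>P\<^esub> h"
    unfolding x(2) coset_mult[OF hP xP i0_carrier] bl_coset[OF P.m_closed[OF hP xP] r(2)] bl_coset[OF xP r(2)]
    using hP xP aP by (simp add: P.m_assoc P.inv_mult_group)
  moreover have "bl i a \<in> carrier P" using par_carrier[OF bl_par[OF r(1,2) vV]] .
  moreover have "inv\<^bsub>P\<^esub> h \<otimes>\<^bsub>P\<^esub> (h \<otimes>\<^bsub>P\<^esub> z) = z" if "z \<in> carrier P" for z
    using that hP by (simp add: P.m_assoc[symmetric])
  ultimately show ?case using 5(1)[OF r(3)] hP vP by (simp add: P.m_assoc)
qed (use par_carrier[OF h] in auto)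

lemma val_join:
  assumes "red (idx V) (Some i0) r" "b \<in> carrier (G v)"
  shows "val (join b r) = cls [(v, b)] \<otimes>\<^bsub>P\<^esub> val r"
proof (cases "b = \<one>\<^bsub>G v\<^esub>")
  case True
  then have "cls [(v, b)] = \<one>\<^bsub>P\<^esub>" using cls_drop[of "[]" "[]" v] vV by (simp add: one_P)
  then show ?thesis using True val_carrier[OF assms(1)] by (simp add: join_def)
next
  case False
  have "bl i0 b = cls [(v, b)]"
    using bl_coset[OF P.one_closed assms(2)] coset_one[OF i0_carrier] cls_carrier[OF letter_v[OF assms(2)]] by simp
  then show ?thesis using False by (simp add: join_def)
qed

text \<open>Decomposition of an element with respect to the semidirect product with kernel factor \<open>val\<close>.\<close>

lemma word_val: "w \<in> W \<Longrightarrow> cls w = val (actw w []) \<otimes>\<^bsub>P\<^esub> rho (V - {v}) (cls w)"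
proof (induction w)
  case Nil
  show ?case by (simp add: one_P[symmetric] P.l_one) (simp add: one_P)
next
  case (Cons p w)
  have p: "[p] \<in> W" "w \<in> W" using Cons.prems by auto
  let ?x = "actw w []" and ?R = "rho (V - {v})"
  have xT: "?x \<in> TT V" using actw_T[OF p(2)] by simp
  have xr: "red (idx V) None ?x" using TT_red[OF xT] .
  have xe: "even (length ?x)" using actw_parity[OF p(2)] by simp
  have vP: "val ?x \<in> carrier P" "?R (cls w) \<in> carrier P" "cls w \<in> carrier P" "cls [p] \<in> carrier P"
    using val_carrier[OF xr] p by simp_all
  have e: "cls (p # w) = cls [p] \<otimes>\<^bsub>P\<^esub> cls w" using mult_cls[OF p] by simp
  have IH: "cls w = val ?x \<otimes>\<^bsub>P\<^esub> ?R (cls w)" using Cons.IH p(2) by blast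
  have re: "?R (cls (p # w)) = ?R (cls [p]) \<otimes>\<^bsub>P\<^esub> ?R (cls w)" unfolding e by (rule rho_mult[OF vP(4,3)])
  show ?case
  proof (cases "fst p = v")
    case True
    then obtain a where a: "p = (v, a)" "a \<in> carrier (G v)" using p(1) by (cases p) auto
    have "?R (cls [p]) = \<one>\<^bsub>P\<^esub>" using p(1) a by (simp add: ret_Cons one_P)
    then have re: "?R (cls (p # w)) = ?R (cls w)" using re vP by simp
    have "val (smul a ?x) = cls [p] \<otimes>\<^bsub>P\<^esub> val ?x"
    proof (rule T_cases[OF xr])
      assume "?x = [Inl i0]"
      then show ?thesis using xe by simp
    next
      fix b r assume *: "b \<in> carrier (G v)" "red (idx V) (Some i0) r" "?x = join b r"
      have "val (smul a ?x) = cls [(v, a \<otimes>\<^bsub>G v\<^esub> b)] \<otimes>\<^bsub>P\<^esub> val r"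
        using smul_join[OF a(2) *(1,2)] val_join[OF *(2), of "a \<otimes>\<^bsub>G v\<^esub> b"] a(2) *(1,3) by simp
      also have "cls [(v, a \<otimes>\<^bsub>G v\<^esub> b)] = cls [(v, a)] \<otimes>\<^bsub>P\<^esub> cls [(v, b)]"
        using cls_merge[of "[]" "[]" v a b] vV a(2) *(1) by (simp add: mult_cls)
      finally show ?thesis
        using val_join[OF *(2,1)] *(3) a val_carrier[OF *(2)] cls_carrier[OF letter_v] *(1)
        by (simp add: P.m_assoc)
    qed
    then have "val (actw (p # w) []) = cls [p] \<otimes>\<^bsub>P\<^esub> val ?x" using a(1) by (simp add: actw_Cons la_def)
    then show ?thesis unfolding re using e IH vP by (metis P.m_assoc)
  next
    case False
    have h: "cls [p] \<in> par (V - {v})" using letter_par[OF p(1) _ False, of V] p(1) by simp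
    have Rp: "?R (cls [p]) = cls [p]" using par_iff_rho[OF vP(4)] h by blast
    have "val (actw (p # w) []) = cls [p] \<otimes>\<^bsub>P\<^esub> val ?x \<otimes>\<^bsub>P\<^esub> inv\<^bsub>P\<^esub> (cls [p])"
      using val_imap[OF h xr] False by (simp add: actw_Cons la_def)
    moreover have "cls [p] \<otimes>\<^bsub>P\<^esub> val ?x \<otimes>\<^bsub>P\<^esub> inv\<^bsub>P\<^esub> (cls [p]) \<otimes>\<^bsub>P\<^esub> (cls [p] \<otimes>\<^bsub>P\<^esub> ?R (cls w))
      = cls [p] \<otimes>\<^bsub>P\<^esub> (val ?x \<otimes>\<^bsub>P\<^esub> ?R (cls w))"
    proof -
      have "inv\<^bsub>P\<^esub> (cls [p]) \<otimes>\<^bsub>P\<^esub> (cls [p] \<otimes>\<^bsub>P\<^esub> ?R (cls w)) = ?R (cls w)"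
        using vP by (simp add: P.m_assoc[symmetric])
      then show ?thesis using vP by (simp add: P.m_assoc)
    qed
    ultimately show ?thesis using re Rp e IH by metis
  qed
qed

lemma val_decomp:
  assumes "g \<in> carrier P" shows "g = val (act g []) \<otimes>\<^bsub>P\<^esub> rho (V - {v}) g"
proof -
  obtain w where w: "w \<in> W" "g = cls w" using assms carrierE by blast
  have "act g [] = actw w []" using act_cls[OF w(1) Nil_T] w(2) by blast
  then show ?thesis using word_val[OF w(1)] w(2) by metis
qed

text \<open>If the base vertex is fixed, the kernel factor in \<open>val_decomp\<close> is trivial
  and the element equals its own retraction.\<close>

lemma stab_Nil:
  assumes "g \<in> carrier P" "act g [] = []" shows "g \<in> par (V - {v})"
proof -
  have "g = \<one>\<^bsub>P\<^esub> \<otimes>\<^bsub>P\<^esub> rho (V - {v}) g"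
    using val_decomp[OF assms(1), unfolded assms(2) val.simps] .
  then have "g = rho (V - {v}) g" using assms(1) by (metis P.l_one rho_closed)
  then show ?thesis using rho_par[OF assms(1), of "V - {v}"] by metis
qed

lemma par_fixes_Nil: "g \<in> par (V - {v}) \<Longrightarrow> act g [] = []"
  using act_par[of g "[]"] by simp

lemma par_act_i0: "g \<in> par (V - {v}) \<Longrightarrow> act g [Inl i0] = [Inl (g <#\<^bsub>P\<^esub> i0)]"
  using act_par[of g "[Inl i0]"] by simp

lemma stab_edge:
  assumes "g \<in> carrier P" "act g [] = []" "act g [Inl i0] = [Inl i0]" shows "g \<in> par lk"
  using par_act_i0[OF stab_Nil[OF assms(1,2)]] assms coset_i0_iff[OF assms(1)] by simp

lemma lk_sub: "par lk \<subseteq> par (V - {v})"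
  using irrE by (intro par_mono) auto

lemma par_labels: "x \<in> par L \<Longrightarrow> x \<in> par (L \<inter> V)"
  using words_labels unfolding par_def by blast

lemma lk_fixes:
  assumes "c \<in> par lk" shows "act c [] = []" "act c [Inl i0] = [Inl i0]"
proof -
  have c: "c \<in> par (V - {v})" using assms lk_sub by blast
  show "act c [] = []" using par_fixes_Nil[OF c] .
  show "act c [Inl i0] = [Inl i0]"
    using par_act_i0[OF c] coset_i0_iff[OF par_carrier[OF c]] assms by simp
qed

lemma star_fixes:
  assumes "x \<in> par (insert v lk)" shows "act x [Inl i0] = [Inl i0]"
proof -
  obtain w where w: "w \<in> W" "\<forall>p\<in>set w. fst p \<in> insert v lk" "x = cls w" using assms by (auto simp: par_def)
  have "actw w [Inl i0] = [Inl i0]" using w(1,2)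
  proof (induction w)
    case (Cons p w)
    have "la p [Inl i0] = [Inl i0]"
    proof (cases "fst p = v")
      case False
      then have "cls [p] \<in> par lk" by (intro cls_par) (use Cons.prems in auto)
      then have "cls [p] <#\<^bsub>P\<^esub> i0 = i0" using coset_i0_iff[OF par_carrier] by blast
      then show ?thesis using False by (simp add: la_def)
    qed (simp add: la_def)
    then show ?case using Cons by (simp add: actw_Cons)
  qed simp
  then show ?thesis using act_cls[OF w(1)] w(3) by simp
qed

text \<open>The image of the base vertex is again a neighbour of \<open>[Inl i0]\<close>, hence
  \<open>join b []\<close> for a letter \<open>b\<close>. Removing this letter leaves an element
  that fixes the base edge.\<close>

lemma stab_star:
  assumes g: "g \<in> carrier P" "act g [Inl i0] = [Inl i0]"
  obtains s c where "s \<in> carrier (G v)" "c \<in> par lk" "g = cls [(v, s)] \<otimes>\<^bsub>P\<^esub> c"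
proof -
  let ?x = "act g []"
  have x: "?x \<in> TT V" using act_closed[OF g(1)] by simp
  have d1: "ldist [Inl i0] ?x = 1"
    using T.aut_d[OF act_aut[OF g(1)], of "[Inl i0]" "[]"] g(2) by (simp add: ldist_def)
  obtain b where b: "b \<in> carrier (G v)" "?x = join b []"
  proof (rule T_cases[OF TT_red[OF x]])
    assume "?x = [Inl i0]"
    then show ?thesis using d1 by simp
  next
    fix b r assume *: "b \<in> carrier (G v)" "red (idx V) (Some i0) r" "?x = join b r"
    then have "r = []" using ldist_join(2)[OF *(2,2), of b] d1 by simp
    then show ?thesis using that * by blast
  qed
  have ib: "inv\<^bsub>G v\<^esub> b \<in> carrier (G v)" using b(1) by simp
  have B: "cls [(v, inv\<^bsub>G v\<^esub> b)] \<in> carrier P" "cls [(v, b)] \<in> carrier P"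
    using letter_v ib b(1) by simp_all
  define c where "c = cls [(v, inv\<^bsub>G v\<^esub> b)] \<otimes>\<^bsub>P\<^esub> g"
  have cP: "c \<in> carrier P" using B g(1) by (simp add: c_def)
  have "act c [] = smul (inv\<^bsub>G v\<^esub> b) (join b [])"
    using act_mult[OF B(1) g(1) Nil_T] act_letter[OF ib x] b(2) by (simp add: c_def)
  also have "\<dots> = []" using smul_join[OF ib b(1), of "idx V" "[]"] b(1) by (simp add: join_def)
  finally have c1: "act c [] = []" .
  have c2: "act c [Inl i0] = [Inl i0]"
    using act_mult[OF B(1) g(1) i0_T] act_letter[OF ib i0_T] g(2) by (simp add: c_def)
  have "cls [(v, b)] \<otimes>\<^bsub>P\<^esub> cls [(v, inv\<^bsub>G v\<^esub> b)] = \<one>\<^bsub>P\<^esub>"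
    using cls_merge[of "[]" "[]" v b "inv\<^bsub>G v\<^esub> b"] cls_drop[of "[]" "[]" v] b(1) ib vV
    by (simp add: mult_cls one_P)
  then have "cls [(v, b)] \<otimes>\<^bsub>P\<^esub> c = g" using B g(1) by (simp add: c_def P.m_assoc[symmetric])
  then show ?thesis using that[OF b(1) stab_edge[OF cP c1 c2]] by simp
qed

lemma idx_mono: "L \<subseteq> M \<Longrightarrow> idx L \<subseteq> idx M"
  using par_mono[of "L - {v}" "M - {v}"] by (auto simp: idx_def)

lemma red_mono: "red S j x \<Longrightarrow> S \<subseteq> S' \<Longrightarrow> red S' j x"
  by (induction S j x rule: red.induct) auto

lemma red_snoc_even: "\<lbrakk>red S j (x @ [e]); even (length x)\<rbrakk> \<Longrightarrow> \<exists>i\<in>S. e = Inl i"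
proof (induction x arbitrary: j rule: induct_list012)
  case 1
  then show ?case by (cases e) auto
next
  case (3 a b x)
  obtain i where a: "a = Inl i" using 3(3) by (cases a) auto
  obtain c where b: "b = Inr c" using 3(3) a by (cases b) auto
  show ?case using 3(1)[of "Some i"] 3(3,4) a b by simp
qed simp

lemma red_snoc_odd: "\<lbrakk>red S j (x @ [e]); odd (length x)\<rbrakk> \<Longrightarrow>
    \<exists>i a y. i \<in> S \<and> a \<in> carrier (G v) \<and> a \<noteq> \<one>\<^bsub>G v\<^esub> \<and> e = Inr a \<and> x = y @ [Inl i]"
proof (induction x arbitrary: j rule: induct_list012)
  case (2 a)
  obtain i where a: "a = Inl i" using 2(1) by (cases a) auto
  obtain c where b: "e = Inr c" using 2(1) a by (cases e) auto
  show ?case using 2 a b by auto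
next
  case (3 a b x)
  obtain i where a: "a = Inl i" using 3(3) by (cases a) auto
  obtain c where b: "b = Inr c" using 3(3) a by (cases b) auto
  have "red S (Some i) (x @ [e])" "odd (length x)" using 3(3,4) a b by simp_all
  then obtain i' a' y where "i' \<in> S" "a' \<in> carrier (G v)" "a' \<noteq> \<one>\<^bsub>G v\<^esub>" "e = Inr a'" "x = y @ [Inl i']"
    using 3(1) by blast
  then show ?case by (intro exI[of _ i'] exI[of _ a'] exI[of _ "a # b # y"]) simp
qed simp

text \<open>Edges at an even vertex are reached by \<open>val x\<close> after an element that moves
  the index; edges below an odd vertex need one more letter of \<open>G v\<close>. For an edge in
  the subtree of \<open>L\<close> the translating element can be taken in \<open>par L\<close>,
  which keeps the induction for square roots inside \<open>L\<close>.\<close>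

lemma edge_orbit:
  assumes r: "red (idx L) None (x @ [e])" and L: "L \<subseteq> V" "v \<in> L"
  shows "even (length x) \<Longrightarrow> \<exists>t\<in>par L. act t [] = x \<and> act t [Inl i0] = x @ [e]"
    and "odd (length x) \<Longrightarrow> \<exists>t\<in>par L. act t [Inl i0] = x \<and> act t [] = x @ [e]"
proof -
  have rV: "red (idx V) None (x @ [e])" using red_mono[OF r idx_mono[OF L(1)]] .
  have y: "\<exists>y\<in>par L. act y [] = [] \<and> act y [Inl i0] = [Inl i]" if i: "i \<in> idx L" for i
  proof -
    obtain y where y: "y \<in> par (L - {v})" "i = y <#\<^bsub>P\<^esub> i0" using i by (rule idxE)
    have "y \<in> par (V - {v})" using y(1) par_mono[of "L - {v}" "V - {v}"] L by blast
    then show ?thesis using par_fixes_Nil par_act_i0 y par_mono[of "L - {v}" L] by blast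
  qed
  show "\<exists>t\<in>par L. act t [] = x \<and> act t [Inl i0] = x @ [e]" if ev: "even (length x)"
  proof -
    obtain i where i: "i \<in> idx L" "e = Inl i" using red_snoc_even[OF r ev] by blast
    obtain y where y: "y \<in> par L" "act y [] = []" "act y [Inl i0] = [Inl i]" using y[OF i(1)] by blast
    have rx: "red (idx L) None x" "red (idx V) None x"
      using red_take[OF r, of "length x"] red_take[OF rV, of "length x"] by simp_all
    have vx: "val x \<in> par L" using val_par[OF rx(1) L(2)] .
    have iT: "[Inl i] \<in> TT V" using i(1) idx_mono[OF L(1)] by (auto simp: TT_def)
    have a: "act (val x) [] = x" "act (val x) [Inl i] = x @ [e]"
      using act_val[of None x "[]"] act_val[of None x "[Inl i]"] rx rV ev i(2) iT by simp_all
    show ?thesis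
      using a y act_mult[OF par_carrier[OF vx] par_carrier[OF y(1)]] par_mult[OF vx y(1)]
      by (intro bexI[of _ "val x \<otimes>\<^bsub>P\<^esub> y"]) simp_all
  qed
  show "\<exists>t\<in>par L. act t [Inl i0] = x \<and> act t [] = x @ [e]" if od: "odd (length x)"
  proof -
    obtain i a z where i: "i \<in> idx L" "a \<in> carrier (G v)" "a \<noteq> \<one>\<^bsub>G v\<^esub>" "e = Inr a" "x = z @ [Inl i]"
      using red_snoc_odd[OF r od] by blast
    obtain y where y: "y \<in> par L" "act y [] = []" "act y [Inl i0] = [Inl i]" using y[OF i(1)] by blast
    have yi: "y \<in> par (V - {v})" using stab_Nil[OF par_carrier[OF y(1)] y(2)] .
    have ev: "even (length z)" using od i(5) by simp
    have rz: "red (idx L) None z"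
      using red_take[OF r, of "length z"] i(5) by simp
    have vz: "val z \<in> par L" using val_par[OF rz L(2)] .
    have iV: "i \<in> idx V" using i(1) idx_mono[OF L(1)] by blast
    have iT: "[Inl i] \<in> TT V" "[Inl i, Inr a] \<in> TT V" "[Inl i0, Inr a] \<in> TT V"
      using iV i(2,3) by (simp_all add: TT_def)
    have A: "cls [(v, a)] \<in> par L" by (rule cls_par) (use letter_v[OF i(2)] L in auto)
    have "red (idx V) None (z @ [Inl i])" using red_take[OF rV, of "length x"] i(5) by simp
    then have a: "act (val z) [Inl i] = x" "act (val z) [Inl i, Inr a] = x @ [e]"
      using act_val[of None z "[Inl i]"] act_val[of None z "[Inl i, Inr a]"] rV ev i(4,5) iT by simp_all
    have ya: "act y [Inl i0, Inr a] = [Inl i, Inr a]"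
      using act_par[OF yi iT(3)] act_par[OF yi i0_T] y(3) by simp
    have b: "act (cls [(v, a)]) [Inl i0] = [Inl i0]" "act (cls [(v, a)]) [] = [Inl i0, Inr a]"
      using act_letter[OF i(2)] i(3) by (simp_all add: join_def)
    have c: "act (val z \<otimes>\<^bsub>P\<^esub> y \<otimes>\<^bsub>P\<^esub> cls [(v, a)]) q = act (val z) (act y (act (cls [(v, a)]) q))" if "q \<in> TT V" for q
      using act_mult par_carrier[OF vz] par_carrier[OF y(1)] par_carrier[OF A] act_closed that by simp
    show ?thesis
      using c[of "[]"] c[of "[Inl i0]"] a ya b y par_mult[OF par_mult[OF vz y(1)] A]
      by (intro bexI[of _ "val z \<otimes>\<^bsub>P\<^esub> y \<otimes>\<^bsub>P\<^esub> cls [(v, a)]"]) simp_all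
  qed
qed

lemma act_conj_fix:
  assumes "z \<in> carrier P" "t \<in> carrier P" "x \<in> TT V" "act z (act t x) = act t x"
  shows "act (inv\<^bsub>P\<^esub> t \<otimes>\<^bsub>P\<^esub> z \<otimes>\<^bsub>P\<^esub> t) x = x"
proof -
  have "act (inv\<^bsub>P\<^esub> t \<otimes>\<^bsub>P\<^esub> z \<otimes>\<^bsub>P\<^esub> t) x = act (inv\<^bsub>P\<^esub> t) (act z (act t x))"
    using act_mult act_closed assms by simp
  also have "\<dots> = act (inv\<^bsub>P\<^esub> t \<otimes>\<^bsub>P\<^esub> t) x"
    using act_mult[of "inv\<^bsub>P\<^esub> t" t x] assms by simp
  finally show ?thesis using assms act_one by simp
qed

lemma fixes_edge_conj:
  assumes z: "z \<in> carrier P" and f: "T.fixes_edge (act z)"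
  obtains t where "t \<in> carrier P" "inv\<^bsub>P\<^esub> t \<otimes>\<^bsub>P\<^esub> z \<otimes>\<^bsub>P\<^esub> t \<in> par lk"
proof -
  obtain x y where xy: "x \<in> TT V" "y \<in> TT V" "ldist x y = 1" "act z x = x" "act z y = y"
    using f unfolding T.fixes_edge_def by blast
  obtain p e where pe: "p @ [e] \<in> TT V" "act z p = p" "act z (p @ [e]) = p @ [e]"
    using ldist_one[OF xy(3)] xy by blast
  have "\<exists>t\<in>par V. act z (act t []) = act t [] \<and> act z (act t [Inl i0]) = act t [Inl i0]"
  proof (cases "even (length p)")
    case True
    then obtain t where t: "t \<in> par V" "act t [] = p" "act t [Inl i0] = p @ [e]"
      using edge_orbit(1)[OF TT_red[OF pe(1)] subset_refl vV] by blast
    then show ?thesis using pe(2,3) by (intro bexI[OF _ t(1)]) simp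
  next
    case False
    then obtain t where t: "t \<in> par V" "act t [Inl i0] = p" "act t [] = p @ [e]"
      using edge_orbit(2)[OF TT_red[OF pe(1)] subset_refl vV] by blast
    then show ?thesis using pe(2,3) by (intro bexI[OF _ t(1)]) simp
  qed
  then obtain t where t: "t \<in> par V" "act z (act t []) = act t []" "act z (act t [Inl i0]) = act t [Inl i0]"
    by blast
  have tP: "t \<in> carrier P" using t(1) par_carrier by blast
  have "inv\<^bsub>P\<^esub> t \<otimes>\<^bsub>P\<^esub> z \<otimes>\<^bsub>P\<^esub> t \<in> par lk"
    using stab_edge act_conj_fix[OF z tP Nil_T t(2)] act_conj_fix[OF z tP i0_T t(3)] z tP by simp
  then show ?thesis using that tP by blast
qed

definition blocks where
  "blocks bs = concat (map (\<lambda>(s, B). (v, s) # B) bs)"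

text \<open>\<open>B\<close> has to leave the link, for otherwise the letters of \<open>G v\<close>
  on its two sides could be merged across it.\<close>

definition good_block where
  "good_block q \<longleftrightarrow> (case q of (s, B) \<Rightarrow> s \<in> carrier (G v) \<and> s \<noteq> \<one>\<^bsub>G v\<^esub> \<and> B \<in> W \<and> v \<notin> fst ` set B \<and> cls B \<notin> par lk)"

lemma blocks_words: "(\<And>q. q \<in> set bs \<Longrightarrow> good_block q) \<Longrightarrow> blocks bs \<in> W"
proof (induction bs)
  case (Cons q bs)
  obtain s B where q: "q = (s, B)" by force
  have "good_block (s, B)" "blocks bs \<in> W" using Cons q by auto
  then show ?case using letter_v by (simp add: q blocks_def good_block_def vV)
qed (simp add: blocks_def)

text \<open>The leading index is the invariant: \<open>B\<close> moves \<open>i0\<close> to a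
  different index, so the next letter of \<open>G v\<close> is put in front without merging and each
  block adds two entries.\<close>

lemma blocks_act:
  "(\<And>q. q \<in> set bs \<Longrightarrow> good_block q) \<Longrightarrow>
    \<exists>x. actw (blocks bs) [] = x \<and> length x = 2 * length bs \<and> (bs \<noteq> [] \<longrightarrow> hd x = Inl i0)"
proof (induction bs)
  case (Cons q bs)
  obtain s B where q: "q = (s, B)" by force
  have B: "s \<in> carrier (G v)" "s \<noteq> \<one>\<^bsub>G v\<^esub>" "B \<in> W" "v \<notin> fst ` set B" "cls B \<notin> par lk"
    using Cons.prems[of q] by (simp_all add: q good_block_def)
  let ?x = "actw (blocks bs) []"
  have bw: "blocks bs \<in> W" by (rule blocks_words) (use Cons.prems in auto)
  have x: "length ?x = 2 * length bs" "bs \<noteq> [] \<Longrightarrow> hd ?x = Inl i0" using Cons by auto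
  have xT: "?x \<in> TT V" using actw_T[OF bw] by simp
  have e: "actw (blocks (q # bs)) [] = smul s (imap (cls B) ?x)"
    using actw_imap[OF xT B(3,4)] by (simp add: blocks_def q actw_Cons actw_append la_def)
  show ?case
  proof (cases bs)
    case Nil
    then show ?thesis using e B by (simp add: blocks_def join_def)
  next
    case (Cons q' bs')
    obtain y where y: "?x = Inl i0 # y" "y \<noteq> []"
    proof (cases ?x)
      case Nil
      then show ?thesis using x(1) Cons by simp
    next
      case c: (Cons e y)
      then show ?thesis using that[of y] x Cons by (cases y) simp_all
    qed
    obtain b r where br: "y = Inr b # r" using TT_red[OF xT] y by (cases y; cases "hd y") auto
    have "cls B <#\<^bsub>P\<^esub> i0 \<noteq> i0" using coset_i0_iff[of "cls B"] B by simp
    then have "smul s (imap (cls B) ?x) = Inl i0 # Inr s # imap (cls B) ?x"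
      using B y br by (simp add: join_def)
    then show ?thesis using e x by simp
  qed
qed (simp add: blocks_def)

text \<open>\<open>bs @ bs\<close> consists of good blocks too, so the square moves the base vertex
  twice as far, against \<open>ell_d_le\<close>.\<close>

lemma blocks_not_ell:
  assumes "bs \<noteq> []" "\<And>q. q \<in> set bs \<Longrightarrow> good_block q" shows "\<not> T.ell (act (cls (blocks bs)))"
proof
  assume a: "T.ell (act (cls (blocks bs)))"
  have w: "blocks bs \<in> W" using blocks_words assms(2) by blast
  let ?f = "act (cls (blocks bs))"
  have 1: "?f [] = actw (blocks bs) []" using act_cls[OF w] by simp
  have 2: "?f (?f []) = actw (blocks (bs @ bs)) []"
  proof -
    have "blocks (bs @ bs) = blocks bs @ blocks bs" by (simp add: blocks_def)
    then show ?thesis using act_cls[OF w actw_T[OF w Nil_T]] 1 actw_append by metis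
  qed
  have l: "length (?f []) = 2 * length bs" using blocks_act[of bs] assms(2) 1 by auto
  have l2: "length (?f (?f [])) = 2 * length (bs @ bs)" using blocks_act[of "bs @ bs"] assms(2) 2 by auto
  have "ldist [] (?f (?f [])) \<le> ldist [] (?f [])"
    by (rule T.ell_d_le[OF act_aut a]) (use w in auto)
  then show False using l l2 assms(1) by (simp add: ldist_def)
qed

end

section \<open>Actions on a family of trees\<close>

context tree begin

lemma ell_cong: "(\<And>x. x \<in> T \<Longrightarrow> f x = g x) \<Longrightarrow> ell f \<longleftrightarrow> ell g"
  by (simp add: ell_def)

lemma fixes_edge_cong: "(\<And>x. x \<in> T \<Longrightarrow> f x = g x) \<Longrightarrow> fixes_edge f \<longleftrightarrow> fixes_edge g"
  by (simp add: fixes_edge_def)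

end

text \<open>\<open>transfer\<close> is the only relation between different trees that the
  combination argument uses; everything else happens in one tree at a time.\<close>

locale tree_family = group P for P :: "('g, 'm) monoid_scheme" (structure) +
  fixes V :: "'v set" and E :: "'v \<Rightarrow> 'v \<Rightarrow> bool" and T :: "'v \<Rightarrow> 'p set"
    and d :: "'v \<Rightarrow> 'p \<Rightarrow> 'p \<Rightarrow> int" and col :: "'v \<Rightarrow> 'p \<Rightarrow> bool"
    and act :: "'v \<Rightarrow> 'g \<Rightarrow> 'p \<Rightarrow> 'p"
  assumes tree: "v \<in> V \<Longrightarrow> tree (T v) (d v) (col v)"
    and act_aut: "\<lbrakk>v \<in> V; x \<in> carrier P\<rbrakk> \<Longrightarrow> tree.aut (T v) (d v) (col v) (act v x)"
    and act_mult: "\<lbrakk>v \<in> V; x \<in> carrier P; y \<in> carrier P; p \<in> T v\<rbrakk> \<Longrightarrow> act v (x \<otimes> y) p = act v x (act v y p)"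
    and transfer: "\<lbrakk>u \<in> V; v \<in> V; u \<noteq> v; \<not> E v u; z \<in> carrier P; tree.fixes_edge (T v) (d v) (act v z)\<rbrakk>
      \<Longrightarrow> tree.ell (T u) (act u z)"
    and symE: "E u w \<Longrightarrow> E w u"
    and finite_V: "finite V"
begin

definition el :: "'v \<Rightarrow> 'g \<Rightarrow> bool" where "el v x = tree.ell (T v) (act v x)"
definition fe :: "'v \<Rightarrow> 'g \<Rightarrow> bool" where "fe v x = tree.fixes_edge (T v) (d v) (act v x)"

lemma act_T: "\<lbrakk>v \<in> V; x \<in> carrier P; p \<in> T v\<rbrakk> \<Longrightarrow> act v x p \<in> T v"
  using tree.aut_mem[OF tree act_aut] .

lemma act_one:
  assumes "v \<in> V" "p \<in> T v" shows "act v \<one> p = p"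
proof -
  have "act v \<one> (act v \<one> p) = act v \<one> p" using act_mult[OF assms(1) one_closed one_closed assms(2)] by simp
  then show ?thesis
    using tree.aut_inj[OF tree[OF assms(1)] act_aut[OF assms(1) one_closed]] act_T assms one_closed by blast
qed

lemma act_pow:
  assumes "v \<in> V" "x \<in> carrier P" "p \<in> T v" shows "act v (x [^] (n::nat)) p = (act v x ^^ n) p"
proof (induction n)
  case (Suc n)
  have "act v (x [^] Suc n) p = act v x (act v (x [^] n) p)"
    unfolding nat_pow_Suc2[OF assms(2)]
    using act_mult[OF assms(1,2) nat_pow_closed[OF assms(2)] assms(3)] .
  then show ?case using Suc by simp
qed (simp add: act_one assms)

lemma act_word:
  assumes "v \<in> V" "f \<in> carrier P" "g \<in> carrier P" "p \<in> T v"
  shows "act v (f [^] (b::nat) \<otimes> g [^] (a::nat)) p = (act v f ^^ b \<circ> act v g ^^ a) p"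
  using act_mult[OF assms(1) nat_pow_closed[OF assms(2)] nat_pow_closed[OF assms(3)] assms(4)]
    act_pow[OF assms(1,2) act_T[OF assms(1) nat_pow_closed[OF assms(3)] assms(4)]]
    act_pow[OF assms(1,3,4)] by simp

lemma el_word:
  assumes "v \<in> V" "f \<in> carrier P" "g \<in> carrier P"
  shows "el v (f [^] (b::nat) \<otimes> g [^] (a::nat)) \<longleftrightarrow> tree.ell (T v) (act v f ^^ b \<circ> act v g ^^ a)"
  unfolding el_def by (rule tree.ell_cong[OF tree[OF assms(1)]]) (rule act_word[OF assms])

lemma fe_word:
  assumes "v \<in> V" "f \<in> carrier P" "g \<in> carrier P"
  shows "fe v (f [^] (b::nat) \<otimes> g [^] (a::nat)) \<longleftrightarrow> tree.fixes_edge (T v) (d v) (act v f ^^ b \<circ> act v g ^^ a)"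
  unfolding fe_def by (rule tree.fixes_edge_cong[OF tree[OF assms(1)]]) (rule act_word[OF assms])

lemma el_mult_self:
  assumes "v \<in> V" "x \<in> carrier P" shows "el v (x \<otimes> x) \<longleftrightarrow> el v x"
proof -
  interpret Tv: tree "T v" "d v" "col v" by (rule tree[OF assms(1)])
  have "el v (x \<otimes> x) \<longleftrightarrow> Tv.ell (act v x ^^ 2)"
    unfolding el_def
    by (rule Tv.ell_cong) (simp add: act_mult[OF assms(1,2,2)] numeral_2_eq_2)
  then show ?thesis
    unfolding el_def using Tv.ell_funpow Tv.funpow_ell[OF act_aut[OF assms], of 2] by auto
qed

lemma el_swap:
  assumes "v \<in> V" "x \<in> carrier P" "y \<in> carrier P" "el v (x \<otimes> y)" shows "el v (y \<otimes> x)"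
proof -
  interpret Tv: tree "T v" "d v" "col v" by (rule tree[OF assms(1)])
  have "Tv.ell (act v x \<circ> act v y)"
    using assms(4) Tv.ell_cong[of "act v (x \<otimes> y)" "act v x \<circ> act v y"] act_mult[OF assms(1-3)]
    unfolding el_def by simp
  then have "Tv.ell (act v y \<circ> act v x)"
    using Tv.ell_swap[OF act_aut[OF assms(1,3)] act_aut[OF assms(1,2)]] by blast
  then show ?thesis
    using Tv.ell_cong[of "act v (y \<otimes> x)" "act v y \<circ> act v x"] act_mult[OF assms(1,3,2)]
    unfolding el_def by simp
qed

lemma fe_transfer:
  assumes "u \<in> V" "v \<in> V" "u = v \<or> \<not> E v u" "z \<in> carrier P" "fe v z" shows "el u z"
proof (cases "u = v")
  case True
  then show ?thesis using tree.fixes_edge_ell[OF tree[OF assms(2)]] assms(5) by (simp add: el_def fe_def)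
next
  case False
  then show ?thesis using transfer[OF assms(1,2) False _ assms(4)] assms(3,5) by (simp add: el_def fe_def)
qed

text \<open>The gap \<open>4\<close> makes the reflected stretch long enough for
  \<open>flip_fixes_edge\<close> at the exponents \<open>k + 1\<close> and \<open>k + 3\<close>. The
  value \<open>k = 0\<close> covers elliptic \<open>g\<close>.\<close>

definition strong_flip :: "'g \<Rightarrow> 'g \<Rightarrow> 'v \<Rightarrow> nat \<Rightarrow> bool" where
  "strong_flip f g v n \<longleftrightarrow> \<not> el v f \<and>
     (\<exists>(k::nat) (m::nat). 4 \<le> m \<and> el v (f [^] k \<otimes> g [^] n) \<and> el v (f [^] (k + m) \<otimes> g [^] n))"

text \<open>What survives of a strong flip in the tree of a vertex that is not adjacent: there only
  the ellipticity of two products is known.\<close>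

definition weak_flip :: "'g \<Rightarrow> 'g \<Rightarrow> 'v \<Rightarrow> nat \<Rightarrow> bool" where
  "weak_flip f g v n \<longleftrightarrow>
     (\<exists>k>0. el v (f [^] (k::nat) \<otimes> g [^] n) \<and> el v (f [^] (k + 2) \<otimes> g [^] n))"

lemma strong_flip_fun:
  assumes v: "v \<in> V" and fg: "f \<in> carrier P" "g \<in> carrier P" and s: "strong_flip f g v n"
  obtains k m where "4 \<le> m"
    "tree.ell (T v) (act v (f [^] k \<otimes> g [^] n))"
    "tree.ell (T v) (act v f ^^ m \<circ> act v (f [^] (k::nat) \<otimes> g [^] n))"
proof -
  interpret Tv: tree "T v" "d v" "col v" by (rule tree[OF v])
  obtain k m :: nat where m: "4 \<le> m" "el v (f [^] k \<otimes> g [^] n)" "el v (f [^] (k + m) \<otimes> g [^] n)"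
    using s unfolding strong_flip_def by blast
  have "Tv.ell (act v f ^^ (m + k) \<circ> act v g ^^ n)"
    using m(3) el_word[OF v fg, of "k + m" n] by (simp add: add.commute)
  moreover have "(act v f ^^ (m + k) \<circ> act v g ^^ n) p = (act v f ^^ m \<circ> act v (f [^] k \<otimes> g [^] n)) p"
    if "p \<in> T v" for p
    using act_word[OF v fg that, of k n] by (simp add: funpow_add)
  ultimately have "Tv.ell (act v f ^^ m \<circ> act v (f [^] k \<otimes> g [^] n))"
    using Tv.ell_cong by blast
  then show ?thesis using that[OF m(1)] m(2) unfolding el_def by blast
qed

text \<open>The products with exponents \<open>k + 1\<close> and \<open>k + 3\<close> of
  \<open>f\<close> have squares that fix an edge at \<open>v\<close>. These squares are elliptic at
  \<open>u\<close>, and an automorphism with elliptic square is elliptic.\<close>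

lemma flip_transfer:
  assumes uv: "u \<in> V" "v \<in> V" "u = v \<or> \<not> E v u" and fg: "f \<in> carrier P" "g \<in> carrier P"
    and s: "strong_flip f g v n"
  shows "weak_flip f g u n"
proof -
  interpret Tv: tree "T v" "d v" "col v" by (rule tree[OF uv(2)])
  obtain k m :: nat where m: "4 \<le> m" "Tv.ell (act v (f [^] (k::nat) \<otimes> g [^] n))"
    "Tv.ell (act v f ^^ m \<circ> act v (f [^] k \<otimes> g [^] n))"
    using strong_flip_fun[OF uv(2) fg s] .
  have nf: "\<not> Tv.ell (act v f)" using s unfolding strong_flip_def el_def by blast
  let ?E = "f [^] k \<otimes> g [^] n"
  have EP: "?E \<in> carrier P" using fg by simp
  have w: "el u (f [^] (k + i) \<otimes> g [^] n)" if i: "i = 1 \<or> i = 3" for i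
  proof -
    let ?W = "f [^] (k + i) \<otimes> g [^] n"
    have WP: "?W \<in> carrier P" using fg by simp
    have aw: "act v ?W p = (act v f ^^ i \<circ> act v ?E) p" if "p \<in> T v" for p
      using act_word[OF uv(2) fg that, of "k + i" n] act_word[OF uv(2) fg that, of k n]
      by (simp add: funpow_add add.commute[of k i])
    have "Tv.fixes_edge ((act v f ^^ i \<circ> act v ?E) \<circ> (act v f ^^ i \<circ> act v ?E))"
      by (rule Tv.flip_fixes_edge[OF act_aut[OF uv(2) fg(1)] nf act_aut[OF uv(2) EP] m(2,1,3) i])
    moreover have "act v (?W \<otimes> ?W) p = ((act v f ^^ i \<circ> act v ?E) \<circ> (act v f ^^ i \<circ> act v ?E)) p"
      if "p \<in> T v" for p
      using act_mult[OF uv(2) WP WP that] aw[OF that] aw[OF act_T[OF uv(2) WP that]] by simp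
    ultimately have "fe v (?W \<otimes> ?W)"
      unfolding fe_def using Tv.fixes_edge_cong by blast
    then have "el u (?W \<otimes> ?W)" using fe_transfer[OF uv] WP by blast
    then show ?thesis using el_mult_self[OF uv(1) WP] by blast
  qed
  have e: "k + 1 + 2 = k + 3" and pos: "0 < k + 1" by simp_all
  have "el u (f [^] (k + 1 + 2) \<otimes> g [^] n)" unfolding e using w[of 3] by blast
  moreover have "el u (f [^] (k + 1) \<otimes> g [^] n)" by (rule w) (rule disjI1, rule refl)
  ultimately show ?thesis unfolding weak_flip_def by (intro exI[of _ "k + 1"] conjI pos)
qed

text \<open>If \<open>g\<close> is elliptic at \<open>u\<close>, the flipping exponents all send one
  point to one other point. If \<open>g\<close> is loxodromic, the overlap of the axes admits at
  most one exponent.\<close>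

lemma weak_flip_avoidable:
  assumes u: "u \<in> V" and fg: "f \<in> carrier P" "g \<in> carrier P" and nf: "\<not> el u f"
  shows "avoidable {n. weak_flip f g u n}"
proof -
  interpret Tu: tree "T u" "d u" "col u" by (rule tree[OF u])
  let ?f = "act u f" and ?g = "act u g"
  have a: "Tu.aut ?f" "Tu.aut ?g" using act_aut[OF u] fg by blast+
  have nf': "\<not> Tu.ell ?f" using nf by (simp add: el_def)
  show ?thesis
  proof (cases "Tu.ell ?g")
    case True
    obtain x y where xy: "x \<in> T u" "y \<in> T u" "x \<noteq> y"
      "\<And>m n. 2 \<le> m \<Longrightarrow> Tu.ell (?f ^^ m \<circ> ?g ^^ n) \<Longrightarrow> (?g ^^ n) x = y"
      using Tu.flip_target[OF a(1) nf' a(2) True] by metis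
    have "inj_on ?g (T u)" using Tu.aut_inj[OF a(2)] by (auto intro: inj_onI)
    then show ?thesis
    proof (rule avoidable_orbit[OF _ _ xy(1,3)])
      show "(?g ^^ n) x = y" if n: "n \<in> {n. weak_flip f g u n}" for n
      proof -
        obtain k where "el u (f [^] (k + 2 :: nat) \<otimes> g [^] n)" using n unfolding weak_flip_def by blast
        then have "Tu.ell (?f ^^ (k + 2) \<circ> ?g ^^ n)" using el_word[OF u fg] by blast
        then show ?thesis by (rule xy(4)[rotated]) simp
      qed
    qed (use Tu.aut_mem[OF a(2)] in blast)
  next
    case False
    obtain \<alpha> lf where f: "Tu.axis ?f \<alpha> lf" using Tu.not_ell_axis[OF a(1) nf'] .
    obtain \<beta> lg where g: "Tu.axis ?g \<beta> lg" using Tu.not_ell_axis[OF a(2) False] .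
    have lg: "0 < lg" using Tu.axis_pos[OF g] .
    have pos: "0 < n" if n: "weak_flip f g u n" for n
    proof (rule ccontr)
      assume "\<not> 0 < n"
      then obtain k :: nat where k: "0 < k" "el u (f [^] k \<otimes> g [^] (0::nat))"
        using n unfolding weak_flip_def by auto
      then have "Tu.ell (?f ^^ k \<circ> ?g ^^ 0)" using el_word[OF u fg] by blast
      then have "Tu.ell (?f ^^ k)" by simp
      then show False using Tu.funpow_ell[OF a(1) k(1)] nf' by blast
    qed
    have prp: "Tu.opposite \<alpha> \<beta> (int n * lg) \<and> Tu.overlap_le \<alpha> \<beta> (int n * lg)" if n: "weak_flip f g u n" for n
    proof -
      obtain k where k: "0 < k" "el u (f [^] k \<otimes> g [^] n)" "el u (f [^] (k + 2 :: nat) \<otimes> g [^] n)"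
        using n unfolding weak_flip_def by blast
      then show ?thesis
        using Tu.flip_exponent_unique[OF a(1) f a(2) g pos[OF n] k(1)] el_word[OF u fg] by blast
    qed
    show ?thesis
    proof (cases "\<exists>n. weak_flip f g u n")
      case True
      then obtain n0 where n0: "weak_flip f g u n0" ..
      have "n = n0" if n: "weak_flip f g u n" for n
      proof -
        have "int n * lg \<le> int n0 * lg" "int n0 * lg \<le> int n * lg"
          using Tu.opposite_le prp[OF n] prp[OF n0] lg by (meson mult_nonneg_nonneg of_nat_0_le_iff order_less_imp_le)+
        then show ?thesis using lg by simp
      qed
      then show ?thesis using pos[OF n0] by (intro avoidable_singleton[of _ n0]) auto
    next
      case False
      then show ?thesis using avoidable_singleton[of "{n. weak_flip f g u n}" 1] by simp
    qed
  qed
qed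

text \<open>By maximality every vertex of \<open>B\<close> is in \<open>Q\<close> or not adjacent to
  some member of \<open>Q\<close>. Strong flips anywhere in \<open>B\<close> are therefore seen as
  weak flips at one of at most \<open>D\<close> vertices, so blocks of length \<open>2 ^ D\<close>
  suffice whatever the number of vertices.\<close>

lemma maximal_clique:
  assumes "B \<subseteq> V"
  obtains Q where "Q \<subseteq> B" "\<And>u w. u \<in> Q \<Longrightarrow> w \<in> Q \<Longrightarrow> u \<noteq> w \<Longrightarrow> E u w"
    "\<And>v. v \<in> B \<Longrightarrow> \<exists>u\<in>Q. u = v \<or> \<not> E v u"
proof -
  let ?C = "{Q. Q \<subseteq> B \<and> (\<forall>u\<in>Q. \<forall>w\<in>Q. u \<noteq> w \<longrightarrow> E u w)}"
  have "finite ?C" using finite_subset[OF assms finite_V] by simp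
  moreover have "{} \<in> ?C" by simp
  ultimately obtain Q where Q: "Q \<in> ?C" "\<And>R. R \<in> ?C \<Longrightarrow> Q \<subseteq> R \<Longrightarrow> R = Q"
    using finite_has_maximal[of ?C] by (metis (no_types, lifting) empty_iff)
  have "\<exists>u\<in>Q. u = v \<or> \<not> E v u" if v: "v \<in> B" for v
  proof (rule ccontr)
    assume a: "\<not> ?thesis"
    then have "insert v Q \<in> ?C" using Q(1) v symE by blast
    then have "insert v Q = Q" using Q(2) by blast
    then show False using a by blast
  qed
  then show ?thesis using that[of Q] Q(1) by blast
qed

lemma block_without_flip:
  assumes fg: "f \<in> carrier P" "g \<in> carrier P"
    and dim: "\<And>C. \<lbrakk>C \<subseteq> V; \<And>u w. u \<in> C \<Longrightarrow> w \<in> C \<Longrightarrow> u \<noteq> w \<Longrightarrow> E u w\<rbrakk> \<Longrightarrow> card C \<le> D"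
  shows "\<exists>n. x < n \<and> n \<le> x + 2 ^ D \<and> (\<forall>v\<in>V. \<not> strong_flip f g v n)"
proof -
  define B where "B = {v \<in> V. \<exists>n. strong_flip f g v n}"
  obtain Q where Q: "Q \<subseteq> B" "\<And>u w. u \<in> Q \<Longrightarrow> w \<in> Q \<Longrightarrow> u \<noteq> w \<Longrightarrow> E u w"
    "\<And>v. v \<in> B \<Longrightarrow> \<exists>u\<in>Q. u = v \<or> \<not> E v u"
    using maximal_clique[of B] unfolding B_def by blast
  have QV: "Q \<subseteq> V" using Q(1) unfolding B_def by blast
  have av: "avoidable {n. weak_flip f g u n}" if "u \<in> Q" for u
  proof (rule weak_flip_avoidable[OF _ fg])
    show "u \<in> V" "\<not> el u f" using that Q(1) unfolding B_def strong_flip_def by blast+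
  qed
  obtain n where n: "x < n" "n \<le> x + 2 ^ card Q" "\<forall>u\<in>Q. n \<notin> {n. weak_flip f g u n}"
    using avoid_block[OF finite_subset[OF QV finite_V], of "\<lambda>u. {n. weak_flip f g u n}" x] av by blast
  have "card Q \<le> D" using dim[OF QV] Q(2) by blast
  then have "(2::nat) ^ card Q \<le> 2 ^ D" by simp
  then have "n \<le> x + 2 ^ D" using n(2) by linarith
  moreover have "\<not> strong_flip f g v n" if v: "v \<in> V" for v
  proof
    assume s: "strong_flip f g v n"
    then obtain u where u: "u \<in> Q" "u = v \<or> \<not> E v u" using Q(3)[of v] v unfolding B_def by blast
    then have "weak_flip f g u n" using flip_transfer[OF _ v u(2) fg s] QV by blast
    then show False using n(3) u(1) by blast
  qed
  ultimately show ?thesis using n(1) by blast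
qed

text \<open>If \<open>f\<close> or \<open>g\<close> were elliptic, the product in which the other
  has exponent \<open>0\<close> would be elliptic too, a strong flip because \<open>a\<close> and
  \<open>b\<close> are at least \<open>4\<close>. If one translation exceeded the other by four or
  more of its own steps, \<open>par\<close> would allow lowering its exponent by \<open>4\<close>,
  again a strong flip. So both are loxodromic and the translation lengths almost agree.\<close>

lemma ell_axes_bound:
  assumes v: "v \<in> V" and fg: "f \<in> carrier P" "g \<in> carrier P"
    and e: "el v (f [^] b \<otimes> g [^] a)" and lox: "\<not> el v f \<or> \<not> el v g"
    and ab: "4 \<le> a" "4 \<le> b"
    and nf: "\<not> strong_flip f g v a" "\<not> strong_flip g f v b"
  obtains \<alpha> lf \<beta> lg where "tree.axis (T v) (d v) (act v f) \<alpha> lf" "tree.axis (T v) (d v) (act v g) \<beta> lg"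
    "int (b - 4) * lf < int a * lg" "int (a - 4) * lg < int b * lf"
proof -
  interpret Tv: tree "T v" "d v" "col v" by (rule tree[OF v])
  let ?f = "act v f" and ?g = "act v g"
  have a: "Tv.aut ?f" "Tv.aut ?g" using act_aut[OF v] fg by blast+
  have sw: "el v (g [^] a \<otimes> f [^] b)" if "el v (f [^] b \<otimes> g [^] a)" for a b :: nat
    using el_swap[OF v nat_pow_closed[OF fg(1)] nat_pow_closed[OF fg(2)] that] .
  have pow0: "el v (h [^] (0::nat) \<otimes> k [^] n)" if "el v k" "k \<in> carrier P" "h \<in> carrier P" for h k and n :: nat
    using that el_word[OF v that(3,2), of 0 n] Tv.ell_funpow[of "act v k" n] by (simp add: el_def)
  have nef: "\<not> el v f"
  proof
    assume "el v f"
    then have "strong_flip g f v b"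
      unfolding strong_flip_def using lox pow0[OF _ fg, of b] sw[OF e] ab
      by (metis add_0)
    then show False using nf by blast
  qed
  have neg: "\<not> el v g"
  proof
    assume "el v g"
    then have "strong_flip f g v a"
      unfolding strong_flip_def using nef pow0[OF _ fg(2,1), of a] e ab by (metis add_0)
    then show False using nf by blast
  qed
  obtain \<alpha> lf where f: "Tv.axis ?f \<alpha> lf" using Tv.not_ell_axis[OF a(1)] nef unfolding el_def by blast
  obtain \<beta> lg where g: "Tv.axis ?g \<beta> lg" using Tv.not_ell_axis[OF a(2)] neg unfolding el_def by blast
  have pos: "0 < a" "0 < b" using ab by simp_all
  have e': "Tv.ell (?f ^^ b \<circ> ?g ^^ a)" using e el_word[OF v fg] by blast
  note p = Tv.par(3,4)[OF a(1) f a(2) g pos e' refl]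
  have "int (b - 4) * lf < int a * lg"
  proof (rule ccontr)
    assume "\<not> ?thesis"
    then have "el v (f [^] (b - 4) \<otimes> g [^] a)" using p(2)[OF ab(2)] el_word[OF v fg] by simp
    moreover have "el v (f [^] (b - 4 + 4) \<otimes> g [^] a)" using e ab(2) by simp
    ultimately have "strong_flip f g v a" unfolding strong_flip_def using nef by blast
    then show False using nf by blast
  qed
  moreover have "int (a - 4) * lg < int b * lf"
  proof (rule ccontr)
    assume "\<not> ?thesis"
    then have "el v (f [^] b \<otimes> g [^] (a - 4))" using p(1)[OF ab(1)] el_word[OF v fg] by simp
    then have "el v (g [^] (a - 4) \<otimes> f [^] b)" by (rule sw)
    moreover have "el v (g [^] (a - 4 + 4) \<otimes> f [^] b)" using sw[OF e] ab(1) by simp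
    ultimately have "strong_flip g f v b" unfolding strong_flip_def using neg by blast
    then show False using nf by blast
  qed
  ultimately show ?thesis using that f g by blast
qed

text \<open>The commutator is \<open>f [^] j \<otimes> h [^] j\<close>, where the axis of
  \<open>h\<close> is the reversed image under \<open>g\<close> of the axis of \<open>f\<close>. If
  it is elliptic, these axes overlap in opposite directions, so \<open>g\<close> shifts a segment of
  length \<open>int j * lf\<close> of \<open>\<alpha>\<close> along \<open>\<alpha>\<close>. By
  \<open>translated_subset_axis\<close> this segment lies on the axis of \<open>g\<close>.\<close>

lemma commutator_ell_overlap:
  assumes v: "v \<in> V" and fg: "f \<in> carrier P" "g \<in> carrier P"
    and f: "tree.axis (T v) (d v) (act v f) \<alpha> lf" and g: "tree.axis (T v) (d v) (act v g) \<beta> lg"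
    and j: "0 < j" and e: "el v (f [^] (j::nat) \<otimes> g \<otimes> inv (f [^] j) \<otimes> inv g)"
    and o: "tree.overlap_le \<alpha> \<beta> m"
  shows "int j * lf \<le> m"
proof -
  interpret Tv: tree "T v" "d v" "col v" by (rule tree[OF v])
  have a: "Tv.aut (act v f)" "Tv.aut (act v g)" using act_aut[OF v] fg by blast+
  have l: "Tv.line \<alpha>" using Tv.axis_line[OF f] .
  have lf: "0 < lf" using Tv.axis_pos[OF f] .
  define h where "h = g \<otimes> inv f \<otimes> inv g"
  have hP: "h \<in> carrier P" using fg by (simp add: h_def)
  have cancel: "inv x \<otimes> (x \<otimes> y) = y" "x \<otimes> (inv x \<otimes> y) = y" if "x \<in> carrier P" "y \<in> carrier P" for x y
    using that by (simp_all add: m_assoc[symmetric])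
  have hpow: "h [^] n = g \<otimes> inv (f [^] n) \<otimes> inv g" for n :: nat
  proof (induction n)
    case (Suc n)
    have "h [^] Suc n = g \<otimes> inv (f [^] n) \<otimes> inv g \<otimes> (g \<otimes> inv f \<otimes> inv g)"
      using Suc by (simp add: h_def)
    also have "\<dots> = g \<otimes> (inv (f [^] n) \<otimes> inv f) \<otimes> inv g"
      using fg by (simp add: m_assoc cancel)
    also have "inv (f [^] n) \<otimes> inv f = inv (f \<otimes> f [^] n)" using fg by (simp add: inv_mult_group)
    also have "f \<otimes> f [^] n = f [^] Suc n" using nat_pow_Suc2[OF fg(1)] by simp
    finally show ?case .
  qed (use fg in simp)
  have "f [^] j \<otimes> g \<otimes> inv (f [^] j) \<otimes> inv g = f [^] j \<otimes> h [^] j"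
    using fg by (simp add: hpow m_assoc)
  then have "Tv.ell (act v f ^^ j \<circ> act v h ^^ j)" using e el_word[OF v fg(1) hP, of j j] by metis
  moreover have "Tv.axis (act v h) (\<lambda>i. act v g (\<alpha> (- i))) lf"
    unfolding Tv.axis_def
  proof (intro conjI allI lf)
    show "Tv.line (\<lambda>i. act v g (\<alpha> (- i)))"
      using Tv.aut_mem[OF a(2)] Tv.aut_d[OF a(2)] l unfolding Tv.line_def by (simp add: abs_minus_commute)
    fix i
    have m: "\<alpha> k \<in> T v" for k using Tv.line_mem[OF l] .
    have "act v h (act v g (\<alpha> (- i))) = act v (h \<otimes> g) (\<alpha> (- i))"
      using act_mult[OF v hP fg(2) m] by simp
    also have "h \<otimes> g = g \<otimes> inv f" using fg by (simp add: h_def m_assoc)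
    also have "act v (g \<otimes> inv f) (\<alpha> (- i)) = act v g (act v (inv f) (\<alpha> (- i)))"
      using act_mult[OF v fg(2) inv_closed[OF fg(1)] m] .
    also have "act v (inv f) (\<alpha> (- i)) = \<alpha> (- (i + lf))"
    proof -
      have "\<alpha> (- i) = act v f (\<alpha> (- (i + lf)))" using f by (simp add: Tv.axis_def)
      then have "act v (inv f) (\<alpha> (- i)) = act v (inv f \<otimes> f) (\<alpha> (- (i + lf)))"
        using act_mult[OF v inv_closed[OF fg(1)] fg(1) m] by simp
      then show ?thesis using act_one[OF v m] fg(1) by simp
    qed
    finally show "act v h (act v g (\<alpha> (- i))) = act v g (\<alpha> (- (i + lf)))" .
  qed
  ultimately have "Tv.opposite \<alpha> (\<lambda>i. act v g (\<alpha> (- i))) (min (int j * lf) (int j * lf))"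
    using Tv.par(1)[OF a(1) f act_aut[OF v hP] _ j j _ refl] by blast
  then have "Tv.opposite \<alpha> (\<lambda>i. act v g (\<alpha> (- i))) (int j * lf)" by (simp only: min.idem)
  then obtain c c' where c: "\<And>k. 0 \<le> k \<Longrightarrow> k \<le> int j * lf \<Longrightarrow> \<alpha> (c + k) = act v g (\<alpha> (- (c' - k)))"
    unfolding Tv.opposite_def by blast
  have m1: "1 \<le> int j * lf" using j lf by (simp add: int_one_le_iff_zero_less)
  have "\<alpha> (- c' + k) \<in> range \<beta>" if "0 \<le> k" "k \<le> int j * lf" for k
    by (rule Tv.translated_subset_axis[OF a(2) g l m1 _ that, of "- c'" c]) (simp add: c)
  from this[of 0] this[of "int j * lf"]
  have "\<alpha> (- c' + 0) \<in> range \<beta>" "\<alpha> (- c' + int j * lf) \<in> range \<beta>" using m1 by simp_all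
  then have "\<bar>(- c' + 0) - (- c' + int j * lf)\<bar> \<le> m" using o unfolding Tv.overlap_le_def by blast
  then show ?thesis by simp
qed

lemma commutator_fixes_edge:
  assumes v: "v \<in> V" and fg: "f \<in> carrier P" "g \<in> carrier P"
    and f: "tree.axis (T v) (d v) (act v f) \<alpha> lf" and g: "tree.axis (T v) (d v) (act v g) \<beta> lg"
    and o: "tree.opposite \<alpha> \<beta> m" and m: "lg + int j * lf + 1 \<le> m"
  shows "fe v (f [^] (j::nat) \<otimes> g \<otimes> inv (f [^] j) \<otimes> inv g)"
proof -
  interpret Tv: tree "T v" "d v" "col v" by (rule tree[OF v])
  obtain x y where xy: "x \<in> T v" "y \<in> T v" "d v x y = 1"
    "(act v f ^^ j) (act v g x) = act v g ((act v f ^^ j) x)"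
    "(act v f ^^ j) (act v g y) = act v g ((act v f ^^ j) y)"
    using Tv.commutator_fixes[OF f g o m] .
  let ?F = "f [^] j"
  have F: "?F \<in> carrier P" using fg by simp
  let ?c = "?F \<otimes> g \<otimes> inv ?F \<otimes> inv g"
  have cP: "?c \<in> carrier P" using F fg by simp
  have gF: "g \<otimes> ?F \<in> carrier P" using F fg by simp
  have cancel: "inv x \<otimes> (x \<otimes> y) = y" if "x \<in> carrier P" "y \<in> carrier P" for x y
    using that by (simp add: m_assoc[symmetric])
  have e: "?c \<otimes> (g \<otimes> ?F) = ?F \<otimes> g" using F fg by (simp add: m_assoc cancel)
  have fix1: "act v ?c (act v (g \<otimes> ?F) p) = act v (g \<otimes> ?F) p"
    if p: "p \<in> T v" "(act v f ^^ j) (act v g p) = act v g ((act v f ^^ j) p)" for p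
  proof -
    have "act v ?c (act v (g \<otimes> ?F) p) = act v (?F \<otimes> g) p"
      using act_mult[OF v cP gF p(1)] unfolding e by simp
    also have "\<dots> = (act v f ^^ j) (act v g p)"
      using act_mult[OF v F fg(2) p(1)] act_pow[OF v fg(1) act_T[OF v fg(2) p(1)]] by simp
    also have "\<dots> = act v (g \<otimes> ?F) p"
      using act_mult[OF v fg(2) F p(1)] act_pow[OF v fg(1) p(1)] p(2) by simp
    finally show ?thesis .
  qed
  have "d v (act v (g \<otimes> ?F) x) (act v (g \<otimes> ?F) y) = 1"
    using Tv.aut_d[OF act_aut[OF v gF] xy(1,2)] xy(3) by simp
  then show ?thesis
    unfolding fe_def Tv.fixes_edge_def
    using fix1[OF xy(1,4)] fix1[OF xy(2,5)] act_T[OF v gF xy(1)] act_T[OF v gF xy(2)] by blast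
qed

text \<open>Otherwise information passes between the trees. At \<open>v'\<close> the overlap is long
  enough for the commutator of \<open>f [^] (b + 1)\<close> and \<open>g\<close> to fix an edge, so
  it is elliptic at \<open>v\<close>. There it forces an overlap of length
  \<open>int (b + 1) * lf\<close>, more than the failure at exponent \<open>b\<close>
  permits.\<close>

lemma two_bad_adjacent:
  assumes vv: "v \<in> V" "v' \<in> V" and fg: "f \<in> carrier P" "g \<in> carrier P"
    and e: "el v (f [^] b \<otimes> g [^] a)" "el v' (f [^] b' \<otimes> g [^] a)"
    and lox: "\<not> el v f \<or> \<not> el v g" "\<not> el v' f \<or> \<not> el v' g"
    and nfa: "\<And>v. v \<in> V \<Longrightarrow> \<not> strong_flip f g v a"
    and nfb: "\<not> strong_flip g f v b" "\<not> strong_flip g f v' b'"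
    and ab: "4 \<le> a" "4 \<le> b" "b + 6 \<le> b'"
    and num: "b' \<le> a * (b' - b - 5)" "b' \<le> (a - 4) * (b' - b - 1)"
  shows "v \<noteq> v' \<and> E v v'"
proof (rule ccontr)
  assume "\<not> ?thesis"
  then have n: "v' = v \<or> \<not> E v v'" "v = v' \<or> \<not> E v' v" using symE by blast+
  have b': "4 \<le> b'" using ab by linarith
  obtain \<alpha> lf \<beta> lg where ax: "tree.axis (T v) (d v) (act v f) \<alpha> lf" "tree.axis (T v) (d v) (act v g) \<beta> lg"
    using ell_axes_bound[OF vv(1) fg e(1) lox(1) ab(1,2) nfa[OF vv(1)] nfb(1)] .
  obtain \<alpha>' lf' \<beta>' lg' where ax': "tree.axis (T v') (d v') (act v' f) \<alpha>' lf'" "tree.axis (T v') (d v') (act v' g) \<beta>' lg'"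
    and bd: "int (b' - 4) * lf' < int a * lg'" "int (a - 4) * lg' < int b' * lf'"
    using ell_axes_bound[OF vv(2) fg e(2) lox(2) ab(1) b' nfa[OF vv(2)] nfb(2)] .
  interpret Tv: tree "T v" "d v" "col v" by (rule tree[OF vv(1)])
  interpret Tw: tree "T v'" "d v'" "col v'" by (rule tree[OF vv(2)])
  have P: "f [^] b \<otimes> g [^] a \<in> carrier P" "f [^] b' \<otimes> g [^] a \<in> carrier P" using fg by simp_all
  have nf: "\<not> el v f" "\<not> el v' f"
    using Tv.axis_not_ell[OF act_aut[OF vv(1) fg(1)] ax(1)] Tw.axis_not_ell[OF act_aut[OF vv(2) fg(1)] ax'(1)]
    by (simp_all add: el_def)
  \<comment> \<open>Two failing exponents \<open>b\<close> and \<open>b'\<close> in one tree would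
    be a strong flip. So the product with \<open>b\<close> fixes no edge at \<open>v\<close>, since
    it would then be elliptic at \<open>v'\<close> as well.\<close>
  have both: False if "w \<in> V" "\<not> el w f" "el w (f [^] b \<otimes> g [^] a)" "el w (f [^] b' \<otimes> g [^] a)" for w
  proof -
    have "b' = b + (b' - b)" "4 \<le> b' - b" using ab by simp_all
    then have "strong_flip f g w a" unfolding strong_flip_def using that by metis
    then show False using nfa that(1) by blast
  qed
  have nfe: "\<not> fe v (f [^] b \<otimes> g [^] a)"
    using both[OF vv(2) nf(2) _ e(2)] fe_transfer[OF vv(2,1) n(1) P(1)] by blast
  have pos: "0 < a" "0 < b" "0 < b'" using ab by simp_all
  have ov: "Tv.overlap_le \<alpha> \<beta> (min (int a * lg) (int b * lf))"
    using Tv.par(2)[OF act_aut[OF vv(1) fg(1)] ax(1) act_aut[OF vv(1) fg(2)] ax(2) pos(1,2) _ refl]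
      e(1) el_word[OF vv(1) fg] nfe fe_word[OF vv(1) fg] by blast
  have op: "Tw.opposite \<alpha>' \<beta>' (min (int a * lg') (int b' * lf'))"
    using Tw.par(1)[OF act_aut[OF vv(2) fg(1)] ax'(1) act_aut[OF vv(2) fg(2)] ax'(2) pos(1,3) _ refl]
      e(2) el_word[OF vv(2) fg] by blast
  have l: "0 < lf" "0 < lf'" "0 < lg'" using Tv.axis_pos[OF ax(1)] Tw.axis_pos[OF ax'(1)] Tw.axis_pos[OF ax'(2)] by blast+
  \<comment> \<open>The next two estimates say that the shorter of the two translations at
    \<open>v'\<close> exceeds what the commutator needs. They combine \<open>bd\<close>, by which
    the translation lengths are nearly equal, with \<open>num\<close>; strictness leaves room for
    the edge.\<close>
  have 1: "lg' + int (b + 1) * lf' < int a * lg'"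
  proof -
    have "a * (b + 1) \<le> (a - 1) * (b' - 4)"
    proof -
      obtain a0 where a0: "a = Suc a0" using ab(1) by (cases a) auto
      obtain t where t: "b' = b + t + 6" using ab(3) by (metis add.commute add.assoc le_Suc_ex)
      show ?thesis using num(1) unfolding a0 t by (simp add: algebra_simps)
    qed
    then have "int (a * (b + 1)) \<le> int ((a - 1) * (b' - 4))" by (simp only: of_nat_le_iff)
    then have "int a * int (b + 1) \<le> int (a - 1) * int (b' - 4)" by (simp only: of_nat_mult)
    then have "int a * int (b + 1) * lf' \<le> int (a - 1) * int (b' - 4) * lf'"
      by (rule mult_right_mono) (use l(2) in simp)
    also have "\<dots> < int (a - 1) * (int a * lg')"
      using bd(1) ab(1) unfolding mult.assoc by (intro mult_strict_left_mono) simp_all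
    finally have "int a * (int (b + 1) * lf') < int a * (int (a - 1) * lg')" by (simp add: mult_ac)
    then have "int (b + 1) * lf' < int (a - 1) * lg'"
      by (rule mult_left_less_imp_less) simp
    moreover have "int (a - 1) * lg' = int a * lg' - lg'" using ab(1) by (simp add: of_nat_diff left_diff_distrib)
    ultimately show ?thesis by simp
  qed
  have 2: "lg' + int (b + 1) * lf' < int b' * lf'"
  proof -
    have "int b' \<le> int ((a - 4) * (b' - b - 1))" using num(2) by (simp only: of_nat_le_iff)
    then have "int b' \<le> int (a - 4) * int (b' - b - 1)" by (simp only: of_nat_mult)
    then have "int b' * lf' \<le> int (a - 4) * int (b' - b - 1) * lf'"
      by (rule mult_right_mono) (use l(2) in simp)
    then have "int (a - 4) * lg' < int (a - 4) * (int (b' - b - 1) * lf')"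
      using bd(2) unfolding mult.assoc by linarith
    then have "lg' < int (b' - b - 1) * lf'"
      by (rule mult_left_less_imp_less) simp
    moreover have "int (b' - b - 1) = int b' - int (b + 1)" using ab(3) by simp
    ultimately show ?thesis by (simp add: left_diff_distrib)
  qed
  have "fe v' (f [^] (b + 1) \<otimes> g \<otimes> inv (f [^] (b + 1)) \<otimes> inv g)"
    by (rule commutator_fixes_edge[OF vv(2) fg ax' op]) (use 1 2 in linarith)
  then have "el v (f [^] (b + 1) \<otimes> g \<otimes> inv (f [^] (b + 1)) \<otimes> inv g)"
    using fe_transfer[OF vv n(2)] fg by simp
  then have "int (b + 1) * lf \<le> min (int a * lg) (int b * lf)"
    by (rule commutator_ell_overlap[OF vv(1) fg ax _ _ ov, rotated]) simp
  then show False using l(1) by (simp add: left_diff_distrib distrib_right)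
qed

end

section \<open>Combining two elements, then many; Serre's lemma for generated subgroups\<close>

context tree_family begin

lemma combine:
  assumes fg: "f \<in> carrier P" "g \<in> carrier P" and K: "1 \<le> K" and D: "1 \<le> D"
    and Kf: "\<And>x. \<exists>n. x < n \<and> n \<le> x + K \<and> (\<forall>v\<in>V. \<not> strong_flip f g v n)"
    and Kg: "\<And>x. \<exists>n. x < n \<and> n \<le> x + K \<and> (\<forall>v\<in>V. \<not> strong_flip g f v n)"
    and dim: "\<And>C. \<lbrakk>C \<subseteq> V; \<And>u w. u \<in> C \<Longrightarrow> w \<in> C \<Longrightarrow> u \<noteq> w \<Longrightarrow> E u w\<rbrakk> \<Longrightarrow> card C \<le> D"
  shows "\<exists>a b. 1 \<le> a \<and> a \<le> 6 * D + 4 + K \<and> 1 \<le> b \<and> b \<le> 8 * K * (D + 1) + K \<and>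
    (\<forall>v\<in>V. \<not> el v f \<or> \<not> el v g \<longrightarrow> \<not> el v (f [^] (b::nat) \<otimes> g [^] (a::nat)))"
proof (rule ccontr)
  assume contra: "\<not> ?thesis"
  \<comment> \<open>\<open>a \<ge> 6 * D + 5\<close> and the spacing \<open>8 * K\<close> of the
    \<open>b j\<close>, which leaves gaps above \<open>7 * K\<close>, are chosen for the two
    numerical hypotheses of \<open>two_bad_adjacent\<close>, although \<open>b j\<close> may be as
    large as \<open>8 * K * (D + 1) + K\<close>.\<close>
  obtain a where a: "6 * D + 4 < a" "a \<le> 6 * D + 4 + K" "\<And>v. v \<in> V \<Longrightarrow> \<not> strong_flip f g v a"
    using Kf[of "6 * D + 4"] by blast
  have "\<forall>j. \<exists>n. 8 * K * (j + 1) < n \<and> n \<le> 8 * K * (j + 1) + K \<and> (\<forall>v\<in>V. \<not> strong_flip g f v n)"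
    using Kg by blast
  then obtain b where b: "\<And>j. 8 * K * (j + 1) < b j" "\<And>j. b j \<le> 8 * K * (j + 1) + K"
    "\<And>j v. v \<in> V \<Longrightarrow> \<not> strong_flip g f v (b j)"
    by metis
  have "\<exists>v\<in>V. (\<not> el v f \<or> \<not> el v g) \<and> el v (f [^] b j \<otimes> g [^] a)" if j: "j \<le> D" for j
  proof -
    have "1 \<le> a" using a(1) by simp
    moreover have "1 \<le> b j" using b(1)[of j] by simp
    moreover have "8 * K * (j + 1) \<le> 8 * K * (D + 1)" using j by (intro mult_le_mono) auto
    then have "b j \<le> 8 * K * (D + 1) + K" using b(2)[of j] by linarith
    ultimately show ?thesis using contra a(2) by blast
  qed
  then obtain w where w: "\<And>j. j \<le> D \<Longrightarrow> w j \<in> V" "\<And>j. j \<le> D \<Longrightarrow> \<not> el (w j) f \<or> \<not> el (w j) g"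
    "\<And>j. j \<le> D \<Longrightarrow> el (w j) (f [^] b j \<otimes> g [^] a)"
    by metis
  have adj: "w i \<noteq> w j \<and> E (w i) (w j)" if ij: "i < j" "j \<le> D" for i j
  proof -
    have i: "i \<le> D" using ij by simp
    have j1: "8 * K * (i + 1) + 8 * K \<le> 8 * K * (j + 1)"
    proof -
      have "8 * K * (i + 1) + 8 * K = 8 * K * (i + 2)" by simp
      also have "\<dots> \<le> 8 * K * (j + 1)" using ij by (intro mult_le_mono) auto
      finally show ?thesis .
    qed
    then have gap: "b i + 7 * K < b j" using b(1)[of j] b(2)[of i] by linarith
    have "8 * K * (j + 1) \<le> 8 * K * (D + 1)" using ij by (intro mult_le_mono) auto
    then have "b j \<le> 8 * K * (D + 1) + K" using b(2)[of j] by linarith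
    also have "\<dots> = 8 * (K * D) + 9 * K" by (simp add: algebra_simps)
    finally have bj: "b j \<le> 8 * (K * D) + 9 * K" .
    have eqs: "(6 * D + 5) * (3 * K) = 18 * (K * D) + 15 * K" "(6 * D + 1) * (7 * K) = 42 * (K * D) + 7 * K"
      by (simp_all add: algebra_simps)
    have KD: "K \<le> K * D" using D by simp
    have "8 * K \<le> 8 * K * (i + 1)" by simp
    then have bi: "8 < b i" using b(1)[of i] K by linarith
    show ?thesis
    proof (rule two_bad_adjacent[OF w(1)[OF i] w(1)[OF ij(2)] fg w(3)[OF i] w(3)[OF ij(2)] w(2)[OF i] w(2)[OF ij(2)] a(3)])
      show "\<not> strong_flip g f (w i) (b i)" "\<not> strong_flip g f (w j) (b j)"
        using b(3) w(1) i ij by blast+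
      show "4 \<le> a" "4 \<le> b i" "b i + 6 \<le> b j" using a(1) bi gap K by linarith+
      have "(6 * D + 5) * (3 * K) \<le> a * (b j - b i - 5)"
        using a(1) gap K by (intro mult_le_mono) linarith+
      then show "b j \<le> a * (b j - b i - 5)" using bj eqs by linarith
      have "(6 * D + 1) * (7 * K) \<le> (a - 4) * (b j - b i - 1)"
        using a(1) gap K by (intro mult_le_mono) linarith+
      then show "b j \<le> (a - 4) * (b j - b i - 1)" using bj KD eqs by linarith
    qed
  qed
  have inj: "inj_on w {..D}"
    using adj by (intro inj_onI) (metis atMost_iff linorder_neqE_nat)
  have "card (w ` {..D}) \<le> D"
  proof (rule dim)
    show "w ` {..D} \<subseteq> V" using w(1) by auto
    show "E u u'" if u: "u \<in> w ` {..D}" "u' \<in> w ` {..D}" "u \<noteq> u'" for u u'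
    proof -
      obtain i j where ij: "i \<le> D" "u = w i" "j \<le> D" "u' = w j" using u by auto
      then have "i < j \<or> j < i" using u(3) by (metis linorder_neqE_nat)
      then show ?thesis using adj symE ij by blast
    qed
  qed
  then show False using card_image[OF inj] by simp
qed

lemma foldr_append_mult:
  "\<lbrakk>set xs \<subseteq> carrier P; set ys \<subseteq> carrier P\<rbrakk> \<Longrightarrow>
    foldr (\<lambda>x y. x \<otimes> y) xs \<one> \<in> carrier P \<and>
    foldr (\<lambda>x y. x \<otimes> y) (xs @ ys) \<one> = foldr (\<lambda>x y. x \<otimes> y) xs \<one> \<otimes> foldr (\<lambda>x y. x \<otimes> y) ys \<one>"
proof (induction xs)
  case Nil
  have "foldr (\<lambda>x y. x \<otimes> y) ys \<one> \<in> carrier P" using Nil(2) by (induction ys) auto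
  then show ?case by simp
next
  case (Cons a xs)
  have "foldr (\<lambda>x y. x \<otimes> y) ys \<one> \<in> carrier P" using Cons(3) by (induction ys) auto
  then show ?case using Cons by (simp add: m_assoc)
qed

lemma set_power_carrier: "U \<subseteq> carrier P \<Longrightarrow> x \<in> set_power P U n \<Longrightarrow> x \<in> carrier P"
  unfolding set_power_def using foldr_append_mult[of _ "[]"] by auto

lemma set_power_mult:
  assumes U: "U \<subseteq> carrier P" and xy: "x \<in> set_power P U m" "y \<in> set_power P U n"
  shows "x \<otimes> y \<in> set_power P U (m + n)"
proof -
  obtain xs ys where "x = foldr (\<lambda>x y. x \<otimes> y) xs \<one>" "length xs = m" "set xs \<subseteq> U"
    "y = foldr (\<lambda>x y. x \<otimes> y) ys \<one>" "length ys = n" "set ys \<subseteq> U"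
    using xy unfolding set_power_def by blast
  then show ?thesis
    unfolding set_power_def using foldr_append_mult[of xs ys] U by (intro CollectI exI[of _ "xs @ ys"]) auto
qed

lemma set_power_pow:
  assumes U: "U \<subseteq> carrier P" and x: "x \<in> set_power P U m" shows "x [^] (n::nat) \<in> set_power P U (n * m)"
proof (induction n)
  case 0
  show ?case by (simp add: set_power_def)
next
  case (Suc n)
  then show ?case using set_power_mult[OF U Suc x] by (simp add: add.commute)
qed

lemma set_power_two: "\<lbrakk>U \<subseteq> carrier P; u \<in> U; w \<in> U\<rbrakk> \<Longrightarrow> u \<otimes> w \<in> set_power P U 2"
  unfolding set_power_def by (intro CollectI exI[of _ "[u, w]"]) auto

text \<open>The new length is at most \<open>6 * N0 + N0 * n\<close>. The summand \<open>7\<close>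
  makes the bound reproduce itself: \<open>N0 * (n + 7)\<close> exceeds \<open>N0 * n\<close> by
  \<open>7 * N0\<close>, which absorbs \<open>6 * N0 + 7\<close>.\<close>

lemma cover_by_products:
  assumes U: "U \<subseteq> carrier P" and N0: "11 \<le> N0"
    and comb: "\<And>f g. \<lbrakk>f \<in> carrier P; g \<in> carrier P\<rbrakk> \<Longrightarrow> \<exists>a b. 1 \<le> a \<and> a \<le> N0 \<and> 1 \<le> b \<and> b \<le> 3 * N0 \<and>
      (\<forall>v\<in>V. \<not> el v f \<or> \<not> el v g \<longrightarrow> \<not> el v (f [^] (b::nat) \<otimes> g [^] (a::nat)))"
    and H: "finite H" "H \<noteq> {}" "H \<subseteq> set_power P U 2"
  shows "\<exists>n y. 1 \<le> n \<and> n + 7 \<le> N0 ^ card H \<and> y \<in> set_power P U n \<and>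
    (\<forall>v\<in>V. (\<exists>h\<in>H. \<not> el v h) \<longrightarrow> \<not> el v y)"
  using H
proof (induction H rule: finite_ne_induct)
  case (singleton h)
  then show ?case using N0 by (intro exI[of _ 2] exI[of _ h]) simp
next
  case (insert h H)
  obtain n y where y: "1 \<le> n" "n + 7 \<le> N0 ^ card H" "y \<in> set_power P U n"
    "\<forall>v\<in>V. (\<exists>h\<in>H. \<not> el v h) \<longrightarrow> \<not> el v y"
    using insert.IH insert.prems by blast
  have h: "h \<in> set_power P U 2" using insert.prems by simp
  obtain a b where ab: "1 \<le> a" "a \<le> N0" "1 \<le> b" "b \<le> 3 * N0"
    "\<forall>v\<in>V. \<not> el v h \<or> \<not> el v y \<longrightarrow> \<not> el v (h [^] (b::nat) \<otimes> y [^] (a::nat))"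
    using comb[OF set_power_carrier[OF U h] set_power_carrier[OF U y(3)]] by blast
  have "h [^] b \<otimes> y [^] a \<in> set_power P U (b * 2 + a * n)"
    by (intro set_power_mult[OF U] set_power_pow[OF U] h y(3))
  moreover have "b * 2 + a * n + 7 \<le> N0 ^ card (insert h H)"
  proof -
    have "a * n \<le> N0 * n" using ab(2) by simp
    moreover have "N0 * (n + 7) = N0 * n + 7 * N0" by (simp add: algebra_simps)
    ultimately have "b * 2 + a * n + 7 \<le> N0 * (n + 7)" using ab(4) N0 by linarith
    also have "\<dots> \<le> N0 * N0 ^ card H" using y(2) by (rule mult_le_mono2)
    finally show ?thesis using insert.hyps by simp
  qed
  moreover have "1 \<le> b * 2 + a * n" using ab(3) by simp
  moreover have "\<forall>v\<in>V. (\<exists>h\<in>insert h H. \<not> el v h) \<longrightarrow> \<not> el v (h [^] b \<otimes> y [^] a)"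
    using ab(5) y(4) by blast
  ultimately show ?case by blast
qed

text \<open>Serre's argument picks a generator of largest displacement, so an infinite
  \<open>U\<close> has to be cut down first.\<close>

lemma generate_finite_subset:
  assumes "x \<in> generate P U" shows "\<exists>U0. finite U0 \<and> U0 \<subseteq> U \<and> x \<in> generate P U0"
  using assms
proof (induction rule: generate.induct)
  case one
  have "\<one> \<in> generate P {}" by (rule generate.one)
  then show ?case by blast
next
  case (incl h)
  have "h \<in> generate P {h}" by (rule generate.incl) simp
  then show ?case using incl by (intro exI[of _ "{h}"]) blast
next
  case (inv h)
  have "inv h \<in> generate P {h}" by (rule generate.inv) simp
  then show ?case using inv by (intro exI[of _ "{h}"]) blast
next
  case (eng h1 h2)
  then obtain U1 U2 where U: "finite U1" "U1 \<subseteq> U" "h1 \<in> generate P U1"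
    "finite U2" "U2 \<subseteq> U" "h2 \<in> generate P U2"
    by blast
  have "h1 \<in> generate P (U1 \<union> U2)" "h2 \<in> generate P (U1 \<union> U2)"
    using mono_generate[of U1 "U1 \<union> U2"] mono_generate[of U2 "U1 \<union> U2"] U(3,6) by blast+
  then have "h1 \<otimes> h2 \<in> generate P (U1 \<union> U2)" by (rule generate.eng)
  moreover have "finite (U1 \<union> U2)" "U1 \<union> U2 \<subseteq> U" using U by simp_all
  ultimately show ?case by blast
qed

lemma generate_fixes:
  assumes v: "v \<in> V" and U: "U \<subseteq> carrier P" and p: "p \<in> T v" "\<And>u. u \<in> U \<Longrightarrow> act v u p = p"
    and x: "x \<in> generate P U"
  shows "x \<in> carrier P \<and> act v x p = p"
  using x
proof (induction rule: generate.induct)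
  case one
  then show ?case using act_one[OF v p(1)] by simp
next
  case (incl h)
  then show ?case using U p by blast
next
  case (inv h)
  then have h: "h \<in> carrier P" "act v h p = p" using U p by blast+
  then have "act v (inv h) p = act v (inv h) (act v h p)" by simp
  also have "\<dots> = act v (inv h \<otimes> h) p" using act_mult[OF v inv_closed[OF h(1)] h(1) p(1)] by simp
  also have "\<dots> = p" using act_one[OF v p(1)] h(1) by simp
  finally show ?case using h(1) by simp
next
  case (eng h1 h2)
  then show ?case using act_mult[OF v _ _ p(1)] by simp
qed

text \<open>If all products of two elements of \<open>U\<close> are elliptic, so are the elements
  themselves, having elliptic squares. \<open>serre_pair\<close>, applied with the generator that
  moves \<open>q\<close> farthest, gives a common fixed point of the finitely many generators that
  \<open>x\<close> needs.\<close>

lemma serre: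
  assumes v: "v \<in> V" and U: "U \<subseteq> carrier P" and x: "x \<in> generate P U" "\<not> el v x"
  shows "\<exists>h. h \<in> set_power P U 2 \<and> \<not> el v h"
proof (rule ccontr)
  assume "\<not> ?thesis"
  then have e: "el v h" if "h \<in> set_power P U 2" for h using that by blast
  interpret Tv: tree "T v" "d v" "col v" by (rule tree[OF v])
  obtain U0 where U0: "finite U0" "U0 \<subseteq> U" "x \<in> generate P U0"
    using generate_finite_subset[OF x(1)] by blast
  have U0P: "U0 \<subseteq> carrier P" using U0(2) U by blast
  obtain q where q: "q \<in> T v" using Tv.nonempty by blast
  have "\<exists>p\<in>T v. \<forall>u\<in>U0. act v u p = p"
  proof (cases "U0 = {}")
    case False
    define m where "m = Max ((\<lambda>u. d v q (act v u q)) ` U0)"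
    have "m \<in> (\<lambda>u. d v q (act v u q)) ` U0" unfolding m_def using U0(1) False by (intro Max_in) auto
    then obtain u where u: "u \<in> U0" "m = d v q (act v u q)" by blast
    have mx: "d v q (act v u' q) \<le> d v q (act v u q)" if "u' \<in> U0" for u'
      unfolding u(2)[symmetric] m_def using U0(1) that by (intro Max_ge) auto
    have uP: "u \<in> carrier P" and uU: "u \<in> U" using u(1) U0P U0(2) by blast+
    have au: "Tv.aut (act v u)" using act_aut[OF v uP] .
    have ell1: "Tv.ell (act v w)" if "w \<in> U" for w
      using e[OF set_power_two[OF U that that]] el_mult_self[OF v] that U unfolding el_def by blast
    obtain p where p: "p \<in> T v" "2 * d v q p = d v q (act v u q)" "2 * d v p (act v u q) = d v q (act v u q)"
      using Tv.midpoint_ex[OF au q] .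
    have "act v u' p = p" if u': "u' \<in> U0" for u'
    proof -
      have u'P: "u' \<in> carrier P" and u'U: "u' \<in> U" using u' U0P U0(2) by blast+
      have "el v (u' \<otimes> u)" using e[OF set_power_two[OF U u'U uU]] .
      then have "Tv.ell (act v u' \<circ> act v u)"
        using Tv.ell_cong[of "act v (u' \<otimes> u)" "act v u' \<circ> act v u"] act_mult[OF v u'P uP] unfolding el_def by simp
      then show ?thesis
        by (rule Tv.serre_pair[OF au ell1[OF uU] act_aut[OF v u'P] ell1[OF u'U] _ q mx[OF u'] p])
    qed
    then show ?thesis using p(1) by blast
  qed (use q in blast)
  then obtain p where "p \<in> T v" "\<And>u. u \<in> U0 \<Longrightarrow> act v u p = p" by blast
  then have "act v x p = p" "p \<in> T v" using generate_fixes[OF v U0P _ _ U0(3)] by blast+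
  then show False using x(2) unfolding el_def Tv.ell_def by blast
qed

text \<open>The set \<open>H\<close> of products to be combined has two possible sources, which give
  the two terms of the minimum: all products of two elements of \<open>U\<close>, or one loxodromic
  product for each vertex of \<open>L\<close>.\<close>

lemma uniform_element:
  assumes U: "U \<subseteq> carrier P" and N0: "11 \<le> N0"
    and comb: "\<And>f g. \<lbrakk>f \<in> carrier P; g \<in> carrier P\<rbrakk> \<Longrightarrow> \<exists>a b. 1 \<le> a \<and> a \<le> N0 \<and> 1 \<le> b \<and> b \<le> 3 * N0 \<and>
      (\<forall>v\<in>V. \<not> el v f \<or> \<not> el v g \<longrightarrow> \<not> el v (f [^] (b::nat) \<otimes> g [^] (a::nat)))"
    and x: "x \<in> generate P U" and L: "L \<subseteq> V" "L \<noteq> {}" "\<And>v. v \<in> L \<Longrightarrow> \<not> el v x"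
  shows "\<exists>n y. 1 \<le> n \<and> n \<le> N0 ^ (if finite U then min (card U ^ 2) (card V) else card V) \<and>
    y \<in> set_power P U n \<and> (\<forall>v\<in>L. \<not> el v y)"
proof -
  let ?k = "if finite U then min (card U ^ 2) (card V) else card V"
  have "\<exists>h. h \<in> set_power P U 2 \<and> \<not> el v h" if v: "v \<in> L" for v
    using serre[OF _ U x L(3)[OF v]] L(1) v by blast
  then obtain h where h: "\<And>v. v \<in> L \<Longrightarrow> h v \<in> set_power P U 2 \<and> \<not> el v (h v)" by metis
  have "\<exists>H. finite H \<and> H \<noteq> {} \<and> H \<subseteq> set_power P U 2 \<and> card H \<le> ?k \<and> (\<forall>v\<in>L. \<exists>h\<in>H. \<not> el v h)"
  proof (cases "finite U \<and> card U ^ 2 < card V")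
    case True
    let ?H = "(\<lambda>(u, w). u \<otimes> w) ` (U \<times> U)"
    have p2: "set_power P U 2 \<subseteq> ?H"
    proof
      fix z assume "z \<in> set_power P U 2"
      then obtain xs where xs: "z = foldr (\<lambda>x y. x \<otimes> y) xs \<one>" "length xs = 2" "set xs \<subseteq> U"
        unfolding set_power_def by blast
      then obtain u w where "xs = [u, w]" by (metis One_nat_def Suc_1 length_0_conv length_Suc_conv)
      moreover from this have "u \<in> U" "w \<in> U" using xs(3) by auto
      moreover from this have "w \<in> carrier P" using U by blast
      ultimately show "z \<in> ?H" using xs(1) by force
    qed
    have "?H \<subseteq> set_power P U 2" using set_power_two[OF U] by auto
    moreover have "card ?H \<le> ?k"
    proof -
      have "card ?H \<le> card (U \<times> U)" using True by (intro card_image_le) auto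
      then show ?thesis using True by (simp add: card_cartesian_product power2_eq_square)
    qed
    moreover have "\<forall>v\<in>L. \<exists>h\<in>?H. \<not> el v h" using h p2 by blast
    moreover have "?H \<noteq> {}" using h p2 L(2) by blast
    moreover have "finite ?H" using True by auto
    ultimately show ?thesis by blast
  next
    case False
    have fL: "finite L" using L(1) finite_V finite_subset by blast
    have "card (h ` L) \<le> card L" using fL by (rule card_image_le)
    also have "\<dots> \<le> card V" using L(1) finite_V by (rule card_mono[rotated])
    finally have "card (h ` L) \<le> ?k" using False by auto
    then show ?thesis using h fL L(2) by (intro exI[of _ "h ` L"]) blast
  qed
  then obtain H where H: "finite H" "H \<noteq> {}" "H \<subseteq> set_power P U 2" "card H \<le> ?k" "\<forall>v\<in>L. \<exists>h\<in>H. \<not> el v h"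
    by blast
  obtain n y where y: "1 \<le> n" "n + 7 \<le> N0 ^ card H" "y \<in> set_power P U n"
    "\<forall>v\<in>V. (\<exists>h\<in>H. \<not> el v h) \<longrightarrow> \<not> el v y"
    using cover_by_products[OF U N0 comb H(1-3)] by blast
  have "N0 ^ card H \<le> N0 ^ ?k" using H(4) N0 by (intro power_increasing) auto
  then have "n \<le> N0 ^ ?k" using y(2) by linarith
  then show ?thesis using y H(5) L(1) by blast
qed

end

section \<open>Square roots\<close>

context group begin

lemma conj_mult:
  assumes "t \<in> carrier G" "x \<in> carrier G" "y \<in> carrier G"
  shows "(inv t \<otimes> x \<otimes> t) \<otimes> (inv t \<otimes> y \<otimes> t) = inv t \<otimes> (x \<otimes> y) \<otimes> t"
proof -
  have "t \<otimes> (inv t \<otimes> y \<otimes> t) = y \<otimes> t" using assms by (simp add: m_assoc[symmetric])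
  then show ?thesis using assms by (simp add: m_assoc)
qed

end

context graph_tree begin

text \<open>If \<open>q\<close> moves the base vertex to \<open>x\<close> while its square fixes it,
  \<open>q\<close> swaps the two and fixes their midpoint \<open>z\<close>. It moves the neighbour
  \<open>y\<close> of \<open>z\<close>, which its square fixes. After conjugation \<open>y\<close>
  and \<open>z\<close> span the base edge. If \<open>z\<close> is a coset of the star, the
  \<open>G v\<close>-component of \<open>q\<close> has order two; otherwise the conjugate of
  \<open>q\<close> has no \<open>v\<close> and contradicts \<open>IH\<close>.\<close>

lemma square_fixes_Nil:
  assumes L: "L \<subseteq> V" "v \<in> L"
    and no2: "\<And>s. s \<in> carrier (G v) \<Longrightarrow> s \<otimes>\<^bsub>G v\<^esub> s = \<one>\<^bsub>G v\<^esub> \<Longrightarrow> s = \<one>\<^bsub>G v\<^esub>"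
    and IH: "\<And>q. q \<in> par (L - {v}) \<Longrightarrow> q \<otimes>\<^bsub>P\<^esub> q \<in> par lk \<Longrightarrow> q \<in> par lk"
    and q: "q \<in> par L" "q \<otimes>\<^bsub>P\<^esub> q \<in> par (V - {v})"
  shows "q \<in> par (V - {v})"
proof (rule ccontr)
  assume contra: "q \<notin> par (V - {v})"
  have qP: "q \<in> carrier P" using q(1) by (rule par_carrier)
  have qq: "q \<otimes>\<^bsub>P\<^esub> q \<in> carrier P" using qP by simp
  have aq: "T.aut (act q)" using act_aut[OF qP] .
  define x where "x = act q []"
  have x: "x \<in> TT L"
  proof -
    obtain w where w: "w \<in> W" "q = cls w" "fst ` set w \<subseteq> L" using q(1) unfolding par_def by blast
    then show ?thesis unfolding x_def using act_cls[OF w(1) Nil_T] actw_closed[OF w(1,3) Nil_T] by simp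
  qed
  have xV: "x \<in> TT V" unfolding x_def by (rule act_closed[OF qP Nil_T])
  have qx: "act q x = []" unfolding x_def using act_mult[OF qP qP Nil_T] par_fixes_Nil[OF q(2)] by simp
  have "x \<noteq> []" using contra stab_Nil[OF qP] unfolding x_def by blast
  moreover have "even (length x)" using T.parity[OF Nil_T xV] T.aut_even[OF aq Nil_T] unfolding x_def by simp
  ultimately obtain k where k: "length x = 2 * Suc k"
    by (metis evenE length_0_conv mult_0_right not0_implies_Suc)
  define y where "y = take k x"
  define z where "z = take (Suc k) x"
  have zy: "z = y @ [x ! k]" unfolding y_def z_def using k by (simp add: take_Suc_conv_app_nth)
  have zL: "z \<in> TT L" unfolding z_def TT_def using red_take x TT_def by simp
  have yV: "y \<in> TT V" and zV: "z \<in> TT V" unfolding z_def y_def TT_def using red_take xV TT_def by simp_all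
  have dist: "ldist [] x = 2 * (int k + 1)" "ldist [] y = int k" "ldist y x = int k + 2"
    "ldist [] z = int k + 1" "ldist z x = int k + 1"
    using k by (simp_all add: ldist_def y_def z_def lcp_takeL)
  have fz: "act q z = z"
    by (rule T.midpoint_fixed[OF aq Nil_T _ zV]) (use dist qx x_def in simp_all)
  have fy: "act (q \<otimes>\<^bsub>P\<^esub> q) y = y"
  proof (rule T.between_unique[OF Nil_T xV _ yV])
    have qqN: "act (q \<otimes>\<^bsub>P\<^esub> q) [] = []" using par_fixes_Nil[OF q(2)] .
    have qqx: "act (q \<otimes>\<^bsub>P\<^esub> q) x = x" using act_mult[OF qP qP xV] qx x_def by simp
    have 1: "ldist [] (act (q \<otimes>\<^bsub>P\<^esub> q) y) = ldist [] y"
      using T.aut_d[OF act_aut[OF qq] Nil_T yV] qqN by simp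
    have 2: "ldist (act (q \<otimes>\<^bsub>P\<^esub> q) y) x = ldist y x"
      using T.aut_d[OF act_aut[OF qq] yV xV] qqx by simp
    show "ldist [] (act (q \<otimes>\<^bsub>P\<^esub> q) y) + ldist (act (q \<otimes>\<^bsub>P\<^esub> q) y) x = ldist [] x"
      "ldist [] y = ldist [] (act (q \<otimes>\<^bsub>P\<^esub> q) y)" "ldist y x = ldist (act (q \<otimes>\<^bsub>P\<^esub> q) y) x"
      unfolding 1 2 using dist by simp_all
    show "act (q \<otimes>\<^bsub>P\<^esub> q) y \<in> TT V" using act_closed[OF qq yV] .
  qed
  have nfy: "act q y \<noteq> y"
  proof
    assume "act q y = y"
    then have "ldist x y = ldist [] y" using T.aut_d[OF aq Nil_T yV] unfolding x_def by simp
    then show False using dist T.d_sym[OF xV yV] by simp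
  qed
  have red: "red (idx L) None (y @ [x ! k])" using TT_red[OF zL] unfolding zy .
  have conj: "act (inv\<^bsub>P\<^esub> t \<otimes>\<^bsub>P\<^esub> q \<otimes>\<^bsub>P\<^esub> t) p = p \<longleftrightarrow> act q (act t p) = act t p"
    if "t \<in> carrier P" "p \<in> TT V" for t p
  proof
    assume a: "act (inv\<^bsub>P\<^esub> t \<otimes>\<^bsub>P\<^esub> q \<otimes>\<^bsub>P\<^esub> t) p = p"
    have "t \<otimes>\<^bsub>P\<^esub> (inv\<^bsub>P\<^esub> t \<otimes>\<^bsub>P\<^esub> q \<otimes>\<^bsub>P\<^esub> t) = q \<otimes>\<^bsub>P\<^esub> t"
      using that(1) qP by (simp add: P.m_assoc[symmetric])
    then have "act t (act (inv\<^bsub>P\<^esub> t \<otimes>\<^bsub>P\<^esub> q \<otimes>\<^bsub>P\<^esub> t) p) = act q (act t p)"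
      using act_mult[OF that(1) _ that(2), of "inv\<^bsub>P\<^esub> t \<otimes>\<^bsub>P\<^esub> q \<otimes>\<^bsub>P\<^esub> t"] act_mult[OF qP that] that(1) qP by simp
    then show "act q (act t p) = act t p" using a by simp
  qed (rule act_conj_fix[OF qP that])
  show False
  proof (cases "even k")
    case True
    then have "even (length y)" using k by (simp add: y_def)
    then obtain t where t: "t \<in> par L" "act t [] = y" "act t [Inl i0] = z"
      using edge_orbit(1)[OF red L] zy by auto
    have tP: "t \<in> carrier P" using t(1) by (rule par_carrier)
    let ?r = "inv\<^bsub>P\<^esub> t \<otimes>\<^bsub>P\<^esub> q \<otimes>\<^bsub>P\<^esub> t"
    have rP: "?r \<in> carrier P" using tP qP by simp
    have r0: "act ?r [Inl i0] = [Inl i0]" using conj[OF tP i0_T] t(3) fz by simp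
    have rN: "act ?r [] \<noteq> []" using conj[OF tP Nil_T] t(2) nfy by simp
    have rr: "act (?r \<otimes>\<^bsub>P\<^esub> ?r) [] = []"
      unfolding P.conj_mult[OF tP qP qP] using act_conj_fix[OF qq tP Nil_T] t(2) fy by simp
    obtain s c where s: "s \<in> carrier (G v)" "c \<in> par lk" "?r = cls [(v, s)] \<otimes>\<^bsub>P\<^esub> c"
      using stab_star[OF rP r0] .
    have cP: "c \<in> carrier P" using s(2) by (rule par_carrier)
    have sP: "cls [(v, s)] \<in> carrier P" using letter_v[OF s(1)] by simp
    have act_r: "act ?r x = smul s (act c x)" if "x \<in> TT V" for x
      unfolding s(3) using act_mult[OF sP cP that] act_letter[OF s(1) act_closed[OF cP that]] by simp
    have rN': "act ?r [] = join s []" using act_r[OF Nil_T] lk_fixes(1)[OF s(2)] by simp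
    have "act (?r \<otimes>\<^bsub>P\<^esub> ?r) [] = smul s (act c (join s []))"
      using act_mult[OF rP rP Nil_T] act_r[OF act_closed[OF rP Nil_T]] rN' by simp
    also have "act c (join s []) = join s []"
    proof -
      have j: "join s [] \<in> TT V" using act_closed[OF rP Nil_T] rN' by simp
      have "act c (join s []) = imap c (join s [])" using act_par[OF _ j] s(2) lk_sub by blast
      moreover have "c <#\<^bsub>P\<^esub> i0 = i0" using coset_i0_iff[OF cP] s(2) by blast
      ultimately show ?thesis by (simp add: join_def)
    qed
    also have "smul s (join s []) = join (s \<otimes>\<^bsub>G v\<^esub> s) []"
      by (rule smul_join[OF s(1) s(1), of UNIV]) simp
    finally have "join (s \<otimes>\<^bsub>G v\<^esub> s) [] = []" using rr by simp
    then have "s \<otimes>\<^bsub>G v\<^esub> s = \<one>\<^bsub>G v\<^esub>" by (simp add: join_def split: if_splits)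
    then have "s = \<one>\<^bsub>G v\<^esub>" using no2[OF s(1)] by blast
    then show False using rN rN' by (simp add: join_def)
  next
    case False
    then have "odd (length y)" using k by (simp add: y_def)
    then obtain t where t: "t \<in> par L" "act t [Inl i0] = y" "act t [] = z"
      using edge_orbit(2)[OF red L] zy by auto
    have tP: "t \<in> carrier P" using t(1) by (rule par_carrier)
    let ?r = "inv\<^bsub>P\<^esub> t \<otimes>\<^bsub>P\<^esub> q \<otimes>\<^bsub>P\<^esub> t"
    have rP: "?r \<in> carrier P" using tP qP by simp
    have rN: "act ?r [] = []" using conj[OF tP Nil_T] t(3) fz by simp
    have r0: "act ?r [Inl i0] \<noteq> [Inl i0]" using conj[OF tP i0_T] t(2) nfy by simp
    have rV: "?r \<in> par (V - {v})" using stab_Nil[OF rP rN] .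
    have "?r \<in> par L" using par_mult par_inv t(1) q(1) by blast
    then have "?r \<in> par (L \<inter> (V - {v}))" using rV by (rule par_inter)
    then have rL: "?r \<in> par (L - {v})" using par_mono[of "L \<inter> (V - {v})" "L - {v}"] by blast
    have "?r \<otimes>\<^bsub>P\<^esub> ?r \<in> par lk"
    proof (rule stab_edge)
      show "?r \<otimes>\<^bsub>P\<^esub> ?r \<in> carrier P" using rP by simp
      show "act (?r \<otimes>\<^bsub>P\<^esub> ?r) [] = []" using act_mult[OF rP rP Nil_T] rN by simp
      show "act (?r \<otimes>\<^bsub>P\<^esub> ?r) [Inl i0] = [Inl i0]"
        unfolding P.conj_mult[OF tP qP qP] using act_conj_fix[OF qq tP i0_T] t(2) fy by simp
    qed
    then have "?r \<in> par lk" using IH rL by blast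
    then show False using lk_fixes(2) r0 by blast
  qed
qed

text \<open>Vertices of even length are translates of the base vertex, so their stabilizers are
  conjugates of \<open>par (V - {v})\<close> and inherit closure under square roots.\<close>

lemma no_involution:
  assumes root: "\<And>q. q \<in> carrier P \<Longrightarrow> q \<otimes>\<^bsub>P\<^esub> q \<in> par (V - {v}) \<Longrightarrow> q \<in> par (V - {v})"
    and z: "z \<in> carrier P" and p: "p \<in> TT V" "even (length p)" "act z (act z p) = p"
  shows "act z p = p"
proof -
  have "\<exists>t\<in>carrier P. act t [] = p"
  proof (cases p rule: rev_cases)
    case Nil
    then show ?thesis using act_one[OF Nil_T] by (intro bexI[of _ "\<one>\<^bsub>P\<^esub>"]) simp_all
  next
    case (snoc y e)
    then have "odd (length y)" "red (idx V) None (y @ [e])" using p TT_red by auto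
    then show ?thesis using edge_orbit(2)[OF _ subset_refl vV] par_carrier snoc by blast
  qed
  then obtain t where t: "t \<in> carrier P" "act t [] = p" by blast
  let ?q = "inv\<^bsub>P\<^esub> t \<otimes>\<^bsub>P\<^esub> z \<otimes>\<^bsub>P\<^esub> t"
  have qP: "?q \<in> carrier P" using t(1) z by simp
  have zz: "z \<otimes>\<^bsub>P\<^esub> z \<in> carrier P" using z by simp
  have "act (?q \<otimes>\<^bsub>P\<^esub> ?q) [] = []"
    unfolding P.conj_mult[OF t(1) z z]
    by (rule act_conj_fix[OF zz t(1) Nil_T]) (use act_mult[OF z z p(1)] p(3) t(2) in simp)
  then have "?q \<otimes>\<^bsub>P\<^esub> ?q \<in> par (V - {v})" using stab_Nil qP by simp
  then have "act ?q [] = []" using root[OF qP] par_fixes_Nil by blast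
  moreover have "t \<otimes>\<^bsub>P\<^esub> ?q = z \<otimes>\<^bsub>P\<^esub> t"
    using t(1) z by (simp add: P.m_assoc[symmetric])
  ultimately show ?thesis
    using act_mult[OF t(1) qP Nil_T] act_mult[OF z t(1) Nil_T] t(2) by simp
qed

end

context graph_group begin

text \<open>One shortest word for \<open>q\<close> serves all \<open>u\<close> at once: by
  \<open>shortest_word_par\<close> it avoids every vertex outside \<open>D\<close>.\<close>

lemma par_from_deletions:
  assumes q: "q \<in> carrier P" and all: "\<And>u. u \<in> V \<Longrightarrow> u \<notin> D \<Longrightarrow> q \<in> par (V - {u})"
  shows "q \<in> par D"
proof -
  obtain w0 where w0: "w0 \<in> W \<and> cls w0 = q" using carrierE[OF q] by blast
  obtain w where w: "w \<in> W \<and> cls w = q" "\<And>w'. w' \<in> W \<and> cls w' = q \<Longrightarrow> length w \<le> length w'"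
    using ex_has_least_nat[of "\<lambda>w. w \<in> W \<and> cls w = q" w0 length, OF w0] by blast
  have "fst ` set w \<subseteq> V - {u}" if "u \<in> V" "u \<notin> D" for u
    using shortest_word_par[of w "V - {u}"] all[OF that] w by blast
  moreover have "fst ` set w \<subseteq> V" using w(1) unfolding gp_words_def by auto
  ultimately have "fst ` set w \<subseteq> D" by blast
  then show ?thesis using cls_par w(1) by blast
qed

text \<open>\<open>D\<close> is arbitrary in the induction on \<open>L\<close>, because the link of
  a deleted vertex takes its place in the step.\<close>

lemma square_root_par:
  assumes no2: "\<And>u s. u \<in> V \<Longrightarrow> s \<in> carrier (G u) \<Longrightarrow> s \<otimes>\<^bsub>G u\<^esub> s = \<one>\<^bsub>G u\<^esub> \<Longrightarrow> s = \<one>\<^bsub>G u\<^esub>"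
    and fin: "finite L"
  shows "\<lbrakk>L \<subseteq> V; q \<in> par L; q \<otimes>\<^bsub>P\<^esub> q \<in> par D\<rbrakk> \<Longrightarrow> q \<in> par D"
  using fin
proof (induction L arbitrary: q D rule: finite_psubset_induct)
  case (psubset L)
  have qP: "q \<in> carrier P" using psubset.prems(2) by (rule par_carrier)
  show ?case
  proof (rule par_from_deletions[OF qP])
    fix u assume u: "u \<in> V" "u \<notin> D"
    interpret gt: graph_tree V E G u by unfold_locales (rule u(1))
    show "q \<in> par (V - {u})"
    proof (cases "u \<in> L")
      case False
      then show ?thesis using psubset.prems(1,2) par_mono[of L "V - {u}"] by blast
    next
      case True
      show ?thesis
      proof (rule gt.square_fixes_Nil[OF psubset.prems(1) True no2[OF u(1)] _ psubset.prems(2)])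
        fix r assume r: "r \<in> par (L - {u})" "r \<otimes>\<^bsub>P\<^esub> r \<in> par {w \<in> V. E u w}"
        show "r \<in> par {w \<in> V. E u w}"
          by (rule psubset.IH[OF _ _ r]) (use True psubset.prems(1) in blast)+
      next
        have "q \<otimes>\<^bsub>P\<^esub> q \<in> par (D \<inter> V)" using gt.par_labels[OF psubset.prems(3)] .
        then show "q \<otimes>\<^bsub>P\<^esub> q \<in> par (V - {u})" using par_mono[of "D \<inter> V" "V - {u}"] u by blast
      qed
    qed
  qed
qed

end

section \<open>Loxodromic elements\<close>

context group begin

lemma conj_conj:
  assumes "a \<in> carrier G" "b \<in> carrier G" "x \<in> carrier G"
  shows "inv b \<otimes> (inv a \<otimes> x \<otimes> a) \<otimes> b = inv (a \<otimes> b) \<otimes> x \<otimes> (a \<otimes> b)"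
  using assms by (simp add: inv_mult_group m_assoc)

lemma conj_pow:
  assumes "t \<in> carrier G" "x \<in> carrier G"
  shows "(inv t \<otimes> x \<otimes> t) [^] (n::nat) = inv t \<otimes> x [^] n \<otimes> t"
proof (induction n)
  case 0
  then show ?case using assms by simp
next
  case (Suc n)
  then show ?case using conj_mult[OF assms(1) nat_pow_closed[OF assms(2)] assms(2)] by simp
qed

lemma conj_intoI:
  assumes "t \<in> carrier G" "x \<in> carrier G" "inv t \<otimes> x \<otimes> t \<in> S" shows "conj_into G x S"
  unfolding conj_into_def using assms by (intro bexI[of _ "inv t"]) simp_all

lemma conj_intoE:
  assumes "conj_into G x S" obtains t where "t \<in> carrier G" "inv t \<otimes> x \<otimes> t \<in> S"
proof -
  obtain h where "h \<in> carrier G" "h \<otimes> x \<otimes> inv h \<in> S" using assms unfolding conj_into_def by blast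
  then show ?thesis using that[of "inv h"] by simp
qed

end

context graph_tree begin

lemma ell_conj:
  assumes "t \<in> carrier P" "z \<in> carrier P" "T.ell (act (inv\<^bsub>P\<^esub> t \<otimes>\<^bsub>P\<^esub> z \<otimes>\<^bsub>P\<^esub> t))"
  shows "T.ell (act z)"
proof -
  let ?q = "inv\<^bsub>P\<^esub> t \<otimes>\<^bsub>P\<^esub> z \<otimes>\<^bsub>P\<^esub> t"
  obtain p where p: "p \<in> TT V" "act ?q p = p" using assms(3) unfolding T.ell_def by blast
  have qP: "?q \<in> carrier P" using assms by simp
  have "t \<otimes>\<^bsub>P\<^esub> ?q = z \<otimes>\<^bsub>P\<^esub> t" using assms(1,2) by (simp add: P.m_assoc[symmetric])
  then have "act z (act t p) = act t p"
    using act_mult[OF assms(1) qP p(1)] act_mult[OF assms(2,1) p(1)] p(2) by simp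
  then show ?thesis using act_closed[OF assms(1) p(1)] unfolding T.ell_def by blast
qed

lemma ell_par:
  assumes "x \<in> par D" "v \<notin> D \<or> D \<subseteq> insert v lk" shows "T.ell (act x)"
proof (cases "v \<in> D")
  case False
  have "D \<inter> V \<subseteq> V - {v}" using False by blast
  then have "x \<in> par (V - {v})" using par_labels[OF assms(1)] par_mono by blast
  then show ?thesis using par_fixes_Nil Nil_T unfolding T.ell_def by blast
next
  case True
  then have "x \<in> par (insert v lk)" using assms par_mono by blast
  then show ?thesis using star_fixes i0_T unfolding T.ell_def by blast
qed

lemma letter_inj:
  assumes "s \<in> carrier (G v)" "t \<in> carrier (G v)" "cls [(v, s)] = cls [(v, t)]" shows "s = t"
proof -
  have "smul s [] = smul t []" using assms act_letter[OF _ Nil_T] by metis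
  then show ?thesis by (simp add: join_def split: if_splits)
qed

end

section \<open>Words of minimal length in a conjugacy class\<close>

context graph_group begin

lemma graph_treeI: "v \<in> V \<Longrightarrow> graph_tree V E G v"
  by unfold_locales

definition conj_min :: "('v \<times> 'a) list \<Rightarrow> bool" where
  "conj_min w \<longleftrightarrow> w \<in> W \<and> (\<forall>w'\<in>W. \<forall>t\<in>carrier P.
     cls w' = inv\<^bsub>P\<^esub> t \<otimes>\<^bsub>P\<^esub> cls w \<otimes>\<^bsub>P\<^esub> t \<longrightarrow> length w \<le> length w')"

lemma conj_min_words: "conj_min w \<Longrightarrow> w \<in> W"
  by (simp add: conj_min_def)

lemma conj_min_le:
  assumes "conj_min w" "w' \<in> W" "cls w' = cls w" shows "length w \<le> length w'"
proof -
  have "cls w' = inv\<^bsub>P\<^esub> \<one>\<^bsub>P\<^esub> \<otimes>\<^bsub>P\<^esub> cls w \<otimes>\<^bsub>P\<^esub> \<one>\<^bsub>P\<^esub>"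
    using assms(3) conj_min_words[OF assms(1)] by simp
  then show ?thesis using assms(1,2) P.one_closed unfolding conj_min_def by blast
qed

lemma ex_conj_min:
  assumes x: "x \<in> carrier P"
  obtains w t where "conj_min w" "t \<in> carrier P" "cls w = inv\<^bsub>P\<^esub> t \<otimes>\<^bsub>P\<^esub> x \<otimes>\<^bsub>P\<^esub> t"
proof -
  let ?Q = "\<lambda>w. w \<in> W \<and> (\<exists>t\<in>carrier P. cls w = inv\<^bsub>P\<^esub> t \<otimes>\<^bsub>P\<^esub> x \<otimes>\<^bsub>P\<^esub> t)"
  obtain w0 where "w0 \<in> W" "x = cls w0" using x by (rule carrierE)
  then have "?Q w0" by (intro conjI bexI[of _ "\<one>\<^bsub>P\<^esub>"]) simp_all
  then obtain w where w: "?Q w" "\<And>w'. ?Q w' \<Longrightarrow> length w \<le> length w'"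
    using ex_has_least_nat[of ?Q w0 length] by blast
  obtain t where t: "t \<in> carrier P" "cls w = inv\<^bsub>P\<^esub> t \<otimes>\<^bsub>P\<^esub> x \<otimes>\<^bsub>P\<^esub> t" using w(1) by blast
  have "length w \<le> length w'"
    if w': "w' \<in> W" "s \<in> carrier P" "cls w' = inv\<^bsub>P\<^esub> s \<otimes>\<^bsub>P\<^esub> cls w \<otimes>\<^bsub>P\<^esub> s" for w' s
  proof (rule w(2))
    have "cls w' = inv\<^bsub>P\<^esub> (t \<otimes>\<^bsub>P\<^esub> s) \<otimes>\<^bsub>P\<^esub> x \<otimes>\<^bsub>P\<^esub> (t \<otimes>\<^bsub>P\<^esub> s)"
      unfolding w'(3) t(2) by (rule P.conj_conj[OF t(1) w'(2) x])
    then show "?Q w'" using w'(1) P.m_closed[OF t(1) w'(2)] by blast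
  qed
  then have "conj_min w" using w(1) unfolding conj_min_def by blast
  then show ?thesis using that t by blast
qed

lemma conj_min_rotate:
  assumes m: "conj_min (a @ b)" shows "conj_min (b @ a)"
    and "cls (b @ a) = inv\<^bsub>P\<^esub> (cls a) \<otimes>\<^bsub>P\<^esub> cls (a @ b) \<otimes>\<^bsub>P\<^esub> cls a"
proof -
  have ab: "a \<in> W" "b \<in> W" using conj_min_words[OF m] by simp_all
  have ca: "cls a \<in> carrier P" "cls b \<in> carrier P" "cls (a @ b) \<in> carrier P" using ab by simp_all
  show 1: "cls (b @ a) = inv\<^bsub>P\<^esub> (cls a) \<otimes>\<^bsub>P\<^esub> cls (a @ b) \<otimes>\<^bsub>P\<^esub> cls a"
    using ca(1,2) by (simp add: mult_cls[symmetric] ab P.m_assoc[symmetric])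
  have "length (b @ a) \<le> length w'"
    if w': "w' \<in> W" "s \<in> carrier P" "cls w' = inv\<^bsub>P\<^esub> s \<otimes>\<^bsub>P\<^esub> cls (b @ a) \<otimes>\<^bsub>P\<^esub> s" for w' s
  proof -
    have "cls w' = inv\<^bsub>P\<^esub> (cls a \<otimes>\<^bsub>P\<^esub> s) \<otimes>\<^bsub>P\<^esub> cls (a @ b) \<otimes>\<^bsub>P\<^esub> (cls a \<otimes>\<^bsub>P\<^esub> s)"
      unfolding w'(3) 1 by (rule P.conj_conj[OF ca(1) w'(2) ca(3)])
    then have "length (a @ b) \<le> length w'" using m w'(1) P.m_closed[OF ca(1) w'(2)] unfolding conj_min_def by blast
    then show ?thesis by simp
  qed
  then show "conj_min (b @ a)" using ab unfolding conj_min_def by simp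
qed

end

context graph_tree begin

lemma ex_blocks:
  "\<exists>B bs. w = B @ blocks bs \<and> v \<notin> fst ` set B \<and> (\<forall>q\<in>set bs. v \<notin> fst ` set (snd q))"
proof (induction w)
  case Nil
  show ?case by (intro exI[of _ "[]"]) (simp add: blocks_def)
next
  case (Cons p w)
  then obtain B bs where B: "w = B @ blocks bs" "v \<notin> fst ` set B" "\<forall>q\<in>set bs. v \<notin> fst ` set (snd q)"
    by blast
  obtain u s where p: "p = (u, s)" by force
  show ?case
  proof (cases "u = v")
    case True
    then show ?thesis using B p
      by (intro exI[of _ "[]"] exI[of _ "(s, B) # bs"]) (simp add: blocks_def)
  next
    case False
    then show ?thesis using B p by (intro exI[of _ "p # B"] exI[of _ bs]) auto
  qed
qed

lemma blocks_append: "blocks (a @ b) = blocks a @ blocks b"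
  by (simp add: blocks_def)

lemma blocks_Cons: "blocks ((s, B) # b) = (v, s) # B @ blocks b"
  by (simp add: blocks_def)

text \<open>After a rotation the block stands in front. A trivial letter could be deleted. If
  \<open>B\<close> lay in the link, the letter could be moved across \<open>B\<close> and merged
  with the next letter of \<open>v\<close>; if there is no other one, the whole word lies in the
  star.\<close>

lemma conj_min_block:
  assumes m: "conj_min (blocks (p @ (s, B) # q))" and vB: "v \<notin> fst ` set B"
    and L: "\<not> fst ` set (blocks (p @ (s, B) # q)) \<subseteq> insert v lk"
  shows "good_block (s, B)"
proof -
  let ?C = "blocks (q @ p)"
  have eq: "blocks (p @ (s, B) # q) = blocks p @ ((v, s) # B @ blocks q)"
    by (simp add: blocks_append blocks_Cons)
  have m': "conj_min ((v, s) # B @ ?C)"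
    using conj_min_rotate(1)[of "blocks p" "(v, s) # B @ blocks q"] m unfolding eq by (simp add: blocks_append)
  have W: "s \<in> carrier (G v)" "B \<in> W" "?C \<in> W" using conj_min_words[OF m'] by simp_all
  have "s \<noteq> \<one>\<^bsub>G v\<^esub>"
  proof
    assume "s = \<one>\<^bsub>G v\<^esub>"
    then have "cls ((v, s) # B @ ?C) = cls (B @ ?C)" using cls_drop[of "[]" "B @ ?C" v] W vV by simp
    then show False using conj_min_le[OF m', of "B @ ?C"] W by simp
  qed
  moreover have "cls B \<notin> par lk"
  proof
    assume "cls B \<in> par lk"
    then have lB: "fst ` set B \<subseteq> lk"
    proof (rule shortest_word_par[OF W(2)])
      fix B' assume B': "B' \<in> W" "cls B' = cls B"
      have "cls ([(v, s)] @ B' @ ?C) = cls ([(v, s)] @ B @ ?C)"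
        using B' W letter_v[OF W(1)] mult_cls[symmetric, of "[(v, s)]" "B' @ ?C"]
          mult_cls[symmetric, of "[(v, s)]" "B @ ?C"] mult_cls[symmetric, of B' ?C] mult_cls[symmetric, of B ?C]
        by simp
      then show "length B \<le> length B'"
        using conj_min_le[OF m', of "(v, s) # B' @ ?C"] B' W vV by simp
    qed
    show False
    proof (cases "q @ p")
      case Nil
      then show False using L lB subset_insertI2[OF lB, of v] by (simp add: blocks_def)
    next
      case (Cons r rs)
      obtain s' B' where r: "r = (s', B')" by force
      have C: "?C = (v, s') # B' @ blocks rs" unfolding Cons r by (rule blocks_Cons)
      have W': "s' \<in> carrier (G v)" "B' \<in> W" "blocks rs \<in> W" using W(3) unfolding C by simp_all
      have "cls ((v, s) # B) = cls (B @ [(v, s)])"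
        by (rule letter_commute[OF vV W(1,2)]) (use lB in auto)
      then have "cls (((v, s) # B) @ ?C) = cls ((B @ [(v, s)]) @ ?C)"
        using mult_cls[symmetric, of "(v, s) # B" ?C] mult_cls[symmetric, of "B @ [(v, s)]" ?C] W vV by simp
      also have "\<dots> = cls (B @ (v, s) # (v, s') # B' @ blocks rs)" unfolding C by simp
      also have "\<dots> = cls (B @ (v, s \<otimes>\<^bsub>G v\<^esub> s') # B' @ blocks rs)"
        by (rule cls_merge) (use W W' vV in simp_all)
      finally show False
        using conj_min_le[OF m', of "B @ (v, s \<otimes>\<^bsub>G v\<^esub> s') # B' @ blocks rs"] W W' vV C by simp
    qed
  qed
  ultimately show ?thesis using W vB by (simp add: good_block_def)
qed

text \<open>Rotating the part before the first letter of \<open>v\<close> to the end turns the word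
  into good blocks, up to conjugation.\<close>

lemma conj_min_not_ell:
  assumes m: "conj_min w" and v: "v \<in> fst ` set w" and L: "\<not> fst ` set w \<subseteq> insert v lk"
  shows "\<not> T.ell (act (cls w))"
proof
  assume e: "T.ell (act (cls w))"
  obtain B bs where B: "w = B @ blocks bs" "v \<notin> fst ` set B" "\<forall>q\<in>set bs. v \<notin> fst ` set (snd q)"
    using ex_blocks by blast
  have "bs \<noteq> []" using v B(1,2) by (auto simp: blocks_def)
  then obtain bs' s B0 where bs': "bs = bs' @ [(s, B0)]" by (metis rev_exhaust surj_pair)
  let ?bs = "bs' @ [(s, B0 @ B)]"
  have eq: "blocks ?bs = blocks bs @ B" by (simp add: bs' blocks_append blocks_Cons blocks_def)
  have W: "B \<in> W" "blocks bs \<in> W" using conj_min_words[OF m] B(1) by simp_all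
  have m': "conj_min (blocks ?bs)" unfolding eq using conj_min_rotate(1) m B(1) by blast
  have L': "\<not> fst ` set (blocks ?bs) \<subseteq> insert v lk" unfolding eq using L B(1) by auto
  have vb: "v \<notin> fst ` set (snd q)" if "q \<in> set ?bs" for q
  proof (cases "q = (s, B0 @ B)")
    case True
    then show ?thesis using B(2,3) bs' by (simp add: image_Un)
  next
    case False
    then show ?thesis using that B(3) bs' by simp
  qed
  have good: "good_block q" if q: "q \<in> set ?bs" for q
  proof -
    obtain s' B' where q': "q = (s', B')" by force
    obtain p r where pr: "?bs = p @ (s', B') # r" using split_list[OF q[unfolded q']] by blast
    have "v \<notin> fst ` set B'" using vb[OF q] q' by simp
    then show ?thesis unfolding q' by (rule conj_min_block[OF m'[unfolded pr] _ L'[unfolded pr]])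
  qed
  have "\<not> T.ell (act (cls (blocks ?bs)))" by (rule blocks_not_ell[OF _ good]) simp
  moreover have "T.ell (act (cls (blocks ?bs)))"
  proof (rule ell_conj[of "inv\<^bsub>P\<^esub> (cls B)"])
    have "inv\<^bsub>P\<^esub> (inv\<^bsub>P\<^esub> (cls B)) \<otimes>\<^bsub>P\<^esub> cls (blocks ?bs) \<otimes>\<^bsub>P\<^esub> inv\<^bsub>P\<^esub> (cls B) = cls w"
      unfolding eq mult_cls[OF W(2,1), symmetric] B(1) mult_cls[OF W, symmetric]
      using cls_carrier[OF W(1)] cls_carrier[OF W(2)] by (simp add: P.m_assoc)
    then show "T.ell (act (inv\<^bsub>P\<^esub> (inv\<^bsub>P\<^esub> (cls B)) \<otimes>\<^bsub>P\<^esub> cls (blocks ?bs) \<otimes>\<^bsub>P\<^esub> inv\<^bsub>P\<^esub> (cls B)))"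
      using e by simp
  qed (use W eq in simp_all)
  ultimately show False by blast
qed

end

locale finite_graph_group = graph_group V E G
  for V :: "'v set" and E :: "'v \<Rightarrow> 'v \<Rightarrow> bool" and G :: "'v \<Rightarrow> 'a monoid" +
  assumes finV: "finite V" and neV: "V \<noteq> {}"
    and nontriv: "\<And>v. v \<in> V \<Longrightarrow> carrier (G v) \<noteq> {\<one>\<^bsub>G v\<^esub>}"

sublocale finite_graph_group \<subseteq> F: tree_family P V E "\<lambda>v. graph_tree.TT V E G v V" "\<lambda>v. ldist"
  "\<lambda>v x. even (length x)" "graph_tree.act V E G"
proof (intro tree_family.intro tree_family_axioms.intro)
  show "group P" by (rule group_P)
next
  fix v assume "v \<in> V"
  then show "tree (graph_tree.TT V E G v V) ldist (\<lambda>x. even (length x))"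
    by (rule graph_tree.T_tree[OF graph_treeI])
next
  fix v x assume "v \<in> V" "x \<in> carrier P"
  then show "tree.aut (graph_tree.TT V E G v V) ldist (\<lambda>x. even (length x)) (graph_tree.act V E G v x)"
    by (rule graph_tree.act_aut[OF graph_treeI])
next
  fix v x y p assume "v \<in> V" "x \<in> carrier P" "y \<in> carrier P" "p \<in> graph_tree.TT V E G v V"
  then show "graph_tree.act V E G v (x \<otimes>\<^bsub>P\<^esub> y) p = graph_tree.act V E G v x (graph_tree.act V E G v y p)"
    by (rule graph_tree.act_mult[OF graph_treeI])
next
  fix u v z assume uv: "u \<in> V" "v \<in> V" "u \<noteq> v" "\<not> E v u" and z: "z \<in> carrier P"
    and f: "tree.fixes_edge (graph_tree.TT V E G v V) ldist (graph_tree.act V E G v z)"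
  obtain t where t: "t \<in> carrier P" "inv\<^bsub>P\<^esub> t \<otimes>\<^bsub>P\<^esub> z \<otimes>\<^bsub>P\<^esub> t \<in> par {w \<in> V. E v w}"
    using graph_tree.fixes_edge_conj[OF graph_treeI[OF uv(2)] z f] .
  have "tree.ell (graph_tree.TT V E G u V) (graph_tree.act V E G u (inv\<^bsub>P\<^esub> t \<otimes>\<^bsub>P\<^esub> z \<otimes>\<^bsub>P\<^esub> t))"
    by (rule graph_tree.ell_par[OF graph_treeI[OF uv(1)] t(2)]) (use uv in blast)
  then show "tree.ell (graph_tree.TT V E G u V) (graph_tree.act V E G u z)"
    by (rule graph_tree.ell_conj[OF graph_treeI[OF uv(1)] t(1) z])
qed (use symE finV in auto)

section \<open>Strongly irreducible and regular elements\<close>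

lemma (in graph_group) par_infinite_letter:
  assumes u: "u \<in> V" "u \<in> A" "infinite (carrier (G u))"
  shows "infinite (par A)"
proof -
  have "inj_on (\<lambda>s. cls [(u, s)]) (carrier (G u))"
    by (rule inj_onI) (rule graph_tree.letter_inj[OF graph_treeI[OF u(1)]])
  moreover have "(\<lambda>s. cls [(u, s)]) ` carrier (G u) \<subseteq> par A"
    using cls_par u graph_tree.letter_v[OF graph_treeI[OF u(1)]] by auto
  ultimately show ?thesis using u(3) finite_imageD finite_subset by blast
qed

text \<open>The powers of a product of nontrivial letters of \<open>u\<close> and \<open>w\<close>
  consist of good blocks, and they carry the base vertex to lists of different lengths.\<close>

lemma (in finite_graph_group) par_infinite_nonadjacent:
  assumes u: "u \<in> V" "u \<in> A" and w: "w \<in> V" "w \<in> A" and uw: "u \<noteq> w" "\<not> E u w"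
  shows "infinite (par A)"
proof -
  interpret gt: graph_tree V E G u by (rule graph_treeI[OF u(1)])
  interpret gw: graph_tree V E G w by (rule graph_treeI[OF w(1)])
  obtain s where s: "s \<in> carrier (G u)" "s \<noteq> \<one>\<^bsub>G u\<^esub>" using nontriv[OF u(1)] group_one[OF u(1)] by blast
  obtain t where t: "t \<in> carrier (G w)" "t \<noteq> \<one>\<^bsub>G w\<^esub>" using nontriv[OF w(1)] group_one[OF w(1)] by blast
  have W: "[(w, t)] \<in> W" using t w(1) by simp
  have "cls [(w, t)] \<notin> par {x \<in> V. E u x}"
  proof
    assume a: "cls [(w, t)] \<in> par {x \<in> V. E u x}"
    have "cls [(w, t)] = rho {x \<in> V. E u x} (cls [(w, t)])"
      using par_iff_rho[OF cls_carrier[OF W]] a by simp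
    also have "\<dots> = cls []" using W uw by (simp add: ret_Cons)
    also have "\<dots> = cls [(w, \<one>\<^bsub>G w\<^esub>)]" using cls_drop[of "[]" "[]" w] w(1) by simp
    finally show False using gw.letter_inj[OF t(1) group_one[OF w(1)]] t(2) by blast
  qed
  then have g: "gt.good_block (s, [(w, t)])" using s W uw(1) by (auto simp: gt.good_block_def)
  define bs where "bs n = replicate n (s, [(w, t)])" for n
  have gb: "\<And>q. q \<in> set (bs n) \<Longrightarrow> gt.good_block q" for n using g unfolding bs_def by auto
  have len: "length (gt.act (cls (gt.blocks (bs n))) []) = 2 * n" for n
  proof -
    have "\<exists>x. gt.actw (gt.blocks (bs n)) [] = x \<and> length x = 2 * length (bs n) \<and> (bs n \<noteq> [] \<longrightarrow> hd x = Inl gt.i0)"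
      by (rule gt.blocks_act) (rule gb)
    then have "length (gt.actw (gt.blocks (bs n)) []) = 2 * length (bs n)" by blast
    moreover have "gt.act (cls (gt.blocks (bs n))) [] = gt.actw (gt.blocks (bs n)) []"
      by (rule gt.act_cls[OF gt.blocks_words gt.Nil_T]) (rule gb)
    moreover have "length (bs n) = n" unfolding bs_def by (rule length_replicate)
    ultimately show ?thesis by (simp only:)
  qed
  have "inj (\<lambda>n. cls (gt.blocks (bs n)))"
  proof (rule injI)
    fix m n assume "cls (gt.blocks (bs m)) = cls (gt.blocks (bs n))"
    then have "2 * m = 2 * n" using len[of m] len[of n] by (simp only:)
    then show "m = n" by simp
  qed
  moreover have "range (\<lambda>n. cls (gt.blocks (bs n))) \<subseteq> par A"
  proof (rule image_subsetI)
    fix n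
    show "cls (gt.blocks (bs n)) \<in> par A"
    proof (rule cls_par)
      show "fst ` set (gt.blocks (bs n)) \<subseteq> A" using u(2) w(2) by (auto simp: gt.blocks_def bs_def)
      show "gt.blocks (bs n) \<in> W" by (rule gt.blocks_words) (rule gb)
    qed
  qed
  ultimately show ?thesis using finite_subset range_inj_infinite by blast
qed

lemma (in graph_group) cls_split:
  assumes "w \<in> W" "u \<in> V" "\<And>p. p \<in> set w \<Longrightarrow> fst p = u \<or> E u (fst p)"
  shows "cls w = cls (ret {u} w) \<otimes>\<^bsub>P\<^esub> cls (ret (V - {u}) w)"
  using assms
proof (induction w)
  case Nil
  then show ?case using mult_cls[of "[]" "[]"] by simp
next
  case (Cons p w)
  have w: "w \<in> W" "[p] \<in> W" "fst p \<in> V" using Cons.prems(1) by simp_all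
  note r = ret_words[OF w(1), of "{u}"] ret_words[OF w(1), of "V - {u}"]
  have IH: "cls w = cls (ret {u} w @ ret (V - {u}) w)"
    using Cons.IH[OF w(1) Cons.prems(2)] Cons.prems(3) mult_cls[OF r] by simp
  have pw: "cls (p # w) = cls (p # ret {u} w @ ret (V - {u}) w)"
    using mult_cls[OF w(2,1)] IH mult_cls[OF w(2), of "ret {u} w @ ret (V - {u}) w"] r by simp
  show ?case
  proof (cases "fst p = u")
    case True
    then have "ret {u} (p # w) = p # ret {u} w" "ret (V - {u}) (p # w) = ret (V - {u}) w"
      by (simp_all add: ret_Cons)
    then show ?thesis using pw mult_cls[of "p # ret {u} w" "ret (V - {u}) w"] r w by simp
  next
    case False
    then have e: "E u (fst p)" using Cons.prems(3)[of p] by simp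
    have "cls ((fst p, snd p) # ret {u} w) = cls (ret {u} w @ [(fst p, snd p)])"
      by (rule letter_commute) (use w r e symE in \<open>auto simp: ret_def\<close>)
    then have "cls (p # ret {u} w @ ret (V - {u}) w) = cls (ret {u} w @ p # ret (V - {u}) w)"
      using mult_cls[of "p # ret {u} w" "ret (V - {u}) w"] mult_cls[of "ret {u} w @ [p]" "ret (V - {u}) w"] r w
      by simp
    moreover have "ret {u} (p # w) = ret {u} w" "ret (V - {u}) (p # w) = p # ret (V - {u}) w"
      using False w(3) by (simp_all add: ret_Cons)
    ultimately show ?thesis using pw mult_cls[of "ret {u} w" "p # ret (V - {u}) w"] r w by simp
  qed
qed

lemma (in graph_group) ret_single:
  "\<lbrakk>w \<in> W; u \<in> V\<rbrakk> \<Longrightarrow> \<exists>s\<in>carrier (G u). cls (ret {u} w) = cls [(u, s)]"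
proof (induction w)
  case Nil
  then show ?case using cls_drop[of "[]" "[]" u] by (intro bexI[of _ "\<one>\<^bsub>G u\<^esub>"]) simp_all
next
  case (Cons p w)
  then obtain s where s: "s \<in> carrier (G u)" "cls (ret {u} w) = cls [(u, s)]" by auto
  obtain x a where p: "p = (x, a)" by force
  show ?case
  proof (cases "x = u")
    case True
    then have a: "a \<in> carrier (G u)" using Cons.prems p by simp
    have "cls (ret {u} (p # w)) = cls [(u, a)] \<otimes>\<^bsub>P\<^esub> cls (ret {u} w)"
      using mult_cls[of "[(u, a)]" "ret {u} w"] Cons.prems a p True by (simp add: ret_Cons)
    also have "\<dots> = cls [(u, a), (u, s)]" unfolding s(2) using mult_cls[of "[(u, a)]" "[(u, s)]"] Cons.prems a s by simp
    also have "\<dots> = cls [(u, a \<otimes>\<^bsub>G u\<^esub> s)]" using cls_merge[of "[]" "[]" u a s] Cons.prems a s by simp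
    finally show ?thesis using group_closed[OF Cons.prems(2) a s(1)] by blast
  next
    case False
    then show ?thesis using s p by (auto simp: ret_Cons)
  qed
qed

lemma (in graph_group) cls_letter_pow:
  assumes "u \<in> V" "s \<in> carrier (G u)"
  shows "cls [(u, s)] [^]\<^bsub>P\<^esub> (n::nat) = cls [(u, s [^]\<^bsub>G u\<^esub> n)]"
proof (induction n)
  case 0
  then show ?case using cls_drop[of "[]" "[]" u] assms by (simp add: one_P)
next
  case (Suc n)
  interpret Gu: group "G u" by (rule grp[OF assms(1)])
  have "cls [(u, s [^]\<^bsub>G u\<^esub> n)] \<otimes>\<^bsub>P\<^esub> cls [(u, s)] = cls [(u, s [^]\<^bsub>G u\<^esub> n), (u, s)]"
    using mult_cls[of "[(u, s [^]\<^bsub>G u\<^esub> n)]" "[(u, s)]"] assms by simp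
  also have "\<dots> = cls [(u, s [^]\<^bsub>G u\<^esub> n \<otimes>\<^bsub>G u\<^esub> s)]"
    using cls_merge[of "[]" "[]" u "s [^]\<^bsub>G u\<^esub> n" s] assms by simp
  finally show ?case using Suc by simp
qed

lemma (in graph_group) rho_pow: "x \<in> carrier P \<Longrightarrow> rho L (x [^]\<^bsub>P\<^esub> (n::nat)) = rho L x [^]\<^bsub>P\<^esub> n"
  by (induction n) (simp_all add: rho_mult one_P)

text \<open>Over a clique the parabolic subgroup is a direct product of vertex groups. The product
  of the orders of all finite vertex groups is an exponent that kills the finite components.\<close>

lemma (in finite_graph_group) clique_power:
  assumes w: "w \<in> W" and C: "\<And>u v. u \<in> fst ` set w \<Longrightarrow> v \<in> fst ` set w \<Longrightarrow> u \<noteq> v \<Longrightarrow> E u v"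
  shows "\<exists>n\<ge>1::nat. cls w [^]\<^bsub>P\<^esub> n \<in> par {v \<in> fst ` set w. infinite (carrier (G v))}"
proof -
  let ?L = "fst ` set w"
  let ?F = "{v \<in> V. finite (carrier (G v))}"
  define n where "n = (\<Prod>v\<in>?F. card (carrier (G v)))"
  have fF: "finite ?F" using finV by simp
  have LV: "?L \<subseteq> V" using w unfolding gp_words_def by auto
  have "n \<noteq> 0"
  proof
    assume "n = 0"
    then have "\<exists>v\<in>?F. card (carrier (G v)) = 0"
      unfolding n_def by (rule prod_zero_iff[OF fF, THEN iffD1])
    then obtain v where v: "v \<in> V" "finite (carrier (G v))" "card (carrier (G v)) = 0" by (elim bexE) simp
    then have "carrier (G v) = {}" by simp
    then show False using group_one[OF v(1)] by simp
  qed
  have wP: "cls w \<in> carrier P" using w by simp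
  have "cls w [^]\<^bsub>P\<^esub> n \<in> par {v \<in> ?L. infinite (carrier (G v))}"
  proof (rule par_from_deletions)
    show "cls w [^]\<^bsub>P\<^esub> n \<in> carrier P" using wP by simp
    fix u assume u: "u \<in> V" "u \<notin> {v \<in> ?L. infinite (carrier (G v))}"
    show "cls w [^]\<^bsub>P\<^esub> n \<in> par (V - {u})"
    proof (cases "u \<in> ?L")
      case False
      then have "?L \<subseteq> V - {u}" using LV by blast
      with w have "cls w \<in> par (V - {u})" by (rule cls_par)
      then show ?thesis by (rule par_pow)
    next
      case True
      interpret Gu: group "G u" by (rule grp[OF u(1)])
      have fu: "u \<in> ?F" using u True by blast
      obtain s where s: "s \<in> carrier (G u)" "cls (ret {u} w) = cls [(u, s)]"
        using ret_single[OF w u(1)] by blast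
      obtain m where m: "n = card (carrier (G u)) * m"
        using dvd_prodI[OF fF fu, of "\<lambda>v. card (carrier (G v))"] unfolding n_def dvd_def by blast
      have "s [^]\<^bsub>G u\<^esub> (card (carrier (G u))) = \<one>\<^bsub>G u\<^esub>"
        using Gu.pow_order_eq_1[OF s(1)] by (simp add: order_def)
      then have sn: "s [^]\<^bsub>G u\<^esub> n = \<one>\<^bsub>G u\<^esub>" unfolding m
        using Gu.nat_pow_pow[OF s(1), of "card (carrier (G u))" m] by simp
      let ?z = "cls w [^]\<^bsub>P\<^esub> n"
      have zP: "?z \<in> carrier P" using wP by simp
      have z1: "rho {u} ?z = \<one>\<^bsub>P\<^esub>"
        unfolding rho_pow[OF wP] rho_cls[OF w] s(2) cls_letter_pow[OF u(1) s(1)] sn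
        using cls_drop[of "[]" "[]" u] u(1) by (simp add: one_P)
      have "?z \<in> par ?L" using cls_par[OF w subset_refl] by (rule par_pow)
      then obtain w' where w': "w' \<in> W" "?z = cls w'" "\<forall>p\<in>set w'. fst p \<in> ?L" unfolding par_def by blast
      have "?z = rho {u} ?z \<otimes>\<^bsub>P\<^esub> rho (V - {u}) ?z"
        unfolding w'(2) rho_cls[OF w'(1)]
      proof (rule cls_split[OF w'(1) u(1)])
        fix p assume "p \<in> set w'"
        then have "fst p \<in> ?L" using w'(3) by simp
        then show "fst p = u \<or> E u (fst p)" using C[OF True] by metis
      qed
      then have "?z = rho (V - {u}) ?z" unfolding z1 using P.l_one[OF rho_closed[OF zP]] by simp
      then show ?thesis using par_iff_rho[OF zP] by simp
    qed
  qed
  then show ?thesis using \<open>n \<noteq> 0\<close> by (intro exI[of _ n]) simp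
qed

section \<open>Sets of vertices that certify strong irreducibility and regularity\<close>

context finite_graph_group begin

lemma el_conj_into_par:
  assumes v: "v \<in> V" and x: "x \<in> carrier P" "conj_into P x (par D)" and D: "v \<notin> D \<or> D \<subseteq> insert v {u \<in> V. E v u}"
  shows "F.el v x"
proof -
  interpret gt: graph_tree V E G v by (rule graph_treeI[OF v])
  obtain t where t: "t \<in> carrier P" "inv\<^bsub>P\<^esub> t \<otimes>\<^bsub>P\<^esub> x \<otimes>\<^bsub>P\<^esub> t \<in> par D" using P.conj_intoE[OF x(2)] .
  show ?thesis unfolding F.el_def by (rule gt.ell_conj[OF t(1) x(1) gt.ell_par[OF t(2) D]])
qed

lemma conj_into_mono: "\<lbrakk>conj_into P x (par A); A \<subseteq> B\<rbrakk> \<Longrightarrow> conj_into P x (par B)"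
  using par_mono unfolding conj_into_def by blast

text \<open>The letters of a word of minimal length in the conjugacy class form the support. By
  \<open>conj_min_not_ell\<close> an element can be elliptic only at support vertices adjacent to
  all others of the support.\<close>

lemma support:
  assumes x: "x \<in> carrier P"
  shows "\<exists>w t. w \<in> W \<and> t \<in> carrier P \<and> cls w = inv\<^bsub>P\<^esub> t \<otimes>\<^bsub>P\<^esub> x \<otimes>\<^bsub>P\<^esub> t \<and> fst ` set w \<subseteq> V \<and>
    conj_into P x (par (fst ` set w)) \<and>
    (\<forall>v\<in>fst ` set w. \<not> fst ` set w \<subseteq> insert v {u \<in> V. E v u} \<longrightarrow> \<not> F.el v x)"
proof -
  obtain w t where w: "conj_min w" "t \<in> carrier P" "cls w = inv\<^bsub>P\<^esub> t \<otimes>\<^bsub>P\<^esub> x \<otimes>\<^bsub>P\<^esub> t"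
    using ex_conj_min[OF x] .
  have W: "w \<in> W" using conj_min_words[OF w(1)] .
  have LV: "fst ` set w \<subseteq> V" using W unfolding gp_words_def by auto
  have "conj_into P x (par (fst ` set w))"
    using P.conj_intoI[OF w(2) x] cls_par[OF W subset_refl] unfolding w(3) .
  moreover have "\<not> F.el v x" if v: "v \<in> fst ` set w" "\<not> fst ` set w \<subseteq> insert v {u \<in> V. E v u}" for v
  proof
    assume e: "F.el v x"
    have vV: "v \<in> V" using v(1) LV by blast
    interpret gt: graph_tree V E G v by (rule graph_treeI[OF vV])
    have "x = inv\<^bsub>P\<^esub> (inv\<^bsub>P\<^esub> t) \<otimes>\<^bsub>P\<^esub> cls w \<otimes>\<^bsub>P\<^esub> inv\<^bsub>P\<^esub> t"
      unfolding w(3) P.conj_conj[OF w(2) P.inv_closed[OF w(2)] x] using w(2) x by simp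
    then have "gt.T.ell (gt.act (cls w))"
      using gt.ell_conj[OF P.inv_closed[OF w(2)] cls_carrier[OF W]] e unfolding F.el_def by simp
    then show False using gt.conj_min_not_ell[OF w(1) v] by blast
  qed
  ultimately show ?thesis using W w(2,3) LV by blast
qed

text \<open>A vertex adjacent to the rest of the support would exhibit the support as a join, so
  \<open>x\<close> is loxodromic at all of it. If \<open>y\<close> is loxodromic there too, any join
  that contains a conjugate of \<open>y\<close> covers the support, and then \<open>x\<close> would
  be conjugate into a join.\<close>

lemma strongly_irreducible_witness:
  assumes x: "strongly_irreducible V E G x"
  shows "\<exists>L. L \<subseteq> V \<and> L \<noteq> {} \<and> (\<forall>v\<in>L. \<not> F.el v x) \<and>
    (\<forall>y\<in>carrier P. (\<forall>v\<in>L. \<not> F.el v y) \<longrightarrow> strongly_irreducible V E G y)"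
proof -
  have xP: "x \<in> carrier P" and xv: "\<And>v. v \<in> V \<Longrightarrow> \<not> conj_into P x (par {v})"
    and xj: "\<And>A B. joined V E A B \<Longrightarrow> \<not> conj_into P x (par (A \<union> B))"
    using x unfolding strongly_irreducible_def by blast+
  obtain w t where "w \<in> W" "t \<in> carrier P" "cls w = inv\<^bsub>P\<^esub> t \<otimes>\<^bsub>P\<^esub> x \<otimes>\<^bsub>P\<^esub> t" and LV: "fst ` set w \<subseteq> V"
    and xL: "conj_into P x (par (fst ` set w))"
    and lox0: "\<forall>v\<in>fst ` set w. \<not> fst ` set w \<subseteq> insert v {u \<in> V. E v u} \<longrightarrow> \<not> F.el v x"
    using support[OF xP] by (elim exE conjE)
  have lox: "\<not> F.el v x" if "v \<in> fst ` set w" "\<not> fst ` set w \<subseteq> insert v {u \<in> V. E v u}" for v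
    using bspec[OF lox0 that(1)] that(2) by blast
  define L where "L = fst ` set w"
  note LV = LV[folded L_def] and xL = xL[folded L_def] and lox = lox[folded L_def]
  have nsub: "\<not> L \<subseteq> {v}" if "v \<in> V" for v using xv[OF that] conj_into_mono[OF xL] by blast
  have ne: "L \<noteq> {}" using nsub neV by blast
  have lx: "\<not> F.el v x" if v: "v \<in> L" for v
  proof (rule lox[OF v])
    show "\<not> L \<subseteq> insert v {u \<in> V. E v u}"
    proof
      assume s: "L \<subseteq> insert v {u \<in> V. E v u}"
      have "joined V E {v} (L - {v})" unfolding joined_def using s LV v nsub[of v] by blast
      then show False using xj conj_into_mono[OF xL, of "{v} \<union> (L - {v})"] by blast
    qed
  qed
  have "strongly_irreducible V E G y" if y: "y \<in> carrier P" "\<And>v. v \<in> L \<Longrightarrow> \<not> F.el v y" for y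
    unfolding strongly_irreducible_def
  proof (intro conjI ballI allI impI notI)
    fix u assume u: "u \<in> V" "conj_into P y (par {u})"
    obtain v where v: "v \<in> L" using ne by blast
    have "F.el v y" by (rule el_conj_into_par[OF _ y(1) u(2)]) (use v LV in blast)+
    then show False using y(2)[OF v] by blast
  next
    fix A B assume j: "joined V E A B" and c: "conj_into P y (par (A \<union> B))"
    have LAB: "L \<subseteq> A \<union> B"
    proof
      fix v assume v: "v \<in> L"
      show "v \<in> A \<union> B" using el_conj_into_par[OF _ y(1) c, of v] y(2)[OF v] v LV by blast
    qed
    have AB: "A \<subseteq> V" "B \<subseteq> V" "A \<noteq> {}" "B \<noteq> {}" "A \<inter> B = {}" "\<forall>u\<in>A. \<forall>w\<in>B. E u w"
      using j unfolding joined_def by blast+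
    consider "L \<inter> A = {}" | "L \<inter> B = {}" | "L \<inter> A \<noteq> {}" "L \<inter> B \<noteq> {}" by blast
    then show False
    proof cases
      case 1
      then have "joined V E A L" unfolding joined_def using AB LAB ne LV by blast
      then show False using xj conj_into_mono[OF xL, of "A \<union> L"] by blast
    next
      case 2
      then have "joined V E L B" unfolding joined_def using AB LAB ne LV by blast
      then show False using xj conj_into_mono[OF xL, of "L \<union> B"] by blast
    next
      case 3
      then have "joined V E (L \<inter> A) (L \<inter> B)" unfolding joined_def using AB by blast
      then show False using xj conj_into_mono[OF xL, of "(L \<inter> A) \<union> (L \<inter> B)"] LAB by blast
    qed
  qed (rule y(1))
  then show ?thesis by (intro exI[of _ L] conjI LV ne ballI impI lx) blast+
qed

text \<open>The support of \<open>x\<close> may now contain vertices adjacent to all others of it,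
  where \<open>x\<close> can be elliptic; \<open>S\<close> leaves these cone vertices out. A join
  for a power of \<open>y\<close> covers \<open>S\<close> but perhaps not them, so it has to be
  rebuilt around the whole support, with both sides infinite, before it contradicts the regularity
  of \<open>x\<close>.\<close>

lemma regular_witness:
  assumes x: "regular V E G x"
  shows "\<exists>L. L \<subseteq> V \<and> L \<noteq> {} \<and> (\<forall>v\<in>L. \<not> F.el v x) \<and>
    (\<forall>y\<in>carrier P. (\<forall>v\<in>L. \<not> F.el v y) \<longrightarrow> regular V E G y)"
proof -
  have xP: "x \<in> carrier P"
    and xv: "\<And>n v. 1 \<le> n \<Longrightarrow> v \<in> V \<Longrightarrow> \<not> conj_into P (x [^]\<^bsub>P\<^esub> (n::nat)) (par {v})"
    and xj: "\<And>n A B. \<lbrakk>1 \<le> n; joined V E A B; infinite (par A); infinite (par B)\<rbrakk>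
      \<Longrightarrow> \<not> conj_into P (x [^]\<^bsub>P\<^esub> (n::nat)) (par (A \<union> B))"
    using x unfolding regular_def by blast+
  have x1: "x [^]\<^bsub>P\<^esub> (1::nat) = x" using xP by simp
  obtain w t where w: "w \<in> W" "t \<in> carrier P" "cls w = inv\<^bsub>P\<^esub> t \<otimes>\<^bsub>P\<^esub> x \<otimes>\<^bsub>P\<^esub> t" and LV: "fst ` set w \<subseteq> V"
    and xL: "conj_into P x (par (fst ` set w))"
    and lox0: "\<forall>v\<in>fst ` set w. \<not> fst ` set w \<subseteq> insert v {u \<in> V. E v u} \<longrightarrow> \<not> F.el v x"
    using support[OF xP] by (elim exE conjE)
  have lox: "\<not> F.el v x" if "v \<in> fst ` set w" "\<not> fst ` set w \<subseteq> insert v {u \<in> V. E v u}" for v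
    using bspec[OF lox0 that(1)] that(2) by blast
  have no_join: False if j: "joined V E A B" "infinite (par A)" "infinite (par B)" "fst ` set w \<subseteq> A \<union> B" for A B
    using xj[OF order_refl j(1-3)] conj_into_mono[OF xL j(4)] unfolding x1 by blast
  define S where "S = {v \<in> fst ` set w. \<not> fst ` set w \<subseteq> insert v {u \<in> V. E v u}}"
  have SL: "S \<subseteq> fst ` set w" unfolding S_def by blast
  have SV: "S \<subseteq> V" using SL LV by blast
  have dom: "E v u" if "v \<in> fst ` set w - S" "u \<in> fst ` set w" "u \<noteq> v" for u v
    using that unfolding S_def by blast
  have partner: "\<exists>u\<in>S. u \<noteq> v \<and> \<not> E v u" if v: "v \<in> S" for v
  proof -
    obtain u where u: "u \<in> fst ` set w" "u \<noteq> v" "\<not> E v u" using v LV unfolding S_def by blast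
    have "u \<in> S" using dom[of u v] u symE v SL by blast
    then show ?thesis using u by blast
  qed
  \<comment> \<open>The non-adjacent partner of \<open>v\<close> cannot lie outside
    \<open>A\<close>, so \<open>A\<close> contains two non-adjacent vertices.\<close>
  have inf: "infinite (par A)" if A: "v \<in> S" "v \<in> A" "\<And>u. u \<in> S \<Longrightarrow> u \<notin> A \<Longrightarrow> E v u" for v A
  proof -
    obtain u where u: "u \<in> S" "u \<noteq> v" "\<not> E v u" using partner[OF A(1)] by blast
    then have "u \<in> A" using A(3) by blast
    then show ?thesis using par_infinite_nonadjacent[of v A u] u A(1,2) SV by blast
  qed
  \<comment> \<open>If \<open>S\<close> were empty, the support would be a clique. Some power of
    \<open>x\<close> would then live on its vertices with infinite groups: none, a single one, or a
    join of two infinite parts.\<close>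
  have ne: "S \<noteq> {}"
  proof
    assume "S = {}"
    then have "E u v" if "u \<in> fst ` set w" "v \<in> fst ` set w" "u \<noteq> v" for u v
      using dom[of u v] that by simp
    then have "\<exists>n\<ge>1::nat. cls w [^]\<^bsub>P\<^esub> n \<in> par {v \<in> fst ` set w. infinite (carrier (G v))}"
      by (rule clique_power[OF w(1)])
    then obtain n :: nat where n: "1 \<le> n" "cls w [^]\<^bsub>P\<^esub> n \<in> par {v \<in> fst ` set w. infinite (carrier (G v))}"
      by (elim exE conjE)
    define C where "C = {v \<in> fst ` set w. infinite (carrier (G v))}"
    have CV: "C \<subseteq> V" using LV unfolding C_def by blast
    have c: "conj_into P (x [^]\<^bsub>P\<^esub> n) (par C)"
      using P.conj_intoI[OF w(2) P.nat_pow_closed[OF xP]] n(2)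
      unfolding w(3) P.conj_pow[OF w(2) xP] C_def .
    have nsub: "\<not> C \<subseteq> {v}" if "v \<in> V" for v using xv[OF n(1) that] conj_into_mono[OF c] by blast
    obtain v where v: "v \<in> C" using nsub neV by blast
    then obtain u where u: "u \<in> C" "u \<noteq> v" using nsub CV by blast
    have "joined V E {v} (C - {v})"
      unfolding joined_def using CV v u dom \<open>S = {}\<close> unfolding C_def by blast
    moreover have "infinite (par {v})" by (rule par_infinite_letter[of v]) (use v CV C_def in auto)
    moreover have "infinite (par (C - {v}))" by (rule par_infinite_letter[of u]) (use u CV C_def in auto)
    ultimately show False using xj[OF n(1)] conj_into_mono[OF c, of "{v} \<union> (C - {v})"] by blast
  qed
  have "regular V E G y" if y: "y \<in> carrier P" "\<And>v. v \<in> S \<Longrightarrow> \<not> F.el v y" for y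
    unfolding regular_def
  proof (intro conjI ballI allI impI notI)
    fix n :: nat assume n: "1 \<le> n"
    let ?z = "y [^]\<^bsub>P\<^esub> n"
    have zP: "?z \<in> carrier P" using y(1) by simp
    have z: "\<not> F.el v ?z" if v: "v \<in> S" for v
    proof -
      have vV: "v \<in> V" using v SV by blast
      interpret gt: graph_tree V E G v by (rule graph_treeI[OF vV])
      have "gt.T.ell (gt.act ?z) \<longleftrightarrow> gt.T.ell (gt.act y ^^ n)"
        by (rule gt.T.ell_cong) (rule F.act_pow[OF vV y(1)])
      then have "gt.T.ell (gt.act ?z) \<longleftrightarrow> gt.T.ell (gt.act y)"
        using gt.T.ell_funpow[of "gt.act y" n] gt.T.funpow_ell[OF gt.act_aut[OF y(1)], of n] n by auto
      then show ?thesis using y(2)[OF v] unfolding F.el_def by blast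
    qed
    {
      fix u assume u: "u \<in> V" "conj_into P ?z (par {u})"
      obtain v where v: "v \<in> S" using ne by blast
      have "F.el v ?z" by (rule el_conj_into_par[OF _ zP u(2)]) (use v SV in blast)+
      then show False using z[OF v] by blast
    next
      fix A B assume j: "joined V E A B \<and> infinite (par A) \<and> infinite (par B)"
        and c: "conj_into P ?z (par (A \<union> B))"
      have SAB: "S \<subseteq> A \<union> B"
      proof
        fix v assume v: "v \<in> S"
        show "v \<in> A \<union> B" using el_conj_into_par[OF _ zP c, of v] z[OF v] v SV by blast
      qed
      have AB: "A \<subseteq> V" "B \<subseteq> V" "A \<inter> B = {}" "\<And>u w. u \<in> A \<Longrightarrow> w \<in> B \<Longrightarrow> E u w"
        "infinite (par A)" "infinite (par B)"
        using j unfolding joined_def by blast+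
      have split: False if AB: "A \<subseteq> V" "B \<subseteq> V" "A \<inter> B = {}" "\<And>u w. u \<in> A \<Longrightarrow> w \<in> B \<Longrightarrow> E u w"
        "infinite (par B)" "S \<subseteq> A \<union> B" and SA: "S \<inter> A \<noteq> {}" for A B
      proof (cases "S \<inter> B = {}")
        case True
        then have SA: "S \<subseteq> A" using AB by blast
        \<comment> \<open>If \<open>S\<close> lies in \<open>A\<close>, the other side becomes the
          set of all vertices adjacent to all of \<open>S\<close>. It contains \<open>B\<close>,
          hence is infinite, and it contains the cone vertices.\<close>
        define R where "R = {u \<in> V. \<forall>s\<in>S. E s u}"
        have BR: "B \<subseteq> R" unfolding R_def using AB SA by blast
        have wR: "fst ` set w \<subseteq> S \<union> R"
        proof
          fix v assume v: "v \<in> fst ` set w"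
          have "E s v" if "s \<in> S" "v \<notin> S" for s using symE[OF dom[of v s]] that v SL by blast
          then show "v \<in> S \<union> R" unfolding R_def using v LV by blast
        qed
        have "B \<noteq> {}"
        proof
          assume "B = {}"
          have "z = cls []" if z: "z \<in> par B" for z
          proof -
            obtain w where "z = cls w" "\<forall>p\<in>set w. fst p \<in> B" using z unfolding par_def by blast
            then show ?thesis using \<open>B = {}\<close> by (cases w) auto
          qed
          then have "par B \<subseteq> {cls []}" by blast
          then show False using AB(5) finite_subset[of "par B" "{cls []}"] by simp
        qed
        then have "joined V E S R"
          unfolding joined_def using SV ne BR irrE R_def by blast
        moreover have "infinite (par S)" using inf[of _ S] ne by blast
        moreover have "infinite (par R)" using AB(5) par_mono[OF BR] finite_subset[of "par B" "par R"] by blast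
        ultimately show False using no_join wR by blast
      next
        case False
        \<comment> \<open>If \<open>S\<close> meets both sides, the cone vertices can be added to
          the side of \<open>B\<close>, since they are adjacent to the rest of the support.\<close>
        define K where "K = fst ` set w - S"
        obtain a where a: "a \<in> S" "a \<in> A" using SA by blast
        obtain b where b: "b \<in> S" "b \<in> B" using False by blast
        have "infinite (par (S \<inter> A))" by (rule inf[of a]) (use a AB in blast)+
        moreover have "infinite (par (S \<inter> B))"
        proof (rule inf[of b])
          fix u assume "u \<in> S" "u \<notin> S \<inter> B"
          then show "E b u" using symE[OF AB(4)[of u b]] AB(6) b(2) by blast
        qed (use b in blast)+
        then have "infinite (par (S \<inter> B \<union> K))"
          using par_mono[of "S \<inter> B" "S \<inter> B \<union> K"] finite_subset[of "par (S \<inter> B)" "par (S \<inter> B \<union> K)"] by blast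
        moreover have "joined V E (S \<inter> A) (S \<inter> B \<union> K)"
        proof -
          have "E u v" if "u \<in> S \<inter> A" "v \<in> S \<inter> B \<union> K" for u v
          proof (cases "v \<in> K")
            case True
            then show ?thesis using symE[OF dom[of v u]] that SL unfolding K_def by blast
          next
            case False
            then show ?thesis using that AB(4) by blast
          qed
          moreover have "K \<subseteq> V" "K \<inter> S = {}" using LV unfolding K_def by blast+
          moreover have "S \<inter> A \<noteq> {}" "S \<inter> B \<union> K \<noteq> {}" using a b by blast+
          ultimately show ?thesis unfolding joined_def using AB(1-3) by blast
        qed
        moreover have "fst ` set w \<subseteq> (S \<inter> A) \<union> (S \<inter> B \<union> K)"
          unfolding K_def using AB(6) by blast
        ultimately show False using no_join by blast
      qed
      show False
      proof (cases "S \<inter> A = {}")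
        case False
        show False by (rule split[OF AB(1-4,6) SAB False])
      next
        case True
        then have "S \<inter> B \<noteq> {}" using SAB ne by blast
        then show False
        proof (rule split[OF AB(2,1) _ _ AB(5), rotated 3])
          show "S \<subseteq> B \<union> A" "B \<inter> A = {}" using SAB AB(3) by blast+
          show "E u w" if "u \<in> B" "w \<in> A" for u w using symE[OF AB(4)[OF that(2,1)]] .
        qed
      qed
    }
  qed (rule y(1))
  moreover have "\<not> F.el v x" if "v \<in> S" for v using lox that unfolding S_def by blast
  ultimately show ?thesis by (intro exI[of _ S] conjI SV ne ballI impI) blast+
qed

text \<open>A strong flip gives an element that moves a vertex which its square fixes.
  \<open>flip_involution\<close> is used with the colour of even length, because
  \<open>square_root_par\<close> speaks about the stabilizers of those vertices.\<close>

lemma no_strong_flip: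
  assumes no2: "\<And>u s. u \<in> V \<Longrightarrow> s \<in> carrier (G u) \<Longrightarrow> s \<otimes>\<^bsub>G u\<^esub> s = \<one>\<^bsub>G u\<^esub> \<Longrightarrow> s = \<one>\<^bsub>G u\<^esub>"
    and v: "v \<in> V" and fg: "f \<in> carrier P" "g \<in> carrier P"
  shows "\<not> F.strong_flip f g v n"
proof
  assume s: "F.strong_flip f g v n"
  interpret gt: graph_tree V E G v by (rule graph_treeI[OF v])
  obtain k m where m: "4 \<le> m" "gt.T.ell (gt.act (f [^]\<^bsub>P\<^esub> (k::nat) \<otimes>\<^bsub>P\<^esub> g [^]\<^bsub>P\<^esub> n))"
    "gt.T.ell (gt.act f ^^ m \<circ> gt.act (f [^]\<^bsub>P\<^esub> k \<otimes>\<^bsub>P\<^esub> g [^]\<^bsub>P\<^esub> n))"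
    using F.strong_flip_fun[OF v fg s] .
  let ?e = "f [^]\<^bsub>P\<^esub> k \<otimes>\<^bsub>P\<^esub> g [^]\<^bsub>P\<^esub> n"
  have eP: "?e \<in> carrier P" using fg by simp
  have nf: "\<not> gt.T.ell (gt.act f)" using s unfolding F.strong_flip_def F.el_def by blast
  obtain p where p: "p \<in> gt.TT V" "even (length p) = True"
    "(gt.act f ^^ 2 \<circ> gt.act ?e) ((gt.act f ^^ 2 \<circ> gt.act ?e) p) = p" "(gt.act f ^^ 2 \<circ> gt.act ?e) p \<noteq> p"
    using gt.T.flip_involution[OF gt.act_aut[OF fg(1)] nf gt.act_aut[OF eP] m(2,1,3)] .
  let ?z = "f [^]\<^bsub>P\<^esub> (2::nat) \<otimes>\<^bsub>P\<^esub> ?e"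
  have zP: "?z \<in> carrier P" using fg by simp
  have z: "gt.act ?z q = (gt.act f ^^ 2 \<circ> gt.act ?e) q" if "q \<in> gt.TT V" for q
    using gt.act_mult[OF P.nat_pow_closed[OF fg(1)] eP that] F.act_pow[OF v fg(1) gt.act_closed[OF eP that]]
    by simp
  have "gt.act ?z p = p"
  proof (rule gt.no_involution[OF _ zP p(1)])
    show "even (length p)" using p(2) by simp
    show "gt.act ?z (gt.act ?z p) = p" using z[OF p(1)] z[OF gt.act_closed[OF zP p(1)]] p(3) by simp
    fix q assume q: "q \<in> carrier P" "q \<otimes>\<^bsub>P\<^esub> q \<in> par (V - {v})"
    obtain w where "w \<in> W" "q = cls w" using q(1) by (rule carrierE)
    then have "q \<in> par V" using cls_par[of w V] unfolding gp_words_def by auto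
    then show "q \<in> par (V - {v})" using square_root_par[OF no2 finV subset_refl] q(2) by blast
  qed
  then show False using z[OF p(1)] p(4) by simp
qed

end

theorem theoremA:
  fixes V :: "'v set" and E :: "'v \<Rightarrow> 'v \<Rightarrow> bool" and G :: "'v \<Rightarrow> 'a monoid"
    and U :: "('v \<times> 'a) list set set"
  assumes finV: "finite V" and neV: "V \<noteq> {}"
    and symE: "\<forall>u w. E u w \<longrightarrow> E w u" and irrE: "\<forall>v. \<not> E v v"
    and grp: "\<forall>v \<in> V. group (G v)"
    and nontriv: "\<forall>v \<in> V. carrier (G v) \<noteq> {\<one>\<^bsub>G v\<^esub>}"
    and U_sub: "U \<subseteq> carrier (graph_product V E G)"
  defines "d \<equiv> graph_dim V E"
    and "k \<equiv> (if finite U then min (card U ^ 2) (card V) else card V)"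
  defines "N \<equiv> (if (\<forall>v \<in> V. \<forall>g \<in> carrier (G v). group.ord (G v) g \<noteq> 2)
                 then (6 * d + 5) ^ k else (2 ^ (d + 3) * d) ^ k)"
  shows "((\<exists>x \<in> generate (graph_product V E G) U. regular V E G x)
            \<longrightarrow> (\<exists>n. 1 \<le> n \<and> n \<le> N \<and>
                   (\<exists>y \<in> set_power (graph_product V E G) U n. regular V E G y)))
       \<and> ((\<exists>x \<in> generate (graph_product V E G) U. strongly_irreducible V E G x)
            \<longrightarrow> (\<exists>n. 1 \<le> n \<and> n \<le> N \<and>
                   (\<exists>y \<in> set_power (graph_product V E G) U n. strongly_irreducible V E G y)))"
proof -
  interpret finite_graph_group V E G
    by (intro finite_graph_group.intro graph_group.intro finite_graph_group_axioms.intro)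
      (use symE irrE grp finV neV nontriv in blast)+
  let ?C = "{card C | C. C \<subseteq> V \<and> is_clique E C}"
  have "?C \<subseteq> card ` Pow V" by blast
  then have fC: "finite ?C" using finV finite_subset by blast
  have dim: "card C \<le> d" if "C \<subseteq> V" "\<And>u w. u \<in> C \<Longrightarrow> w \<in> C \<Longrightarrow> u \<noteq> w \<Longrightarrow> E u w" for C
    unfolding d_def graph_dim_def using that by (intro Max_ge[OF fC]) (auto simp: is_clique_def)
  obtain v0 where "v0 \<in> V" using neV by blast
  then have d1: "1 \<le> d" using dim[of "{v0}"] by simp
  define no2 where "no2 \<longleftrightarrow> (\<forall>v\<in>V. \<forall>g\<in>carrier (G v). group.ord (G v) g \<noteq> 2)"
  \<comment> \<open>The length of a block that surely contains an exponent without strong flips: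
    \<open>1\<close> if there are no flips at all, otherwise \<open>2 ^ d\<close> by avoiding
    progressions.\<close>
  define K where "K = (if no2 then 1 else 2 ^ d :: nat)"
  define N0 where "N0 = (if no2 then 6 * d + 5 else 2 ^ (d + 3) * d)"
  have N: "N = N0 ^ k" unfolding N_def N0_def no2_def by simp
  have K1: "1 \<le> K" unfolding K_def by simp
  have block: "\<exists>n. x < n \<and> n \<le> x + K \<and> (\<forall>v\<in>V. \<not> F.strong_flip f g v n)"
    if fg: "f \<in> carrier P" "g \<in> carrier P" for f g x
  proof (cases no2)
    case False
    have "\<exists>n. x < n \<and> n \<le> x + 2 ^ d \<and> (\<forall>v\<in>V. \<not> F.strong_flip f g v n)"
      by (rule F.block_without_flip[OF fg]) (use dim in blast)
    then show ?thesis using False unfolding K_def by simp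
  next
    case True
    have "s = \<one>\<^bsub>G u\<^esub>" if u: "u \<in> V" and s: "s \<in> carrier (G u)" "s \<otimes>\<^bsub>G u\<^esub> s = \<one>\<^bsub>G u\<^esub>" for u s
    proof (rule ccontr)
      assume n1: "s \<noteq> \<one>\<^bsub>G u\<^esub>"
      interpret Gu: group "G u" using grp u by blast
      have "s [^]\<^bsub>G u\<^esub> (2::nat) = \<one>\<^bsub>G u\<^esub>" using s by (simp add: numeral_2_eq_2)
      then have "Gu.ord s dvd 2" using Gu.pow_eq_id[OF s(1)] by blast
      moreover have "Gu.ord s \<noteq> 1" using Gu.ord_eq_1[OF s(1)] n1 by blast
      ultimately have "Gu.ord s = 2" using two_is_prime_nat prime_nat_iff by blast
      then show False using True u s(1) unfolding no2_def by blast
    qed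
    then have "\<not> F.strong_flip f g v (Suc x)" if "v \<in> V" for v using no_strong_flip[OF _ that fg] by blast
    then show ?thesis using True unfolding K_def by (intro exI[of _ "Suc x"]) simp
  qed
  have N0: "11 \<le> N0" "6 * d + 4 + K \<le> N0" "8 * K * (d + 1) + K \<le> 3 * N0"
  proof -
    have "11 \<le> N0 \<and> 6 * d + 4 + K \<le> N0 \<and> 8 * K * (d + 1) + K \<le> 3 * N0"
    proof (cases no2)
      case True
      then show ?thesis unfolding K_def N0_def using d1 by simp
    next
      case False
      have e: "N0 = 8 * (2 ^ d * d)" "K = 2 ^ d" using False unfolding K_def N0_def by (simp_all add: power_add)
      have "2 * 1 \<le> (2::nat) ^ d * 1" using power_increasing[OF d1, of "2::nat"] by simp
      then have 1: "2 * d \<le> 2 ^ d * d" by simp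
      have 2: "2 ^ d \<le> 2 ^ d * d" using d1 by simp
      have 3: "8 * K * (d + 1) + K = 8 * (2 ^ d * d) + 9 * 2 ^ d" unfolding e by (simp add: algebra_simps)
      show ?thesis unfolding 3 unfolding e using 1 2 d1 by linarith
    qed
    then show "11 \<le> N0" "6 * d + 4 + K \<le> N0" "8 * K * (d + 1) + K \<le> 3 * N0" by blast+
  qed
  have comb: "\<exists>a b. 1 \<le> a \<and> a \<le> N0 \<and> 1 \<le> b \<and> b \<le> 3 * N0 \<and>
      (\<forall>v\<in>V. \<not> F.el v f \<or> \<not> F.el v g \<longrightarrow> \<not> F.el v (f [^]\<^bsub>P\<^esub> (b::nat) \<otimes>\<^bsub>P\<^esub> g [^]\<^bsub>P\<^esub> (a::nat)))"
    if fg: "f \<in> carrier P" "g \<in> carrier P" for f g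
  proof -
    have "\<exists>a b. 1 \<le> a \<and> a \<le> 6 * d + 4 + K \<and> 1 \<le> b \<and> b \<le> 8 * K * (d + 1) + K \<and>
      (\<forall>v\<in>V. \<not> F.el v f \<or> \<not> F.el v g \<longrightarrow> \<not> F.el v (f [^]\<^bsub>P\<^esub> (b::nat) \<otimes>\<^bsub>P\<^esub> g [^]\<^bsub>P\<^esub> (a::nat)))"
      by (rule F.combine[OF fg K1 d1 block[OF fg] block[OF fg(2,1)]]) (use dim in blast)
    then obtain a b where ab: "1 \<le> a" "a \<le> 6 * d + 4 + K" "1 \<le> b" "b \<le> 8 * K * (d + 1) + K"
      "\<forall>v\<in>V. \<not> F.el v f \<or> \<not> F.el v g \<longrightarrow> \<not> F.el v (f [^]\<^bsub>P\<^esub> (b::nat) \<otimes>\<^bsub>P\<^esub> g [^]\<^bsub>P\<^esub> (a::nat))"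
      by (elim exE conjE)
    show ?thesis
      by (rule exI[of _ a], rule exI[of _ b], intro conjI ab(1,3,5))
        (use ab(2,4) N0(2,3) in linarith)+
  qed
  have main: "\<exists>n y. 1 \<le> n \<and> n \<le> N \<and> y \<in> set_power P U n \<and> (\<forall>v\<in>L. \<not> F.el v y)"
    if "x \<in> generate P U" "L \<subseteq> V" "L \<noteq> {}" "\<forall>v\<in>L. \<not> F.el v x" for x L
    unfolding N k_def
  proof (rule F.uniform_element[OF U_sub N0(1) _ that(1-3)])
    fix f g assume "f \<in> carrier P" "g \<in> carrier P"
    then show "\<exists>a b. 1 \<le> a \<and> a \<le> N0 \<and> 1 \<le> b \<and> b \<le> 3 * N0 \<and>
      (\<forall>v\<in>V. \<not> F.el v f \<or> \<not> F.el v g \<longrightarrow> \<not> F.el v (f [^]\<^bsub>P\<^esub> (b::nat) \<otimes>\<^bsub>P\<^esub> g [^]\<^bsub>P\<^esub> (a::nat)))"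
      by (rule comb)
  next
    fix v assume "v \<in> L"
    then show "\<not> F.el v x" using that(4) by simp
  qed
  show ?thesis
  proof (intro conjI impI)
    assume "\<exists>x \<in> generate P U. regular V E G x"
    then obtain x where x: "x \<in> generate P U" "regular V E G x" by blast
    obtain L where L: "L \<subseteq> V" "L \<noteq> {}" "\<forall>v\<in>L. \<not> F.el v x"
      "\<forall>y\<in>carrier P. (\<forall>v\<in>L. \<not> F.el v y) \<longrightarrow> regular V E G y"
      using regular_witness[OF x(2)] by (elim exE conjE)
    obtain n y where ny: "1 \<le> n" "n \<le> N" "y \<in> set_power P U n" "\<forall>v\<in>L. \<not> F.el v y"
      using main[OF x(1) L(1-3)] by (elim exE conjE)
    have "regular V E G y" using L(4) F.set_power_carrier[OF U_sub ny(3)] ny(4) by simp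
    then show "\<exists>n. 1 \<le> n \<and> n \<le> N \<and> (\<exists>y \<in> set_power P U n. regular V E G y)"
      using ny(1-3) by (intro exI[of _ n]) auto
  next
    assume "\<exists>x \<in> generate P U. strongly_irreducible V E G x"
    then obtain x where x: "x \<in> generate P U" "strongly_irreducible V E G x" by blast
    obtain L where L: "L \<subseteq> V" "L \<noteq> {}" "\<forall>v\<in>L. \<not> F.el v x"
      "\<forall>y\<in>carrier P. (\<forall>v\<in>L. \<not> F.el v y) \<longrightarrow> strongly_irreducible V E G y"
      using strongly_irreducible_witness[OF x(2)] by (elim exE conjE)
    obtain n y where ny: "1 \<le> n" "n \<le> N" "y \<in> set_power P U n" "\<forall>v\<in>L. \<not> F.el v y"
      using main[OF x(1) L(1-3)] by (elim exE conjE)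
    have "strongly_irreducible V E G y" using L(4) F.set_power_carrier[OF U_sub ny(3)] ny(4) by simp
    then show "\<exists>n. 1 \<le> n \<and> n \<le> N \<and> (\<exists>y \<in> set_power P U n. strongly_irreducible V E G y)"
      using ny(1-3) by (intro exI[of _ n]) auto
  qed
qed

end
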